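(* Let $X$ be a separable Banach space and let $f:X\to\mathbb{R}$ be strictly quasiconvex and densely continuous. Set $m:=\mathcal{T}\operatorname{ess\,inf}_X f$. Then $F'_m$ is nowhere dense and $f$ is Hadamard differentiable on a dense open subset of $X$ except at the points of an Aronszajn null set. Furthermore: (i) If $F'_m$ is contained in an Aronszajn null (resp. Haar null) set, then $f$ is Hadamard differentiable on $X$ except at the points of an Aronszajn null (resp. Haar null) set. (ii) If $X$ is reflexive, $f$ is Hadamard differentiable on $X$ except at the points of a Haar null set.
   Context: Banach spaces are real. A function $f:X\to\mathbb{R}$ is strictly quasiconvex if $f(\lambda x+(1-\lambda)y)<\max\{f(x),f(y)\}$ whenever $x\neq y$ and $\lambda\in(0,1)$. It is densely continuous if it is continuous at the points of a dense subset of $X$. For $\alpha\in\mathbb{R}\cup\{-\infty\}$, $F_\alpha:=\{x\in X:f(x)<\alpha\}$ and $F'_\alpha:=\{x\in X:f(x)\le\alpha\}$ (both empty for $\alpha=-\infty$). First category means a countable union of nowhere dense subsets of $X$; second category means not of first category. The topological essential infimum is $\mathcal{T}\operatorname{ess\,inf}_X f:=\sup\{\alpha\in\mathbb{R}:F_\alpha\text{ is of first category}\}=\inf\{\alpha\in\mathbb{R}:F_\alpha\text{ is of second category}\}\in[-\infty,\infty)$. $f$ is Gâteaux differentiable at $x$ with derivative $Df(x)\in X^*$ if $Df(x)h=\lim_{t\to0}\frac{f(x+th)-f(x)}{t}$ for every $h\in X$; it is Hadamard differentiable at $x$ if moreover the limit is uniform for $h$ in every compact subset of $X$. A Borel set $E\subset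 X$ is Aronszajn null if for every sequence $(\xi_n)\subset X$ with $\overline{\operatorname{span}}\{\xi_n\}=X$ one can write $E=\bigcup_nE_n$ with $E_n$ Borel and, for every $x\in X$, $\lambda_1((x+\mathbb{R}\xi_n)\cap E_n)=0$ ($\lambda_1$ = one-dimensional Lebesgue measure). A Borel set $E\subset X$ is Haar null if there is a Borel probability measure $\mu$ on $X$ with $\mu(x+E)=0$ for every $x\in X$. "A property holds on $S$ except at the points of an Aronszajn (Haar) null set" means that there is an Aronszajn (Haar) null set $N$ such that the property holds at every point of $S\setminus N$. *)

theory Defs
  imports "HOL-Probability.Probability"
begin

text \<open>
  A separable Banach space is a type of the classes \<open>banach\<close> and \<open>second_countable_topology\<close>. The
  next lemma states that the axiom of the second class amounts to separability in a metric space.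
\<close>

lemma second_countable_iff_separable:
  "(\<exists>B::'a::metric_space set set. countable B \<and> open = generate_topology B) \<longleftrightarrow>
   (\<exists>D::'a set. countable D \<and> closure D = UNIV)"
proof
  assume "\<exists>B::'a set set. countable B \<and> open = generate_topology B"
  then obtain B :: "'a set set" where B: "countable B" "open = generate_topology B"
    by blast
  define F where "F = {\<Inter>S |S. finite S \<and> S \<subseteq> B}"
  have "F = Inter ` {S. finite S \<and> S \<subseteq> B}"
    by (auto simp: F_def)
  then have F: "countable F"
    using B(1) by (simp add: countable_Collect_finite_subset)
  have base: "\<exists>V\<in>F. x \<in> V \<and> V \<subseteq> U" if "generate_topology B U" "x \<in> U" for x U
    using that
  proof (induction arbitrary: x)
    case UNIV
    have "\<Inter>{} \<in> F"
      unfolding F_def by blast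
    then show ?case
      by auto
  next
    case (Int a b)
    obtain S where S: "finite S" "S \<subseteq> B" "x \<in> \<Inter>S" "\<Inter>S \<subseteq> a"
      using Int.IH(1)[of x] Int.prems unfolding F_def by blast
    obtain T where T: "finite T" "T \<subseteq> B" "x \<in> \<Inter>T" "\<Inter>T \<subseteq> b"
      using Int.IH(2)[of x] Int.prems unfolding F_def by blast
    have "\<Inter>(S \<union> T) \<in> F"
      using S T unfolding F_def by blast
    moreover have "x \<in> \<Inter>(S \<union> T)" "\<Inter>(S \<union> T) \<subseteq> a \<inter> b"
      using S T by auto
    ultimately show ?case
      by blast
  next
    case (UN K)
    then obtain k where k: "k \<in> K" "x \<in> k"
      by blast
    then show ?case
      using UN.IH[of k x] by blast
  next
    case (Basis s)
    then have "\<Inter>{s} \<in> F"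
      unfolding F_def by blast
    then show ?case
      using Basis by auto
  qed
  define D where "D = (\<lambda>V. SOME x. x \<in> V) ` (F - {{}})"
  have "x \<in> closure D" for x
    unfolding closure_iff_nhds_not_empty
  proof (intro allI impI)
    fix A V
    assume "V \<subseteq> A" "open V" "x \<in> V"
    moreover from this obtain W where "W \<in> F" "x \<in> W" "W \<subseteq> V"
      using base[of V x] B(2) by auto
    moreover from this have "(SOME y. y \<in> W) \<in> W" "(SOME y. y \<in> W) \<in> D"
      by (auto simp: D_def intro: someI)
    ultimately show "D \<inter> A \<noteq> {}"
      by blast
  qed
  then show "\<exists>D::'a set. countable D \<and> closure D = UNIV"
    using F by (intro exI[of _ D]) (auto simp: D_def)
next
  assume "\<exists>D::'a set. countable D \<and> closure D = UNIV"
  then obtain D :: "'a set" where D: "countable D" "closure D = UNIV"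
    by blast
  define B where "B = (\<lambda>(d, n). ball d (inverse (real (Suc n)))) ` (D \<times> (UNIV :: nat set))"
  have "topological_basis B"
  proof (rule topological_basisI)
    fix U :: "'a set" and x
    assume "open U" "x \<in> U"
    then obtain e where e: "e > 0" "ball x e \<subseteq> U"
      by (meson open_contains_ball)
    obtain n where n: "inverse (real (Suc n)) < e / 2"
      using reals_Archimedean[of "e / 2"] e by auto
    obtain d where d: "d \<in> D" "dist d x < inverse (real (Suc n))"
      using D(2) closure_approachable[of x D]
      by (metis UNIV_I inverse_positive_iff_positive of_nat_0_less_iff zero_less_Suc)
    have "ball d (inverse (real (Suc n))) \<subseteq> ball x e"
    proof
      fix y
      assume "y \<in> ball d (inverse (real (Suc n)))"
      then show "y \<in> ball x e"
        using n d(2) dist_triangle[of x y d] by (simp add: dist_commute)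
    qed
    then show "\<exists>V\<in>B. x \<in> V \<and> V \<subseteq> U"
      using d e unfolding B_def
      by (intro bexI[of _ "ball d (inverse (real (Suc n)))"]) auto
  qed (auto simp: B_def)
  moreover have "countable B"
    using D(1) by (simp add: B_def)
  ultimately show "\<exists>B::'a set set. countable B \<and> open = generate_topology B"
    by (metis topological_basis_imp_subbasis)
qed


definition reflexive_space :: "'a::real_normed_vector itself \<Rightarrow> bool" where
  "reflexive_space _ \<longleftrightarrow>
     (\<forall>\<Phi> :: ('a \<Rightarrow>\<^sub>L real) \<Rightarrow>\<^sub>L real. \<exists>x::'a. \<forall>\<phi>. blinfun_apply \<Phi> \<phi> = blinfun_apply \<phi> x)"

definition strictly_quasiconvex :: "('a::real_vector \<Rightarrow> real) \<Rightarrow> bool" where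
  "strictly_quasiconvex f \<longleftrightarrow>
     (\<forall>x y. \<forall>c\<in>{0<..<1}. x \<noteq> y \<longrightarrow> f (c *\<^sub>R x + (1 - c) *\<^sub>R y) < max (f x) (f y))"

definition densely_continuous :: "('a::t2_space \<Rightarrow> real) \<Rightarrow> bool" where
  "densely_continuous f \<longleftrightarrow> (\<exists>D. closure D = UNIV \<and> (\<forall>x\<in>D. isCont f x))"

definition nowhere_dense :: "'a::topological_space set \<Rightarrow> bool" where
  "nowhere_dense S \<longleftrightarrow> interior (closure S) = {}"

definition first_category :: "'a::topological_space set \<Rightarrow> bool" where
  "first_category S \<longleftrightarrow> (\<exists>N :: nat \<Rightarrow> 'a set. (\<forall>n. nowhere_dense (N n)) \<and> S = (\<Union>n. N n))"


text \<open>The level \<open>\<alpha>\<close> is extended real, so that both sets are empty for \<open>\<alpha> = -\<infinity>\<close>.\<close>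

definition strict_sublevel :: "('a \<Rightarrow> real) \<Rightarrow> ereal \<Rightarrow> 'a set" where
  "strict_sublevel f \<alpha> = {x. ereal (f x) < \<alpha>}"

definition sublevel :: "('a \<Rightarrow> real) \<Rightarrow> ereal \<Rightarrow> 'a set" where
  "sublevel f \<alpha> = {x. ereal (f x) \<le> \<alpha>}"

text \<open>The supremum is taken over real \<open>\<alpha>\<close>; in \<^typ>\<open>ereal\<close>, the supremum of the empty set is \<open>-\<infinity>\<close>.\<close>

definition top_ess_inf :: "('a::topological_space \<Rightarrow> real) \<Rightarrow> ereal" where
  "top_ess_inf f = (SUP \<alpha>\<in>{\<alpha>::real. first_category (strict_sublevel f (ereal \<alpha>))}. ereal \<alpha>)"


definition has_gateaux_derivative ::
    "('a::real_normed_vector \<Rightarrow> real) \<Rightarrow> ('a \<Rightarrow>\<^sub>L real) \<Rightarrow> 'a \<Rightarrow> bool" where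
  "has_gateaux_derivative f D x \<longleftrightarrow>
     (\<forall>h. ((\<lambda>t. (f (x + t *\<^sub>R h) - f x) / t) \<longlongrightarrow> blinfun_apply D h) (at (0::real)))"

definition hadamard_differentiable :: "('a::real_normed_vector \<Rightarrow> real) \<Rightarrow> 'a \<Rightarrow> bool" where
  "hadamard_differentiable f x \<longleftrightarrow>
     (\<exists>D. has_gateaux_derivative f D x \<and>
          (\<forall>K. compact K \<longrightarrow>
             uniform_limit K (\<lambda>t h. (f (x + t *\<^sub>R h) - f x) / t) (blinfun_apply D) (at (0::real))))"


text \<open>
  The one-dimensional measure on the line \<open>x + \<real> \<xi> n\<close> is taken in the parameter \<open>t\<close>; for
  \<open>\<xi> n \<noteq> 0\<close> this only rescales it, so that the null sets are the same. For \<open>\<xi> n = 0\<close> it forces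
  \<open>E n = {}\<close>, which in a nonzero space does not affect the notion: in a sequence with dense span,
  the zero terms can be replaced by a repeated nonzero one.
\<close>

definition aronszajn_null :: "'a::real_normed_vector set \<Rightarrow> bool" where
  "aronszajn_null S \<longleftrightarrow> S \<in> sets borel \<and>
     (\<forall>\<xi> :: nat \<Rightarrow> 'a. closure (span (range \<xi>)) = UNIV \<longrightarrow>
        (\<exists>E :: nat \<Rightarrow> 'a set. (\<forall>n. E n \<in> sets borel) \<and> S = (\<Union>n. E n) \<and>
           (\<forall>n x. emeasure lborel {t::real. x + t *\<^sub>R \<xi> n \<in> E n} = 0)))"

definition haar_null :: "'a::real_normed_vector set \<Rightarrow> bool" where
  "haar_null S \<longleftrightarrow> S \<in> sets borel \<and>
     (\<exists>\<mu> :: 'a measure. sets \<mu> = sets borel \<and> prob_space \<mu> \<and>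
        (\<forall>x. emeasure \<mu> ((+) x ` S) = 0))"

definition holds_except :: "('a set \<Rightarrow> bool) \<Rightarrow> 'a set \<Rightarrow> ('a \<Rightarrow> bool) \<Rightarrow> bool" where
  "holds_except null S P \<longleftrightarrow> (\<exists>N. null N \<and> (\<forall>x\<in>S - N. P x))"

end

theory Submission
  imports Defs
begin

text \<open>
  Let \<open>m\<close> be the topological essential infimum of a strictly quasiconvex, densely continuous \<open>f\<close>, and
  write \<open>F \<alpha>\<close> for the strict sublevel sets.

  \<^emph>\<open>Above \<open>m\<close>.\<close> For \<open>\<alpha> > m\<close> the convex set \<open>F \<alpha>\<close> contains a ball, because a continuity point of \<open>f\<close> in the
  interior of the closure of a lower sublevel set of second category has a whole neighbourhood on which
  \<open>f < \<alpha>\<close> (\<open>ball_subset_strict_sublevel\<close>). By quasiconvexity the truncation \<open>max f \<alpha>\<close> does not increase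
  along segments that lead into that ball. Hence it is monotone with respect to an open cone near every
  point, and it is Hadamard differentiable off an Aronszajn null set (\<open>cone_monotone_hadamard_ae\<close>). Where
  \<open>f > \<alpha>\<close>, derivatives of the truncation are derivatives of \<open>f\<close>, and rational levels \<open>\<alpha>\<close> suffice. So \<open>f\<close> is
  Hadamard differentiable outside the union of an Aronszajn null set and the sublevel set at \<open>m\<close>
  (\<open>hadamard_ae_above_top_ess_inf\<close>). The rest of the theorem is about the size of that sublevel set.

  \<^emph>\<open>Cone-monotone functions.\<close> Every small displacement is dominated, in the order of the cone, by a
  multiple of a fixed direction \<open>e\<close> inside the cone. So the increments of the function near a point are
  controlled by its increments along \<open>e\<close>, and boundedness of the difference quotients along \<open>e\<close> is a Lipschitz
  bound at that point. On lines with directions near \<open>e\<close> the function is monotone, and a Vitali covering shows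
  that its quotients are unbounded only on a null set. At a point with a Lipschitz bound the function is
  squeezed between two Lipschitz functions from a countable family that touch it there
  (\<open>hadamard_if_pointwise_lipschitz_ae\<close>). This leaves Lipschitz functions: their directional derivatives exist
  almost everywhere on lines, and the points at which these derivatives exist but are not additive form
  countably many sets that are porous in one direction (\<open>aronszajn_null_not_hadamard_lipschitz\<close>).
  All the exceptional sets are shown to be null along a single direction; \<open>splits_along_if_null_along\<close> turns
  this into the decomposition that the definition of Aronszajn null sets asks for.

  \<^emph>\<open>The sublevel set at \<open>m\<close>.\<close> It is convex. The continuity points of \<open>f\<close> form a residual set, and \<open>f = m\<close> at all
  those that lie in the interior of the closure of the sublevel set. If this interior were nonempty, one
  such point would be the midpoint of two others, against strictness (\<open>nowhere_dense_sublevel_top_ess_inf\<close>).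

  \<^emph>\<open>Reflexive spaces.\<close> A closed convex set \<open>C\<close> with empty interior is Haar null (\<open>haar_null_closed_convex\<close>).
  Suppose that \<open>C\<close>, slightly thickened, could be translated to catch more than \<open>9/10\<close> of every finitely
  supported probability measure on a small ball. Finite game theory (\<open>multiplicative_weights\<close>) then gives, for
  every finite subset of the ball, one translate of the whole subset into a thickening of \<open>C\<close> that is thinner
  than the radius. Weak compactness extends this to the ball itself, and cancelling the thickening puts a
  ball into \<open>C\<close>. So there are measures of which no translate of \<open>C\<close> catches more than \<open>9/10\<close>; convolving such
  measures on rapidly decreasing scales improves this to \<open>(9/10) ^ k\<close>, and the law of a random series built
  from them vanishes on all translates of \<open>C\<close>. Since the closure of the sublevel set at \<open>m\<close> is of this kind,
  the reflexive case follows from the case in which the sublevel set lies in a Haar null set.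
\<close>

section \<open>Covering estimates on the real line\<close>

lemma null_on_lborel_iff_negligible:
  fixes N :: "'a::euclidean_space set"
  assumes "N \<in> sets borel"
  shows "emeasure lborel N = 0 \<longleftrightarrow> negligible N"
  using assms
  by (metis completion.complete2 null_sets_completion_iff negligible_iff_null_sets null_setsD1 null_setsI
        sets_lborel subset_refl)

lemma countable_INT_open_borel:
  fixes A :: "nat \<Rightarrow> 'a::topological_space set"
  assumes "\<And>n. open (A n)"
  shows "(\<Inter>n. A n) \<in> sets borel"
  using assms by (intro sets.countable_INT) auto

lemma cball_midpoint:
  fixes u v :: real
  shows "cball ((u + v) / 2) ((v - u) / 2) = {u..v}"
  by (auto simp: cball_eq_atLeastAtMost field_simps)

text \<open>
  A form of the Vitali covering theorem that yields both porosity and stretching estimates: it compares a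
  measure \<open>\<nu>\<close> with Lebesgue measure when \<open>\<nu>\<close> is small on arbitrarily short intervals around each point of \<open>E\<close>.
  Disjoint intervals of this kind exhaust \<open>E\<close> up to a Lebesgue null set, which is also \<open>\<nu>\<close>-null.
\<close>
lemma measure_le_if_fine_cover:
  fixes \<nu> :: "real measure"
  assumes sets_\<nu>: "sets \<nu> = sets borel" and ac: "absolutely_continuous lborel \<nu>"
    and E: "E \<in> sets borel" "emeasure lborel E < \<infinity>" and r: "0 \<le> r"
    and fine: "\<And>x d. x \<in> E \<Longrightarrow> 0 < d \<Longrightarrow>
      \<exists>u v. u < v \<and> u \<le> x \<and> x \<le> v \<and> v - u < d \<and> emeasure \<nu> {u..v} \<le> ennreal (r * (v - u))"
  shows "emeasure \<nu> E \<le> ennreal r * emeasure lborel E"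
proof (rule ennreal_le_epsilon)
  fix e :: real
  assume e: "0 < e"
  define e' where "e' = e / (r + 1)"
  have e': "e' > 0" "r * e' \<le> e"
    using e r by (auto simp: e'_def field_simps)
  obtain U where U: "open U" "E \<subseteq> U" "emeasure lborel (U - E) < ennreal e'"
    using outer_regular_lborel[OF _ e'(1), of E] E(1) by auto
  have mU: "emeasure lborel U \<le> emeasure lborel E + ennreal e'"
  proof -
    have "emeasure lborel U = emeasure lborel (E \<union> (U - E))"
      using U(2) by (intro arg_cong[where f = "emeasure lborel"]) auto
    also have "\<dots> \<le> emeasure lborel E + emeasure lborel (U - E)"
      using U(1) E by (intro emeasure_subadditive) auto
    also have "\<dots> \<le> emeasure lborel E + ennreal e'"
      using U(3) by (intro add_left_mono) auto
    finally show ?thesis .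
  qed
  define K where "K = {(u, v). u < v \<and> {u..v} \<subseteq> U \<and> emeasure \<nu> {u..v} \<le> ennreal (r * (v - u))}"
  define I where "I = (\<lambda>(u, v). {u..v :: real})"
  have I: "cball ((fst i + snd i) / 2) ((snd i - fst i) / 2) = I i" for i
    by (cases i) (simp add: I_def cball_midpoint)
  obtain C where C: "countable C" "C \<subseteq> K"
      "pairwise (\<lambda>i j. disjnt (I i) (I j)) C" "negligible (E - (\<Union>i\<in>C. I i))"
  proof (rule Vitali_covering_theorem_cballs
      [of K "\<lambda>i. (snd i - fst i) / 2" E "\<lambda>i. (fst i + snd i) / 2", unfolded I])
    fix i
    assume "i \<in> K"
    then show "0 < (snd i - fst i) / 2"
      by (auto simp: K_def)
  next
    fix x d :: real
    assume x: "x \<in> E" "0 < d"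
    obtain d' where d': "d' > 0" "ball x d' \<subseteq> U"
      using x U by (meson open_contains_ball subsetD)
    obtain u v where uv: "u < v" "u \<le> x" "x \<le> v" "v - u < min d d'"
        "emeasure \<nu> {u..v} \<le> ennreal (r * (v - u))"
      using fine[OF x(1), of "min d d'"] x(2) d'(1) by auto
    have "{u..v} \<subseteq> U"
      using uv d'(2) by (auto simp: subset_iff dist_real_def)
    then show "\<exists>i. i \<in> K \<and> x \<in> I i \<and> (snd i - fst i) / 2 < d"
      using uv by (intro exI[of _ "(u, v)"]) (auto simp: K_def I_def)
  qed blast
  have mI: "I i \<in> sets borel" for i
    by (cases i) (auto simp: I_def)
  have disj: "disjoint_family_on I C"
    using C(3) by (auto simp: disjoint_family_on_def pairwise_def disjnt_def)
  have mUn: "(\<Union>i\<in>C. I i) \<in> sets borel"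
    using C(1) mI by auto
  have "E - (\<Union>i\<in>C. I i) \<in> null_sets lborel"
    using C(4) E(1) mUn null_on_lborel_iff_negligible[of "E - (\<Union>i\<in>C. I i)"] by auto
  then have null: "emeasure \<nu> (E - (\<Union>i\<in>C. I i)) = 0"
    using ac by (auto simp: absolutely_continuous_def)
  have "emeasure \<nu> E \<le> emeasure \<nu> ((E - (\<Union>i\<in>C. I i)) \<union> (\<Union>i\<in>C. I i))"
    using E(1) mUn sets_\<nu> by (intro emeasure_mono) auto
  also have "\<dots> \<le> emeasure \<nu> (E - (\<Union>i\<in>C. I i)) + emeasure \<nu> (\<Union>i\<in>C. I i)"
    using E(1) mUn sets_\<nu> by (intro emeasure_subadditive) auto
  also have "\<dots> = (\<integral>\<^sup>+i. emeasure \<nu> (I i) \<partial>count_space C)"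
    using null mI sets_\<nu> C(1) disj by (simp add: emeasure_UN_countable)
  also have "\<dots> \<le> (\<integral>\<^sup>+i. ennreal r * emeasure lborel (I i) \<partial>count_space C)"
  proof (intro nn_integral_mono)
    fix i
    assume "i \<in> space (count_space C)"
    then have "i \<in> K"
      using C(2) by auto
    then show "emeasure \<nu> (I i) \<le> ennreal r * emeasure lborel (I i)"
      using r by (auto simp: K_def I_def ennreal_mult)
  qed
  also have "\<dots> = ennreal r * emeasure lborel (\<Union>i\<in>C. I i)"
    using mI C(1) disj by (simp add: nn_integral_cmult emeasure_UN_countable)
  also have "\<dots> \<le> ennreal r * emeasure lborel U"
    using C(2) U(1) by (intro mult_left_mono emeasure_mono) (auto simp: K_def I_def)
  also have "\<dots> \<le> ennreal r * (emeasure lborel E + ennreal e')"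
    using mU by (intro mult_left_mono) auto
  also have "\<dots> = ennreal r * emeasure lborel E + ennreal (r * e')"
    using r e'(1) by (simp add: distrib_left ennreal_mult)
  also have "\<dots> \<le> ennreal r * emeasure lborel E + ennreal e"
    using e'(2) by (intro add_left_mono ennreal_leI)
  finally show "emeasure \<nu> E \<le> ennreal r * emeasure lborel E + ennreal e" .
qed

lemma null_set_if_null_on_bounded_parts:
  fixes A :: "real set"
  assumes "A \<in> sets borel" and "\<And>n::nat. emeasure lborel (A \<inter> {- real n..real n}) = 0"
  shows "emeasure lborel A = 0"
proof -
  have "A = (\<Union>n::nat. A \<inter> {- real n..real n})"
  proof -
    have "\<exists>n::nat. - real n \<le> x \<and> x \<le> real n" for x
      using real_arch_simple[of "\<bar>x\<bar>"] by (metis abs_le_D1 abs_le_D2 minus_le_iff)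
    then show ?thesis
      by auto
  qed
  moreover have "(\<Union>n::nat. A \<inter> {- real n..real n}) \<in> null_sets lborel"
    using assms by (intro null_sets_UN) auto
  ultimately show ?thesis
    by (metis null_setsD1)
qed

lemma finite_emeasure_bounded_part:
  fixes A :: "real set"
  shows "emeasure lborel (A \<inter> {- c..c}) < \<infinity>"
proof -
  have "emeasure lborel (A \<inter> {- c..c}) \<le> emeasure lborel {- c..c}"
    by (intro emeasure_mono) auto
  then show ?thesis
    by (cases "- c \<le> c") (auto simp: order_le_less_trans)
qed

lemma ennreal_eq_0_if_le_fraction:
  assumes "x < \<infinity>" "x \<le> ennreal q * x" "0 \<le> q" "q < 1"
  shows "x = 0"
proof -
  obtain b where b: "x = ennreal b" "0 \<le> b"
    using assms(1) by (cases x) auto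
  then have "b \<le> q * b"
    using assms(2,3) by (simp add: ennreal_mult[symmetric] ennreal_le_iff)
  then have "b = 0"
    using assms(4) b(2) mult_strict_right_mono[of q 1 b] by fastforce
  then show ?thesis
    by (simp add: b(1))
qed

text \<open>
  In the interval around \<open>x\<close> that reaches just beyond the hole, the hole takes up the fraction \<open>c / (1 + c)\<close>.
  So \<open>A\<close> has density at most \<open>1 / (1 + c) < 1\<close> on arbitrarily short intervals around each of its points, which
  forces its measure to be at most a proper fraction of itself.
\<close>
lemma porous_set_null:
  fixes A :: "real set"
  assumes A: "A \<in> sets borel" and c: "0 < c"
    and porous: "\<And>x d. x \<in> A \<Longrightarrow> 0 < d \<Longrightarrow>
      \<exists>t. t \<noteq> 0 \<and> \<bar>t\<bar> < d \<and> ball (x + t) (c * \<bar>t\<bar>) \<inter> A = {}"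
  shows "emeasure lborel A = 0"
proof (rule null_set_if_null_on_bounded_parts[OF A])
  fix n :: nat
  define B where "B = A \<inter> {- real n..real n}"
  have B: "B \<in> sets borel"
    using A by (simp add: B_def)
  have fin: "emeasure lborel B < \<infinity>"
    unfolding B_def by (rule finite_emeasure_bounded_part)
  define \<nu> where "\<nu> = density lborel (indicator B)"
  have \<nu>: "emeasure \<nu> S = emeasure lborel (B \<inter> S)" if "S \<in> sets borel" for S
    using that B by (simp add: \<nu>_def emeasure_density indicator_inter_arith[symmetric])
  define q where "q = 1 / (1 + c)"
  have q: "0 \<le> q" "q < 1"
    using c by (auto simp: q_def)
  have "emeasure \<nu> B \<le> ennreal q * emeasure lborel B"
  proof (rule measure_le_if_fine_cover)
    show "absolutely_continuous lborel \<nu>"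
      unfolding \<nu>_def using B by (intro absolutely_continuousI_density) auto
    fix x d :: real
    assume x: "x \<in> B" "0 < d"
    define d' where "d' = d / (2 * (1 + c))"
    have d': "d' > 0" "2 * (1 + c) * d' = d"
      using x(2) c by (auto simp: d'_def)
    obtain t where t: "t \<noteq> 0" "\<bar>t\<bar> < d'" "ball (x + t) (c * \<bar>t\<bar>) \<inter> A = {}"
      using porous[of x d'] x d'(1) by (auto simp: B_def)
    define \<rho> where "\<rho> = (1 + c) * \<bar>t\<bar>"
    have \<rho>: "\<rho> > 0" "2 * \<rho> < d"
    proof -
      have "2 * (1 + c) * \<bar>t\<bar> < 2 * (1 + c) * d'"
        using t(2) c by (intro mult_strict_left_mono) auto
      then show "2 * \<rho> < d"
        using d'(2) by (simp only: \<rho>_def mult.assoc)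
    qed (use t(1) c in \<open>auto simp: \<rho>_def\<close>)
    have sub: "ball (x + t) (c * \<bar>t\<bar>) \<subseteq> {x - \<rho>..x + \<rho>}"
    proof
      fix y
      assume "y \<in> ball (x + t) (c * \<bar>t\<bar>)"
      then have "\<bar>y - x\<bar> \<le> \<rho>"
        by (simp add: \<rho>_def dist_real_def distrib_right)
      then show "y \<in> {x - \<rho>..x + \<rho>}"
        by auto
    qed
    have "emeasure \<nu> {x - \<rho>..x + \<rho>} = emeasure lborel (B \<inter> {x - \<rho>..x + \<rho>})"
      by (simp add: \<nu>)
    also have "\<dots> \<le> emeasure lborel ({x - \<rho>..x + \<rho>} - ball (x + t) (c * \<bar>t\<bar>))"
      using t(3) by (intro emeasure_mono) (auto simp: B_def)
    also have "\<dots> = emeasure lborel {x - \<rho>..x + \<rho>} - emeasure lborel (ball (x + t) (c * \<bar>t\<bar>))"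
      using sub c by (intro emeasure_Diff) (auto simp: ball_eq_greaterThanLessThan)
    also have "\<dots> = ennreal (2 * \<rho>) - ennreal (2 * c * \<bar>t\<bar>)"
      using \<rho> c by (simp add: ball_eq_greaterThanLessThan algebra_simps)
    also have "\<dots> = ennreal (2 * \<bar>t\<bar>)"
      using c by (subst ennreal_minus) (auto simp: \<rho>_def algebra_simps)
    also have "2 * \<bar>t\<bar> = q * ((x + \<rho>) - (x - \<rho>))"
      using c by (simp add: q_def \<rho>_def field_simps)
    finally show "\<exists>u v. u < v \<and> u \<le> x \<and> x \<le> v \<and> v - u < d \<and>
        emeasure \<nu> {u..v} \<le> ennreal (q * (v - u))"
      using \<rho> by (intro exI[of _ "x - \<rho>"] exI[of _ "x + \<rho>"]) auto
  qed (use B fin q in \<open>auto simp: \<nu>_def\<close>)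
  then have "emeasure lborel B \<le> ennreal q * emeasure lborel B"
    by (simp add: \<nu> B)
  from ennreal_eq_0_if_le_fraction[OF fin this q]
  show "emeasure lborel (A \<inter> {- real n..real n}) = 0"
    by (simp add: B_def)
qed

text \<open>
  Where a monotone function has steep increments at all scales, short intervals are paid for by increments
  of the function. For disjoint intervals \<open>{s - t..s + t}\<close> the image intervals \<open>{G (s - t)<..<G (s + t)}\<close> are
  disjoint too, so their total length is at most the total increment of \<open>G\<close>, and the intervals themselves have
  total length \<open>O(1 / k)\<close>.
\<close>
lemma null_set_monotone_infinite_derivate:
  fixes G :: "real \<Rightarrow> real"
  assumes mono: "mono_on {a'..b'} G" and ab: "a' < a" "b < b'"
    and S: "\<And>s k. s \<in> S \<Longrightarrow> a \<le> s \<and> s \<le> b \<and>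
       (\<exists>t. 0 < t \<and> t * real (Suc k) < 1 \<and> G (s + t) - G (s - t) > real (Suc k) * t)"
    and meas: "S \<in> sets borel"
  shows "emeasure lborel S = 0"
proof -
  define D where "D = max 0 (G b' - G a')"
  have D: "D \<ge> 0"
    by (simp add: D_def)
  have bound: "emeasure lborel S \<le> ennreal (2 * D / real (Suc k))"
    if k: "1 < real (Suc k) * (a - a')" "1 < real (Suc k) * (b' - b)" for k
  proof -
    define K where "K = {(s, t). 0 < t \<and> a' \<le> s - t \<and> s + t \<le> b' \<and> G (s + t) - G (s - t) > real (Suc k) * t}"
    define I where "I = (\<lambda>(s, t). {s - t..s + t :: real})"
    have I: "cball (fst i) (snd i) = I i" for i
      by (cases i) (simp add: I_def cball_eq_atLeastAtMost)
    obtain C where C: "countable C" "C \<subseteq> K"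
        "pairwise (\<lambda>i j. disjnt (I i) (I j)) C" "negligible (S - (\<Union>i\<in>C. I i))"
    proof (rule Vitali_covering_theorem_cballs[of K snd S fst, unfolded I])
      fix i
      assume "i \<in> K"
      then show "0 < snd i"
        by (auto simp: K_def)
    next
      fix x d :: real
      assume x: "x \<in> S" "0 < d"
      obtain j :: nat where j: "1 / d < real j"
        using reals_Archimedean2 by blast
      define l where "l = max j k"
      have l: "1 < real (Suc l) * d" "real (Suc k) \<le> real (Suc l)"
      proof -
        have "1 < real j * d"
          using j x(2) by (simp add: field_simps)
        also have "\<dots> \<le> real (Suc l) * d"
          using x(2) by (intro mult_right_mono) (auto simp: l_def)
        finally show "1 < real (Suc l) * d" .
      qed (auto simp: l_def)
      obtain t where t: "0 < t" "t * real (Suc l) < 1" "G (x + t) - G (x - t) > real (Suc l) * t"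
        using S[OF x(1), of l] by auto
      have ax: "a \<le> x" "x \<le> b"
        using S[OF x(1), of l] by auto
      have "t * real (Suc k) \<le> t * real (Suc l)"
        using l(2) t(1) by (intro mult_left_mono) auto
      then have tk: "t * real (Suc k) < 1" "G (x + t) - G (x - t) > real (Suc k) * t"
        using t(2,3) by (auto simp: mult.commute)
      have "t < d"
        using less_trans[OF t(2) l(1)] by (simp add: mult.commute[of "real (Suc l)"] mult_less_cancel_right del: of_nat_Suc)
      moreover have "t < a - a'" "t < b' - b"
        using less_trans[OF tk(1) k(1)] less_trans[OF tk(1) k(2)]
        by (simp_all add: mult.commute[of "real (Suc k)"] mult_less_cancel_right del: of_nat_Suc)
      ultimately show "\<exists>i. i \<in> K \<and> x \<in> I i \<and> snd i < d"
        using tk t(1) ax by (intro exI[of _ "(x, t)"]) (auto simp: K_def I_def)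
    qed blast
    define J where "J = (\<lambda>(s, t). {G (s - t)<..<G (s + t)})"
    have mI: "I i \<in> sets borel" "J i \<in> sets borel" for i
      by (cases i; auto simp: I_def J_def)+
    have disj: "disjoint_family_on I C"
      using C(3) by (auto simp: disjoint_family_on_def pairwise_def disjnt_def)
    have G: "G x \<le> G y" if "x \<le> y" "a' \<le> x" "y \<le> b'" for x y
      using mono that by (auto simp: mono_on_def)
    have disjJ: "disjoint_family_on J C"
      unfolding disjoint_family_on_def
    proof (intro ballI impI)
      fix i j
      assume ij: "i \<in> C" "j \<in> C" "i \<noteq> j"
      obtain s t s' t' where st: "i = (s, t)" "j = (s', t')"
        by (cases i; cases j) auto
      have K: "(s, t) \<in> K" "(s', t') \<in> K"
        using ij C(2) st by auto
      have "{s - t..s + t} \<inter> {s' - t'..s' + t'} = {}"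
        using disj[unfolded disjoint_family_on_def, rule_format, OF ij] by (simp add: I_def st)
      then have "s + t < s' - t' \<or> s' + t' < s - t"
        using K by (auto simp: K_def Int_atLeastAtMost)
      then have "G (s + t) \<le> G (s' - t') \<or> G (s' + t') \<le> G (s - t)"
        using K by (auto simp: K_def intro!: G)
      then show "J i \<inter> J j = {}"
        by (auto simp: J_def st)
    qed
    have mUn: "(\<Union>i\<in>C. I i) \<in> sets borel"
      using C(1) mI by auto
    have null: "emeasure lborel (S - (\<Union>i\<in>C. I i)) = 0"
      using C(4) meas mUn null_on_lborel_iff_negligible[of "S - (\<Union>i\<in>C. I i)"] by auto
    have "emeasure lborel S \<le> emeasure lborel ((S - (\<Union>i\<in>C. I i)) \<union> (\<Union>i\<in>C. I i))"
      using meas mUn by (intro emeasure_mono) auto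
    also have "\<dots> \<le> emeasure lborel (S - (\<Union>i\<in>C. I i)) + emeasure lborel (\<Union>i\<in>C. I i)"
      using meas mUn by (intro emeasure_subadditive) auto
    also have "\<dots> = (\<integral>\<^sup>+i. emeasure lborel (I i) \<partial>count_space C)"
      using null mI C(1) disj by (simp add: emeasure_UN_countable)
    also have "\<dots> \<le> (\<integral>\<^sup>+i. ennreal (2 / real (Suc k)) * emeasure lborel (J i) \<partial>count_space C)"
    proof (intro nn_integral_mono)
      fix i
      assume "i \<in> space (count_space C)"
      then have iK: "i \<in> K"
        using C(2) by auto
      obtain s t where st: "i = (s, t)"
        by (cases i)
      have *: "0 < t" "G (s + t) - G (s - t) > real (Suc k) * t"
        using iK st by (auto simp: K_def)
      have "0 < real (Suc k) * t"
        using *(1) by simp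
      then have pos: "0 \<le> G (s + t) - G (s - t)"
        using *(2) by linarith
      have "2 * t \<le> 2 / real (Suc k) * (G (s + t) - G (s - t))"
        using *(2) by (simp add: field_simps)
      then have "ennreal (2 * t) \<le> ennreal (2 / real (Suc k)) * ennreal (G (s + t) - G (s - t))"
        using * pos by (subst ennreal_mult[symmetric]) (auto intro!: ennreal_leI)
      then show "emeasure lborel (I i) \<le> ennreal (2 / real (Suc k)) * emeasure lborel (J i)"
        using * pos by (simp add: I_def J_def st)
    qed
    also have "\<dots> = ennreal (2 / real (Suc k)) * emeasure lborel (\<Union>i\<in>C. J i)"
      using mI C(1) disjJ by (simp add: nn_integral_cmult emeasure_UN_countable)
    also have "\<dots> \<le> ennreal (2 / real (Suc k)) * emeasure lborel {G a'..G a' + D}"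
    proof (intro mult_left_mono emeasure_mono)
      show "(\<Union>i\<in>C. J i) \<subseteq> {G a'..G a' + D}"
      proof (rule UN_least)
        fix i
        assume "i \<in> C"
        then have iK: "i \<in> K"
          using C(2) by auto
        obtain s t where st: "i = (s, t)"
          by (cases i)
        have "G a' \<le> G (s - t)" "G (s + t) \<le> G b'"
          using iK st by (auto simp: K_def intro!: G)
        then show "J i \<subseteq> {G a'..G a' + D}"
          by (auto simp: J_def st D_def)
      qed
    qed auto
    also have "\<dots> = ennreal (2 * D / real (Suc k))"
      using D by (simp add: ennreal_mult[symmetric])
    finally show ?thesis .
  qed
  have lim: "(\<lambda>k. 2 * D / real (Suc k)) \<longlonglongrightarrow> 0"
    using LIMSEQ_Suc[OF tendsto_divide_0[OF tendsto_const filterlim_at_top_imp_at_infinity[OF filterlim_real_sequentially]]]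
    by auto
  have lim': "(\<lambda>k. ennreal (2 * D / real (Suc k))) \<longlonglongrightarrow> ennreal 0"
    by (intro tendsto_ennrealI lim)
  have large: "eventually (\<lambda>k. 1 < real (Suc k) * c) sequentially" if "c > 0" for c :: real
  proof -
    have "filterlim (\<lambda>k. real (Suc k) * c) at_top sequentially"
      using that filterlim_tendsto_pos_mult_at_top[OF tendsto_const that
        filterlim_compose[OF filterlim_real_sequentially filterlim_Suc]]
      by (simp add: mult.commute del: of_nat_Suc)
    then show ?thesis
      by (simp add: filterlim_at_top_dense)
  qed
  have "eventually (\<lambda>k. emeasure lborel S \<le> ennreal (2 * D / real (Suc k))) sequentially"
    using eventually_conj[OF large[of "a - a'"] large[of "b' - b"]] ab
    by (auto elim!: eventually_mono simp del: of_nat_Suc intro!: bound)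
  then have "emeasure lborel S \<le> ennreal 0"
    by (rule tendsto_lowerbound[OF lim']) auto
  then show ?thesis
    by simp
qed

text \<open>
  The measure of images under \<open>F\<close> is the image of Lebesgue measure under the inverse \<open>G\<close>; this makes the
  covering estimate applicable.
\<close>
lemma emeasure_bilipschitz_image_le:
  fixes F G :: "real \<Rightarrow> real"
  assumes inv: "\<And>x. G (F x) = x" "\<And>y. F (G y) = y"
    and lip: "M-lipschitz_on UNIV F" and cont: "continuous_on UNIV G"
    and E: "E \<in> sets borel" "emeasure lborel E < \<infinity>" and r: "0 \<le> r"
    and mono: "strict_mono F"
    and fine: "\<And>x d. x \<in> E \<Longrightarrow> 0 < d \<Longrightarrow>
      \<exists>u v. u < v \<and> u \<le> x \<and> x \<le> v \<and> v - u < d \<and> F v - F u \<le> r * (v - u)"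
  shows "emeasure lborel (F ` E) \<le> ennreal r * emeasure lborel E"
proof -
  have image: "F ` S = G -` S" for S
    using inv by (auto simp: image_iff) metis
  have G: "G \<in> borel_measurable borel"
    using cont by (rule borel_measurable_continuous_onI)
  define \<nu> where "\<nu> = distr lborel borel G"
  have \<nu>: "emeasure \<nu> S = emeasure lborel (F ` S)" if "S \<in> sets borel" for S
    using that G by (simp add: \<nu>_def emeasure_distr image)
  have "emeasure \<nu> E \<le> ennreal r * emeasure lborel E"
  proof (rule measure_le_if_fine_cover)
    show "absolutely_continuous lborel \<nu>"
      unfolding absolutely_continuous_def
    proof
      fix N :: "real set"
      assume N: "N \<in> null_sets lborel"
      then have "N \<in> sets borel" "negligible N"
        using null_on_lborel_iff_negligible[of N] by (auto simp: null_sets_def)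
      moreover have "negligible (F ` N)"
        by (rule negligible_locally_Lipschitz_image[OF _ \<open>negligible N\<close>])
           (use lip in \<open>auto simp: lipschitz_on_def dist_real_def norm_minus_commute intro!: exI[of _ UNIV] exI[of _ M]\<close>)
      moreover have "F ` N \<in> sets borel"
        using measurable_sets[OF G \<open>N \<in> sets borel\<close>] by (simp add: image)
      ultimately show "N \<in> null_sets \<nu>"
        using null_on_lborel_iff_negligible[of "F ` N"] by (auto simp: null_sets_def \<nu>) (simp add: \<nu>_def)
    qed
    fix x d :: real
    assume "x \<in> E" "0 < d"
    then obtain u v where uv: "u < v" "u \<le> x" "x \<le> v" "v - u < d" "F v - F u \<le> r * (v - u)"
      using fine by blast
    have "F ` {u..v} = {F u..F v}"
    proof -
      have "y \<in> F ` {u..v}" if "F u \<le> y" "y \<le> F v" for y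
        using that inv(2)[of y] strict_mono_less_eq[OF mono, of u "G y"] strict_mono_less_eq[OF mono, of "G y" v]
        by (intro image_eqI[of _ _ "G y"]) auto
      then show ?thesis
        using strict_mono_less_eq[OF mono] by auto
    qed
    then have "emeasure \<nu> {u..v} = ennreal (F v - F u)"
      using uv(1) strict_monoD[OF mono uv(1)] by (simp add: \<nu>)
    then show "\<exists>u v. u < v \<and> u \<le> x \<and> x \<le> v \<and> v - u < d \<and> emeasure \<nu> {u..v} \<le> ennreal (r * (v - u))"
      using uv by (intro exI[of _ u] exI[of _ v]) (auto intro: ennreal_leI)
  qed (use E r in \<open>auto simp: \<nu>_def\<close>)
  then show ?thesis
    using E by (simp add: \<nu>)
qed

text \<open>
  Adding a linear function makes \<open>h\<close> a bi-Lipschitz homeomorphism \<open>F\<close>. If \<open>r < R\<close> and \<open>E\<close> is a set of points with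
  difference quotients below \<open>r\<close> and above \<open>R\<close> at all scales, the stretching estimate for \<open>F\<close> gives
  \<open>|F(E)| \<le> r |E|\<close>, and the same estimate for the inverse of \<open>F\<close> gives \<open>|E| \<le> |F(E)| / R\<close>. So \<open>|E| = 0\<close>.
\<close>
lemma lipschitz_real_differentiable_ae:
  fixes h :: "real \<Rightarrow> real"
  assumes lip: "L-lipschitz_on UNIV h"
  shows "negligible {s. \<not> (\<exists>d. ((\<lambda>t. (h (s + t) - h s) / t) \<longlongrightarrow> d) (at 0))}"
proof -
  have L: "L \<ge> 0" "\<bar>h x - h y\<bar> \<le> L * \<bar>x - y\<bar>" for x y
    using lip by (auto simp: lipschitz_on_def dist_real_def)
  define F where "F = (\<lambda>x. h x + (L + 1) * x)"
  define M where "M = 2 * L + 1"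
  have M: "M > 0"
    using L(1) by (simp add: M_def)
  have F: "y - x \<le> F y - F x" "F y - F x \<le> M * (y - x)" if "x \<le> y" for x y
    using L(2)[of y x] that by (auto simp: F_def M_def algebra_simps abs_le_iff)
  have mono: "strict_mono F"
  proof (rule strict_monoI)
    fix x y :: real
    assume "x < y"
    then show "F x < F y"
      using F(1)[of x y] by linarith
  qed
  have contF: "continuous_on UNIV F"
    unfolding F_def using lipschitz_on_continuous_on[OF lip] by (intro continuous_intros)
  have "surj F"
    unfolding surj_def
  proof
    fix y
    have "F (- \<bar>y - F 0\<bar>) \<le> y" "y \<le> F \<bar>y - F 0\<bar>"
      using F(1)[of "- \<bar>y - F 0\<bar>" 0] F(1)[of 0 "\<bar>y - F 0\<bar>"] by auto
    then show "\<exists>x. y = F x"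
      using IVT'[of F "- \<bar>y - F 0\<bar>" y "\<bar>y - F 0\<bar>"] continuous_on_subset[OF contF] by auto
  qed
  define G where "G = inv F"
  have inv: "G (F x) = x" "F (G y) = y" for x y
    using strict_mono_imp_inj_on[OF mono, of UNIV] \<open>surj F\<close> by (auto simp: G_def inv_f_f surj_f_inv_f strict_mono_on_imp_inj_on[OF mono])
  have monoG: "strict_mono G"
    using strict_mono_less[OF mono] inv by (intro strict_monoI) metis
  have lipF: "M-lipschitz_on UNIV F"
  proof (rule lipschitz_onI)
    fix x y
    show "dist (F x) (F y) \<le> M * dist x y"
      using F[of x y] F[of y x] by (cases "x \<le> y") (auto simp: dist_real_def)
  qed (use M in auto)
  have lipG: "1-lipschitz_on UNIV G"
  proof (rule lipschitz_onI)
    fix x y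
    show "dist (G x) (G y) \<le> 1 * dist x y"
      using F(1)[of "G x" "G y"] F(1)[of "G y" "G x"] inv by (cases "G x \<le> G y") (auto simp: dist_real_def)
  qed auto
  define q where "q = (\<lambda>x t. (F (x + t) - F x) / t)"
  have q: "1 \<le> q x t" "q x t \<le> M" if "t \<noteq> 0" for x t
    using F[of x "x + t"] F[of "x + t" x] that
    by (cases "t > 0"; auto simp: q_def field_simps)+
  define below where "below = (\<lambda>r. {x. \<forall>n. \<exists>t. t \<noteq> 0 \<and> \<bar>t\<bar> < 1 / real (Suc n) \<and> q x t < r})"
  define above where "above = (\<lambda>r. {x. \<forall>n. \<exists>t. t \<noteq> 0 \<and> \<bar>t\<bar> < 1 / real (Suc n) \<and> r < q x t})"
  have contq: "continuous_on UNIV (\<lambda>x. q x t)" if "t \<noteq> 0" for t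
    unfolding q_def using that
    by (intro continuous_intros continuous_on_compose2[OF contF]) auto
  have "below r \<in> sets borel" for r
  proof -
    have "below r = (\<Inter>n. \<Union>t\<in>{t. t \<noteq> 0 \<and> \<bar>t\<bar> < 1 / real (Suc n)}. {x. q x t < r})"
      by (auto simp: below_def)
    moreover have "open {x. q x t < r}" if "t \<noteq> 0" for t
      using contq[OF that] by (intro open_Collect_less) auto
    ultimately show ?thesis
      by (auto intro!: countable_INT_open_borel)
  qed
  moreover have "above r \<in> sets borel" for r
  proof -
    have "above r = (\<Inter>n. \<Union>t\<in>{t. t \<noteq> 0 \<and> \<bar>t\<bar> < 1 / real (Suc n)}. {x. r < q x t})"
      by (auto simp: above_def)
    moreover have "open {x. r < q x t}" if "t \<noteq> 0" for t
      using contq[OF that] by (intro open_Collect_less) auto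
    ultimately show ?thesis
      by (auto intro!: countable_INT_open_borel)
  qed
  ultimately have meas: "below r \<inter> above R \<in> sets borel" for r R
    by auto
  have null: "emeasure lborel (below r \<inter> above R) = 0" if rR: "r < R" for r R
  proof (cases "below r = {}")
    case False
    then obtain x t where "t \<noteq> 0" "q x t < r"
      by (auto simp: below_def)
    then have r: "r > 1"
      using q(1)[of t x] by auto
    show ?thesis
    proof (rule null_set_if_null_on_bounded_parts[OF meas])
      fix n :: nat
      define E where "E = below r \<inter> above R \<inter> {- real n..real n}"
      have E: "E \<in> sets borel"
        using meas by (auto simp: E_def)
      have fin: "emeasure lborel E < \<infinity>"
        unfolding E_def by (rule finite_emeasure_bounded_part)
      have small: "\<exists>n. 1 / real (Suc n) < d" if "d > 0" for d :: real
        using reals_Archimedean[OF that] by (auto simp: inverse_eq_divide)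
      (* the flat intervals bound the image of E *)
      have 1: "emeasure lborel (F ` E) \<le> ennreal r * emeasure lborel E"
      proof (rule emeasure_bilipschitz_image_le[OF inv lipF lipschitz_on_continuous_on[OF lipG] E fin _ mono])
        fix x d :: real
        assume x: "x \<in> E" "0 < d"
        obtain n where n: "1 / real (Suc n) < d"
          using small[OF x(2)] by auto
        obtain t where t: "t \<noteq> 0" "\<bar>t\<bar> < 1 / real (Suc n)" "q x t < r"
          using x(1) unfolding E_def below_def by blast
        define u where "u = min x (x + t)"
        define v where "v = max x (x + t)"
        have "F v - F u \<le> r * (v - u)"
          using t(1,3) by (auto simp: q_def u_def v_def min_def max_def field_simps split: if_splits)
        moreover have "u < v" "u \<le> x" "x \<le> v" "v - u < d"
          using t n by (auto simp: u_def v_def)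
        ultimately show "\<exists>u v. u < v \<and> u \<le> x \<and> x \<le> v \<and> v - u < d \<and> F v - F u \<le> r * (v - u)"
          by blast
      qed (use r in auto)
      have EG: "F ` E = G -` E"
        using inv by (auto simp: image_iff) metis
      have mF: "F ` E \<in> sets borel"
        unfolding EG
        using measurable_sets[OF borel_measurable_continuous_onI[OF lipschitz_on_continuous_on[OF lipG]] E] by simp
      have "G ` F ` E = E"
        by (auto simp: image_image inv)
      (* the steep intervals are flat for the inverse function *)
      moreover have "emeasure lborel (G ` (F ` E)) \<le> ennreal (1 / R) * emeasure lborel (F ` E)"
      proof (rule emeasure_bilipschitz_image_le[OF inv(2,1) lipG contF mF _ _ monoG])
        show "emeasure lborel (F ` E) < \<infinity>"
          using 1 fin by (auto simp: ennreal_mult_less_top order_le_less_trans)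
        fix y d :: real
        assume y: "y \<in> F ` E" "0 < d"
        then obtain x where x: "x \<in> E" "y = F x"
          by auto
        obtain n where n: "1 / real (Suc n) < d / M"
          using small[of "d / M"] y(2) M by auto
        obtain t where t: "t \<noteq> 0" "\<bar>t\<bar> < 1 / real (Suc n)" "R < q x t"
          using x(1) unfolding E_def above_def by blast
        define u where "u = min x (x + t)"
        define v where "v = max x (x + t)"
        have "R * (v - u) \<le> F v - F u"
          using t(1,3) by (auto simp: q_def u_def v_def min_def max_def field_simps split: if_splits)
        moreover have "u < v" "u \<le> x" "x \<le> v" "v - u < d / M"
          using t n by (auto simp: u_def v_def)
        ultimately have uv: "R * (v - u) \<le> F v - F u" "u < v" "u \<le> x" "x \<le> v" "v - u < d / M"
          by auto
        have "F v - F u < d"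
          using F(2)[of u v] uv M by (simp add: field_simps)
        then show "\<exists>u v. u < v \<and> u \<le> y \<and> y \<le> v \<and> v - u < d \<and> G v - G u \<le> 1 / R * (v - u)"
          using uv r rR strict_mono_less_eq[OF mono] strict_mono_less[OF mono]
          by (intro exI[of _ "F u"] exI[of _ "F v"]) (auto simp: inv x field_simps)
      qed (use r rR in auto)
      ultimately have "emeasure lborel E \<le> ennreal (1 / R) * emeasure lborel (F ` E)"
        by simp
      also have "\<dots> \<le> ennreal (1 / R) * (ennreal r * emeasure lborel E)"
        using 1 by (intro mult_left_mono) auto
      also have "\<dots> = ennreal (r / R) * emeasure lborel E"
        using r rR by (simp add: mult.assoc[symmetric] ennreal_mult[symmetric])
      finally have "emeasure lborel E \<le> ennreal (r / R) * emeasure lborel E" .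
      then have "emeasure lborel E = 0"
        by (rule ennreal_eq_0_if_le_fraction[OF fin]) (use r rR in auto)
      then show "emeasure lborel (below r \<inter> above R \<inter> {- real n..real n}) = 0"
        by (simp add: E_def)
    qed
  qed auto
  have "{s. \<not> (\<exists>d. ((\<lambda>t. (h (s + t) - h s) / t) \<longlongrightarrow> d) (at 0))}
      \<subseteq> (\<Union>(r, R)\<in>{(r, R) \<in> \<rat> \<times> \<rat>. r < R}. below r \<inter> above R)"
  proof (rule subsetI, rule ccontr)
    fix s
    assume s: "s \<in> {s. \<not> (\<exists>d. ((\<lambda>t. (h (s + t) - h s) / t) \<longlongrightarrow> d) (at 0))}"
    assume *: "s \<notin> (\<Union>(r, R)\<in>{(r, R) \<in> \<rat> \<times> \<rat>. r < R}. below r \<inter> above R)"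
    let ?q = "\<lambda>t. ereal (q s t)"
    have "\<not> Liminf (at 0) ?q < Limsup (at 0) ?q"
    proof
      assume less: "Liminf (at 0) ?q < Limsup (at 0) ?q"
      obtain r' where r': "Liminf (at 0) ?q < ereal (real_of_rat r')" "ereal (real_of_rat r') < Limsup (at 0) ?q"
        using ereal_dense3[OF less] by auto
      obtain R' where R': "ereal (real_of_rat r') < ereal (real_of_rat R')" "ereal (real_of_rat R') < Limsup (at 0) ?q"
        using ereal_dense3[OF r'(2)] by auto
      define r R where "r = real_of_rat r'" and "R = real_of_rat R'"
      have "s \<in> below r"
        unfolding below_def
      proof (rule CollectI, rule allI, rule ccontr)
        fix n
        assume "\<not> (\<exists>t. t \<noteq> 0 \<and> \<bar>t\<bar> < 1 / real (Suc n) \<and> q s t < r)"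
        then have "eventually (\<lambda>t. ereal r \<le> ?q t) (at 0)"
          unfolding eventually_at by (intro exI[of _ "1 / real (Suc n)"]) (auto simp: not_less)
        then have "ereal r \<le> Liminf (at 0) ?q"
          by (rule Liminf_bounded)
        then show False
          using r'(1) by (simp add: r_def)
      qed
      moreover have "s \<in> above R"
        unfolding above_def
      proof (rule CollectI, rule allI, rule ccontr)
        fix n
        assume "\<not> (\<exists>t. t \<noteq> 0 \<and> \<bar>t\<bar> < 1 / real (Suc n) \<and> R < q s t)"
        then have "eventually (\<lambda>t. ?q t \<le> ereal R) (at 0)"
          unfolding eventually_at by (intro exI[of _ "1 / real (Suc n)"]) (auto simp: not_less)
        then have "Limsup (at 0) ?q \<le> ereal R"
          by (rule Limsup_bounded)
        then show False
          using R'(2) by (simp add: R_def)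
      qed
      moreover have "r \<in> \<rat>" "R \<in> \<rat>" "r < R"
        using R'(1) by (auto simp: r_def R_def)
      ultimately show False
        using * by auto
    qed
    moreover have "Liminf (at 0) ?q \<le> Limsup (at 0) ?q"
      by (rule Liminf_le_Limsup) simp
    ultimately have eq: "Liminf (at 0) ?q = Limsup (at 0) ?q"
      by simp
    have "ereal 1 \<le> Liminf (at 0) ?q"
      using q by (intro Liminf_bounded) (auto simp: eventually_at intro!: exI[of _ 1])
    moreover have "Limsup (at 0) ?q \<le> ereal M"
      using q by (intro Limsup_bounded) (auto simp: eventually_at intro!: exI[of _ 1])
    ultimately obtain l where l: "Limsup (at 0) ?q = ereal l"
      using eq by (cases "Limsup (at 0) ?q") auto
    have "(?q \<longlongrightarrow> ereal l) (at 0)"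
      using eq l by (intro iffD2[OF tendsto_iff_Liminf_eq_Limsup]) auto
    then have "((\<lambda>t. q s t) \<longlongrightarrow> l) (at 0)"
      by simp
    then have "((\<lambda>t. q s t - (L + 1)) \<longlongrightarrow> l - (L + 1)) (at 0)"
      by (intro tendsto_intros)
    moreover have "eventually (\<lambda>t. q s t - (L + 1) = (h (s + t) - h s) / t) (at 0)"
      by (auto simp: q_def F_def eventually_at field_simps intro!: exI[of _ 1])
    ultimately have "((\<lambda>t. (h (s + t) - h s) / t) \<longlongrightarrow> l - (L + 1)) (at 0)"
      by (rule Lim_transform_eventually)
    then show False
      using s by auto
  qed
  moreover have "negligible (\<Union>(r, R)\<in>{(r, R) \<in> \<rat> \<times> \<rat>. r < R}. below r \<inter> above R)"
  proof (rule negligible_countable_Union)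
    have "countable {(r, R) \<in> \<rat> \<times> (\<rat> :: real set). r < R}"
      by (rule countable_subset[of _ "\<rat> \<times> \<rat>"]) (auto intro: countable_SIGMA countable_rat)
    then show "countable ((\<lambda>(r, R). below r \<inter> above R) ` {(r, R) \<in> \<rat> \<times> \<rat>. r < R})"
      by simp
  qed (use null meas null_on_lborel_iff_negligible[OF meas] in auto)
  ultimately show ?thesis
    by (rule negligible_subset[rotated])
qed

section \<open>Sets that are null along directions\<close>

definition null_along :: "'a::real_normed_vector \<Rightarrow> 'a set \<Rightarrow> bool" where
  "null_along e S \<longleftrightarrow> (\<forall>x. emeasure lborel {t::real. x + t *\<^sub>R e \<in> S} = 0)"

text \<open>
  The decomposition in the definition of Aronszajn null sets, for one sequence of directions.
\<close>
definition splits_along :: "(nat \<Rightarrow> 'a::real_normed_vector) \<Rightarrow> 'a set \<Rightarrow> bool" where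
  "splits_along \<xi> S \<longleftrightarrow>
     (\<exists>E. (\<forall>n. E n \<in> sets borel) \<and> S = (\<Union>n. E n) \<and> (\<forall>n. null_along (\<xi> n) (E n)))"

lemma aronszajn_null_iff:
  "aronszajn_null S \<longleftrightarrow> S \<in> sets borel \<and>
     (\<forall>\<xi>. closure (span (range \<xi>)) = UNIV \<longrightarrow> splits_along \<xi> S)"
  unfolding aronszajn_null_def splits_along_def null_along_def by blast

lemma line_section_borel:
  fixes S :: "'a::{real_normed_vector, second_countable_topology} set"
  assumes "S \<in> sets borel"
  shows "{t::real. x + t *\<^sub>R e \<in> S} \<in> sets borel"
proof -
  have "(\<lambda>t::real. x + t *\<^sub>R e) \<in> borel_measurable borel"
    by measurable
  from measurable_sets[OF this assms] show ?thesis
    by (simp add: vimage_def)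
qed

lemma null_along_subset:
  fixes S :: "'a::{real_normed_vector, second_countable_topology} set"
  assumes "null_along e T" "S \<subseteq> T" "T \<in> sets borel"
  shows "null_along e S"
  unfolding null_along_def
proof
  fix x
  have "emeasure lborel {t::real. x + t *\<^sub>R e \<in> S} \<le> emeasure lborel {t::real. x + t *\<^sub>R e \<in> T}"
    using assms(2) line_section_borel[OF assms(3)] by (intro emeasure_mono) auto
  then show "emeasure lborel {t::real. x + t *\<^sub>R e \<in> S} = 0"
    using assms(1) by (auto simp: null_along_def)
qed

lemma null_along_UN:
  fixes T :: "nat \<Rightarrow> 'a::{real_normed_vector, second_countable_topology} set"
  assumes "\<And>n. T n \<in> sets borel" "\<And>n. null_along e (T n)"
  shows "null_along e (\<Union>n. T n)"
  unfolding null_along_def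
proof
  fix x
  have "{t::real. x + t *\<^sub>R e \<in> (\<Union>n. T n)} = (\<Union>n. {t. x + t *\<^sub>R e \<in> T n})"
    by auto
  moreover have "(\<Union>n. {t. x + t *\<^sub>R e \<in> T n}) \<in> null_sets lborel"
    using assms line_section_borel by (intro null_sets_UN) (auto simp: null_along_def)
  ultimately show "emeasure lborel {t::real. x + t *\<^sub>R e \<in> (\<Union>n. T n)} = 0"
    by (metis null_setsD1)
qed

lemma splits_along_subset:
  fixes S :: "'a::{real_normed_vector, second_countable_topology} set"
  assumes "splits_along \<xi> T" "S \<subseteq> T" "S \<in> sets borel"
  shows "splits_along \<xi> S"
proof -
  obtain E where E: "\<And>n. E n \<in> sets borel" "T = (\<Union>n. E n)" "\<And>n. null_along (\<xi> n) (E n)"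
    using assms(1) unfolding splits_along_def by blast
  show ?thesis
    unfolding splits_along_def
    using E assms null_along_subset[OF E(3) _ E(1)] by (intro exI[of _ "\<lambda>n. S \<inter> E n"]) auto
qed

lemma splits_along_UN:
  fixes T :: "nat \<Rightarrow> 'a::{real_normed_vector, second_countable_topology} set"
  assumes "\<And>k. splits_along \<xi> (T k)"
  shows "splits_along \<xi> (\<Union>k. T k)"
proof -
  have "\<forall>k. \<exists>E. (\<forall>n. E n \<in> sets borel) \<and> T k = (\<Union>n. E n) \<and> (\<forall>n. null_along (\<xi> n) (E n))"
    using assms unfolding splits_along_def by blast
  then obtain E where E: "\<And>k n. E k n \<in> sets borel" "\<And>k. T k = (\<Union>n. E k n)"
      "\<And>k n. null_along (\<xi> n) (E k n)"
    by metis
  show ?thesis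
    unfolding splits_along_def
    using E by (intro exI[of _ "\<lambda>n. \<Union>k. E k n"]) (auto intro!: null_along_UN)
qed

lemma aronszajn_null_empty: "aronszajn_null ({} :: 'a::real_normed_vector set)"
  unfolding aronszajn_null_iff splits_along_def null_along_def
  by (auto intro!: exI[of _ "\<lambda>_. {}"])

lemma aronszajn_null_UN:
  fixes T :: "nat \<Rightarrow> 'a::{real_normed_vector, second_countable_topology} set"
  assumes "\<And>k. aronszajn_null (T k)"
  shows "aronszajn_null (\<Union>k. T k)"
  using assms splits_along_UN[of _ T] unfolding aronszajn_null_iff by auto

lemma aronszajn_null_countable_Union:
  fixes T :: "'i \<Rightarrow> 'a::{real_normed_vector, second_countable_topology} set"
  assumes "countable I" "\<And>k. k \<in> I \<Longrightarrow> aronszajn_null (T k)"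
  shows "aronszajn_null (\<Union>k\<in>I. T k)"
proof (cases "I = {}")
  case False
  then have "range (from_nat_into I) = I"
    using assms(1) by (rule range_from_nat_into)
  then have "(\<Union>k\<in>I. T k) = (\<Union>n. T (from_nat_into I n))"
    by (metis image_image)
  then show ?thesis
    using assms(2) from_nat_into[OF False] by (auto intro!: aronszajn_null_UN)
qed (simp add: aronszajn_null_empty)

lemma aronszajn_null_Un:
  fixes S T :: "'a::{real_normed_vector, second_countable_topology} set"
  assumes "aronszajn_null S" "aronszajn_null T"
  shows "aronszajn_null (S \<union> T)"
  using aronszajn_null_countable_Union[of "{S, T}" "\<lambda>x. x"] assms by auto

lemma emeasure_line_section_shift:
  fixes S :: "'a::{real_normed_vector, second_countable_topology} set"
  assumes "S \<in> sets borel"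
  shows "emeasure lborel {t. x + (a + t) *\<^sub>R e \<in> S} = emeasure lborel {t::real. x + t *\<^sub>R e \<in> S}"
proof -
  have "emeasure lborel {t. x + t *\<^sub>R e \<in> S} = emeasure (distr lborel borel ((+) a)) {t. x + t *\<^sub>R e \<in> S}"
    by (simp add: lborel_distr_plus)
  also have "\<dots> = emeasure lborel {t. x + (a + t) *\<^sub>R e \<in> S}"
    using line_section_borel[OF assms] by (subst emeasure_distr) (auto simp: vimage_def)
  finally show ?thesis
    by simp
qed

text \<open>
  Let \<open>S1\<close> consist of the points of \<open>S\<close> whose line in direction \<open>\<xi>\<close> meets \<open>S\<close> in a null set. To see that the rest
  is null along \<open>y\<close>, integrate the measure of the \<open>\<xi>\<close>-sections over a line in direction \<open>y\<close>. This is an integral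
  over a plane; after a shear it can be computed along lines in direction \<open>c *\<^sub>R \<xi> + y\<close>, where it vanishes. So
  almost every point of the line has a null \<open>\<xi>\<close>-section, and such a point is not in \<open>S - S1\<close>.
\<close>
lemma null_along_sum_split:
  fixes S :: "'a::{real_normed_vector, second_countable_topology} set"
  assumes S[measurable]: "S \<in> sets borel" and null: "null_along (c *\<^sub>R \<xi> + y) S"
  obtains S1 where "S1 \<in> sets borel" "S1 \<subseteq> S" "null_along \<xi> S1" "null_along y (S - S1)"
proof -
  define \<phi> where "\<phi> = (\<lambda>x. emeasure lborel {t::real. x + t *\<^sub>R \<xi> \<in> S})"
  have \<phi>_eq: "\<phi> x = (\<integral>\<^sup>+t. indicator S (x + t *\<^sub>R \<xi>) \<partial>lborel)" for x
  proof -
    have "\<phi> x = (\<integral>\<^sup>+t. indicator {t. x + t *\<^sub>R \<xi> \<in> S} t \<partial>lborel)"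
      using line_section_borel[OF S, of x \<xi>] by (simp add: \<phi>_def)
    also have "\<dots> = (\<integral>\<^sup>+t. indicator S (x + t *\<^sub>R \<xi>) \<partial>lborel)"
      by (intro nn_integral_cong) (simp add: indicator_def)
    finally show ?thesis .
  qed
  have [measurable]: "\<phi> \<in> borel_measurable borel"
    unfolding \<phi>_eq[abs_def] by measurable
  define S1 where "S1 = {x \<in> S. \<phi> x = 0}"
  have S1: "S1 \<in> sets borel"
    unfolding S1_def by measurable
  have "null_along \<xi> S1"
    unfolding null_along_def
  proof
    fix x
    show "emeasure lborel {t::real. x + t *\<^sub>R \<xi> \<in> S1} = 0"
    proof (cases "{t::real. x + t *\<^sub>R \<xi> \<in> S1} = {}")
      case False
      then obtain a :: real where a: "x + a *\<^sub>R \<xi> \<in> S1"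
        by auto
      have "emeasure lborel {t::real. x + t *\<^sub>R \<xi> \<in> S1} \<le> emeasure lborel {t::real. x + t *\<^sub>R \<xi> \<in> S}"
        using line_section_borel[OF S, of x \<xi>] by (intro emeasure_mono) (auto simp: S1_def)
      also have "\<dots> = emeasure lborel {t. x + (a + t) *\<^sub>R \<xi> \<in> S}"
        by (rule emeasure_line_section_shift[OF S, symmetric])
      also have "\<dots> = \<phi> (x + a *\<^sub>R \<xi>)"
        by (simp add: \<phi>_def scaleR_add_left add.assoc)
      finally show ?thesis
        using a by (simp add: S1_def)
    qed simp
  qed
  moreover have "null_along y (S - S1)"
    unfolding null_along_def
  proof
    fix x
    have "(\<integral>\<^sup>+s. \<phi> (x + s *\<^sub>R y) \<partial>lborel)
        = (\<integral>\<^sup>+s. (\<integral>\<^sup>+t. indicator S (x + s *\<^sub>R y + t *\<^sub>R \<xi>) \<partial>lborel) \<partial>lborel)"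
      by (simp add: \<phi>_eq)
    (* the shear: for fixed s, the inner variable is shifted by c * s *)
    also have "\<dots> = (\<integral>\<^sup>+s. (\<integral>\<^sup>+t. indicator S (x + s *\<^sub>R y + (c * s + 1 * t) *\<^sub>R \<xi>) \<partial>lborel) \<partial>lborel)"
    proof (rule nn_integral_cong)
      fix s :: real
      show "(\<integral>\<^sup>+t. indicator S (x + s *\<^sub>R y + t *\<^sub>R \<xi>) \<partial>lborel)
          = (\<integral>\<^sup>+t. indicator S (x + s *\<^sub>R y + (c * s + 1 * t) *\<^sub>R \<xi>) \<partial>lborel)"
        by (subst nn_integral_real_affine[where c = 1 and t = "c * s"]) auto
    qed
    also have "\<dots> = (\<integral>\<^sup>+t. (\<integral>\<^sup>+s. indicator S (x + s *\<^sub>R y + (c * s + 1 * t) *\<^sub>R \<xi>) \<partial>lborel) \<partial>lborel)"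
      by (rule lborel_pair.Fubini'[symmetric]) measurable
    also have "\<dots> = (\<integral>\<^sup>+t. 0 \<partial>(lborel :: real measure))"
    proof (rule nn_integral_cong)
      fix t :: real
      have "(\<integral>\<^sup>+s. indicator S (x + s *\<^sub>R y + (c * s + 1 * t) *\<^sub>R \<xi>) \<partial>lborel)
          = (\<integral>\<^sup>+s. indicator {s. (x + t *\<^sub>R \<xi>) + s *\<^sub>R (c *\<^sub>R \<xi> + y) \<in> S} s \<partial>lborel)"
        by (intro nn_integral_cong) (simp add: indicator_def algebra_simps)
      also have "\<dots> = emeasure lborel {s. (x + t *\<^sub>R \<xi>) + s *\<^sub>R (c *\<^sub>R \<xi> + y) \<in> S}"
        using line_section_borel[OF S] by (intro nn_integral_indicator) simp
      also have "\<dots> = 0"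
        using null by (simp only: null_along_def)
      finally show "(\<integral>\<^sup>+s. indicator S (x + s *\<^sub>R y + (c * s + 1 * t) *\<^sub>R \<xi>) \<partial>lborel) = 0" .
    qed
    finally have "(\<integral>\<^sup>+s. \<phi> (x + s *\<^sub>R y) \<partial>lborel) = 0"
      by simp
    then have "emeasure lborel {s \<in> space lborel. \<phi> (x + s *\<^sub>R y) \<noteq> 0} = 0"
      by (subst (asm) nn_integral_0_iff) auto
    moreover have "emeasure lborel {t::real. x + t *\<^sub>R y \<in> S - S1}
        \<le> emeasure lborel {s \<in> space lborel. \<phi> (x + s *\<^sub>R y) \<noteq> 0}"
      by (intro emeasure_mono) (auto simp: S1_def)
    ultimately show "emeasure lborel {t::real. x + t *\<^sub>R y \<in> S - S1} = 0"
      by simp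
  qed
  ultimately show thesis
    using S1 by (intro that[of S1]) (auto simp: S1_def)
qed

text \<open>
  The summands of a linear combination \<open>e\<close> are split off one at a time. The induction ends at \<open>e = 0\<close>, and only
  the empty set is null along the direction \<open>0\<close>.
\<close>
lemma splits_along_if_null_along:
  fixes S :: "'a::{real_normed_vector, second_countable_topology} set"
  assumes "e \<in> span (range \<xi>)" "S \<in> sets borel" "null_along e S"
  shows "splits_along \<xi> S"
  using assms
proof (induction e arbitrary: S rule: span_induct_alt)
  case base
  have "S = {}"
  proof (rule ccontr)
    assume "S \<noteq> {}"
    then obtain x where x: "x \<in> S"
      by auto
    have "emeasure lborel {t::real. x + t *\<^sub>R 0 \<in> S} = 0"
      using base(2) by (simp only: null_along_def)
    then show False
      using x by simp
  qed
  then show ?case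
    unfolding splits_along_def null_along_def by (auto intro!: exI[of _ "\<lambda>_. {}"])
next
  case (step c v y)
  then obtain i where i: "v = \<xi> i"
    by auto
  obtain S1 where S1: "S1 \<in> sets borel" "S1 \<subseteq> S" "null_along v S1" "null_along y (S - S1)"
    using null_along_sum_split[OF step.prems] by blast
  have "splits_along \<xi> (S - S1)"
    using S1 step.prems by (intro step.IH) auto
  moreover have "splits_along \<xi> S1"
    unfolding splits_along_def
    using S1 i by (intro exI[of _ "\<lambda>n. if n = i then S1 else {}"])
      (auto simp: null_along_def split: if_splits)
  ultimately have "splits_along \<xi> (\<Union>k::nat. if k = 0 then S1 else S - S1)"
    by (intro splits_along_UN) auto
  moreover have "(\<Union>k::nat. if k = 0 then S1 else S - S1) = S"
    using S1(2) by (auto split: if_splits intro: exI[of _ 0] exI[of _ 1])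
  ultimately show ?case
    by simp
qed

text \<open>
  The form in which Aronszajn nullity is verified below: the covering sets and their directions may depend on
  the sequence \<open>\<xi>\<close>, and one direction in its span is enough for each of them.
\<close>
lemma aronszajn_nullI:
  fixes S :: "'a::{real_normed_vector, second_countable_topology} set"
  assumes "S \<in> sets borel"
    and "\<And>\<xi> :: nat \<Rightarrow> 'a. closure (span (range \<xi>)) = UNIV \<Longrightarrow>
      \<exists>\<T>. countable \<T> \<and> S \<subseteq> \<Union>\<T> \<and>
        (\<forall>T\<in>\<T>. T \<in> sets borel \<and> (\<exists>e\<in>span (range \<xi>). null_along e T))"
  shows "aronszajn_null S"
  unfolding aronszajn_null_iff
proof (intro conjI allI impI)
  fix \<xi> :: "nat \<Rightarrow> 'a"
  assume "closure (span (range \<xi>)) = UNIV"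
  then obtain \<T> where \<T>: "countable \<T>" "S \<subseteq> \<Union>\<T>"
      "\<And>T. T \<in> \<T> \<Longrightarrow> T \<in> sets borel \<and> (\<exists>e\<in>span (range \<xi>). null_along e T)"
    using assms(2) by metis
  define T where "T = from_nat_into (insert {} \<T>)"
  have T: "range T = insert {} \<T>"
    unfolding T_def using \<T>(1) by (intro range_from_nat_into) auto
  have "splits_along \<xi> (T k)" for k
  proof -
    have "T k \<in> insert {} \<T>"
      using T by auto
    then show ?thesis
      using \<T>(3) splits_along_if_null_along[of _ \<xi> "T k"] span_zero[of "range \<xi>"]
      by (auto simp: null_along_def)
  qed
  then have "splits_along \<xi> (\<Union>k. T k)"
    by (rule splits_along_UN)
  then show "splits_along \<xi> S"
    by (rule splits_along_subset) (use T \<T>(2) assms(1) in auto)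
qed (rule assms(1))

section \<open>Haar null sets and random series\<close>

lemma in_translate_iff:
  fixes S :: "'a::real_vector set"
  shows "y \<in> (+) x ` S \<longleftrightarrow> y - x \<in> S"
  by (auto simp: image_iff intro: bexI[of _ "y - x"])

lemma in_translate_diff_iff:
  fixes S :: "'a::real_vector set"
  shows "b \<in> (+) (x - a) ` S \<longleftrightarrow> a + b \<in> (+) x ` S"
  unfolding in_translate_iff by (simp add: algebra_simps)

lemma translate_borel:
  fixes S :: "'a::{real_normed_vector, second_countable_topology} set"
  assumes "S \<in> sets borel"
  shows "(+) x ` S \<in> sets borel"
proof -
  have "(\<lambda>y. y - x) -` S \<inter> space borel \<in> sets borel"
    by (rule measurable_sets[OF _ assms]) measurable
  moreover have "(+) x ` S = (\<lambda>y. y - x) -` S"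
    by (auto simp: in_translate_iff)
  ultimately show ?thesis
    by simp
qed

lemma convolution_null_translates:
  fixes M N :: "'a::{real_normed_vector, second_countable_topology} measure"
  assumes M: "sets M = sets borel" "prob_space M" and N: "sets N = sets borel" "prob_space N"
    and S: "S \<in> sets borel" and null: "\<And>x. emeasure N ((+) x ` S) = 0"
  shows "emeasure (distr (M \<Otimes>\<^sub>M N) borel (\<lambda>(a, b). a + b)) ((+) x ` S) = 0"
proof -
  interpret M: prob_space M by (rule M(2))
  interpret N: prob_space N by (rule N(2))
  interpret pair_prob_space M N ..
  note [measurable_cong] = M(1) N(1)
  have sum: "(\<lambda>(a, b). a + b) \<in> M \<Otimes>\<^sub>M N \<rightarrow>\<^sub>M borel"
    by measurable
  define A where "A = (+) x ` S"
  have A[measurable]: "A \<in> sets borel"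
    unfolding A_def by (rule translate_borel[OF S])
  have "emeasure (distr (M \<Otimes>\<^sub>M N) borel (\<lambda>(a, b). a + b)) A
      = (\<integral>\<^sup>+z. indicator A z \<partial>distr (M \<Otimes>\<^sub>M N) borel (\<lambda>(a, b). a + b))"
    by simp
  also have "\<dots> = (\<integral>\<^sup>+z. indicator A (case z of (a, b) \<Rightarrow> a + b) \<partial>(M \<Otimes>\<^sub>M N))"
    by (rule nn_integral_distr[OF sum]) measurable
  also have "\<dots> = (\<integral>\<^sup>+a. (\<integral>\<^sup>+b. indicator A (case (a, b) of (a, b) \<Rightarrow> a + b) \<partial>N) \<partial>M)"
    by (rule N.nn_integral_fst[symmetric]) measurable
  also have "\<dots> = (\<integral>\<^sup>+a. (\<integral>\<^sup>+b. indicator ((+) (x - a) ` S) b \<partial>N) \<partial>M)"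
    by (intro nn_integral_cong) (simp only: indicator_def in_translate_diff_iff A_def prod.case)
  also have "\<dots> = 0"
    using null translate_borel[OF S] by (simp add: N(1))
  finally show ?thesis
    by (simp add: A_def)
qed

text \<open>
  A convolution vanishes on all translates of every set on whose translates one of its factors vanishes.
\<close>
lemma haar_null_Un:
  fixes S T :: "'a::{real_normed_vector, second_countable_topology} set"
  assumes "haar_null S" "haar_null T"
  shows "haar_null (S \<union> T)"
proof -
  obtain M where M: "sets M = sets borel" "prob_space M" "\<And>x. emeasure M ((+) x ` S) = 0"
    using assms(1) unfolding haar_null_def by blast
  obtain N where N: "sets N = sets borel" "prob_space N" "\<And>x. emeasure N ((+) x ` T) = 0"
    using assms(2) unfolding haar_null_def by blast
  have S: "S \<in> sets borel" and T: "T \<in> sets borel"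
    using assms by (auto simp: haar_null_def)
  interpret M: prob_space M by (rule M(2))
  interpret N: prob_space N by (rule N(2))
  interpret pair_prob_space M N ..
  note [measurable_cong] = M(1) N(1)
  define \<kappa> where "\<kappa> = distr (M \<Otimes>\<^sub>M N) borel (\<lambda>(a, b). a + b)"
  have \<kappa>_swap: "\<kappa> = distr (N \<Otimes>\<^sub>M M) borel (\<lambda>(a, b). a + b)"
    unfolding \<kappa>_def
    by (subst distr_pair_swap, subst distr_distr) (auto simp: comp_def case_prod_beta' add.commute)
  have "emeasure \<kappa> ((+) x ` (S \<union> T)) = 0" for x
  proof -
    have "emeasure \<kappa> ((+) x ` (S \<union> T)) \<le> emeasure \<kappa> ((+) x ` S) + emeasure \<kappa> ((+) x ` T)"
      unfolding image_Un by (intro emeasure_subadditive) (auto simp: \<kappa>_def translate_borel S T)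
    moreover have "emeasure \<kappa> ((+) x ` S) = 0"
      unfolding \<kappa>_swap by (rule convolution_null_translates[OF N(1,2) M(1,2) S M(3)])
    moreover have "emeasure \<kappa> ((+) x ` T) = 0"
      unfolding \<kappa>_def by (rule convolution_null_translates[OF M(1,2) N(1,2) T N(3)])
    ultimately show ?thesis
      by simp
  qed
  moreover have "prob_space \<kappa>"
    unfolding \<kappa>_def by (rule P.prob_space_distr) measurable
  ultimately show ?thesis
    unfolding haar_null_def using S T by (intro conjI exI[of _ \<kappa>]) (auto simp: \<kappa>_def)
qed

text \<open>
  The measure \<open>\<mu>\<close> is the law of the sum of independent random vectors with laws \<open>\<nu> n\<close>. Conditioning on all
  summands but one shows that \<open>\<mu>\<close> is at most as large on translates of a set as any single \<open>\<nu> n\<close> is. Hence one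
  \<open>\<mu>\<close> combines the smallness properties of all the \<open>\<nu> n\<close>.
\<close>
lemma random_series:
  fixes \<nu> :: "nat \<Rightarrow> 'a::{banach, second_countable_topology} measure"
  assumes sets_\<nu>: "\<And>n. sets (\<nu> n) = sets borel" and prob: "\<And>n. prob_space (\<nu> n)"
    and small: "\<And>n. AE x in \<nu> n. norm x \<le> (1 / 2) ^ n"
  shows "\<exists>\<mu> :: 'a measure. sets \<mu> = sets borel \<and> prob_space \<mu> \<and>
    (\<forall>n. \<forall>S\<in>sets borel. \<forall>\<epsilon>. (\<forall>x. emeasure (\<nu> n) ((+) x ` S) \<le> \<epsilon>) \<longrightarrow>
       (\<forall>x. emeasure \<mu> ((+) x ` S) \<le> \<epsilon>))"
proof -
  note [measurable_cong] = sets_\<nu>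
  have sp: "space (\<nu> n) = UNIV" for n
    using sets_eq_imp_space_eq[OF sets_\<nu>[of n]] by auto
  (* The bound on the norm holds only almost everywhere. Truncation makes the series converge at
     every point of the product space and does not change the law of the sum. *)
  define clip where "clip = (\<lambda>n x. if norm x \<le> (1 / 2) ^ n then x else (0::'a))"
  have clip_meas[measurable]: "clip n \<in> borel_measurable borel" for n
    unfolding clip_def by measurable
  have clip_norm: "norm (clip n x) \<le> (1 / 2) ^ n" for n x
    by (simp add: clip_def)
  have summ: "summable (\<lambda>n. clip n (w n))" for w
    by (rule summable_comparison_test'[of "\<lambda>n. (1 / 2) ^ n" 0]) (auto simp: clip_norm)
  define Y where "Y = (\<lambda>w. \<Sum>n. clip n (w n))"
  define \<Omega> where "\<Omega> = (\<Pi>\<^sub>M n\<in>UNIV. \<nu> n)"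
  interpret \<Omega>: prob_space \<Omega>
    unfolding \<Omega>_def using prob by (rule prob_space_PiM)
  have Y[measurable]: "Y \<in> borel_measurable \<Omega>"
  proof (rule borel_measurable_LIMSEQ_metric)
    fix k
    show "(\<lambda>w. \<Sum>n<k. clip n (w n)) \<in> borel_measurable \<Omega>"
      unfolding \<Omega>_def by measurable
  next
    fix w
    show "(\<lambda>k. \<Sum>n<k. clip n (w n)) \<longlonglongrightarrow> Y w"
      unfolding Y_def by (rule summable_LIMSEQ[OF summ])
  qed
  define \<mu> where "\<mu> = distr \<Omega> borel Y"
  have small_translates: "emeasure \<mu> ((+) x ` S) \<le> \<epsilon>"
    if S: "S \<in> sets borel" and bound: "\<And>x. emeasure (\<nu> n) ((+) x ` S) \<le> \<epsilon>" for n S \<epsilon> x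
  proof -
    interpret \<nu>n: prob_space "\<nu> n" by (rule prob)
    interpret pair_prob_space "\<nu> n" \<Omega> ..
    have upd: "(\<lambda>(s, w). w(n := s)) \<in> measurable (\<nu> n \<Otimes>\<^sub>M \<Omega>) \<Omega>"
      unfolding \<Omega>_def case_prod_beta
      by (rule measurable_fun_upd[where J = UNIV]) auto
    (* resampling the coordinate n preserves the product measure *)
    have \<Omega>_eq: "\<Omega> = distr (\<nu> n \<Otimes>\<^sub>M \<Omega>) \<Omega> (\<lambda>(s, w). w(n := s))"
      using distr_pair_PiM_eq_PiM[of UNIV \<nu> n] prob by (simp add: \<Omega>_def)
    have split: "Y (w(n := s)) = Y (w(n := 0)) + clip n s" for w s
    proof -
      have "(\<Sum>m. clip m ((w(n := s)) m)) - (\<Sum>m. clip m ((w(n := 0)) m))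
          = (\<Sum>m. clip m ((w(n := s)) m) - clip m ((w(n := 0)) m))"
        by (intro suminf_diff summ)
      also have "\<dots> = (\<Sum>m\<in>{n}. clip m ((w(n := s)) m) - clip m ((w(n := 0)) m))"
        by (intro suminf_finite) auto
      also have "\<dots> = clip n s"
        by (simp add: clip_def)
      finally show ?thesis
        by (simp add: Y_def algebra_simps)
    qed
    define A where "A = (+) x ` S"
    have A[measurable]: "A \<in> sets borel"
      unfolding A_def by (rule translate_borel[OF S])
    have "emeasure \<mu> A = (\<integral>\<^sup>+y. indicator A y \<partial>\<mu>)"
      by (simp add: \<mu>_def)
    also have "\<dots> = (\<integral>\<^sup>+w. indicator A (Y w) \<partial>\<Omega>)"
      unfolding \<mu>_def by (rule nn_integral_distr[OF Y]) measurable
    also have "\<dots> = (\<integral>\<^sup>+w. indicator A (Y w) \<partial>distr (\<nu> n \<Otimes>\<^sub>M \<Omega>) \<Omega> (\<lambda>(s, w). w(n := s)))"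
      by (subst \<Omega>_eq) simp
    also have "\<dots> = (\<integral>\<^sup>+z. indicator A (Y (case z of (s, w) \<Rightarrow> w(n := s))) \<partial>(\<nu> n \<Otimes>\<^sub>M \<Omega>))"
      by (rule nn_integral_distr[OF upd]) measurable
    also have "\<dots> = (\<integral>\<^sup>+w. (\<integral>\<^sup>+s. indicator A (Y (w(n := s))) \<partial>\<nu> n) \<partial>\<Omega>)"
      using upd by (subst nn_integral_snd[symmetric]) (auto intro!: measurable_compose[OF _ Y] measurable_compose[OF upd])
    also have "\<dots> \<le> (\<integral>\<^sup>+w. \<epsilon> \<partial>\<Omega>)"
    proof (intro nn_integral_mono)
      fix w
      have "(\<integral>\<^sup>+s. indicator A (Y (w(n := s))) \<partial>\<nu> n)
          = (\<integral>\<^sup>+s. indicator ((+) (x - Y (w(n := 0))) ` S) s \<partial>\<nu> n)"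
      proof (rule nn_integral_cong_AE)
        show "AE s in \<nu> n. indicator A (Y (w(n := s)))
            = (indicator ((+) (x - Y (w(n := 0))) ` S) s :: ennreal)"
          using small[of n]
        proof eventually_elim
          case (elim s)
          then have "clip n s = s"
            by (simp add: clip_def)
          then show ?case
            by (simp only: split[of w s] indicator_def in_translate_diff_iff A_def)
        qed
      qed
      also have "\<dots> = emeasure (\<nu> n) ((+) (x - Y (w(n := 0))) ` S)"
        using translate_borel[OF S] by (intro nn_integral_indicator) (auto simp: sets_\<nu>)
      also have "\<dots> \<le> \<epsilon>"
        by (rule bound)
      finally show "(\<integral>\<^sup>+s. indicator A (Y (w(n := s))) \<partial>\<nu> n) \<le> \<epsilon>" .
    qed
    also have "\<dots> = \<epsilon>"
      by (simp add: \<Omega>.emeasure_space_1)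
    finally show "emeasure \<mu> ((+) x ` S) \<le> \<epsilon>"
      by (simp only: A_def)
  qed
  show ?thesis
  proof (intro exI[of _ \<mu>] conjI allI ballI impI)
    show "prob_space \<mu>"
      unfolding \<mu>_def by (rule \<Omega>.prob_space_distr[OF Y])
    fix n S \<epsilon> x
    assume "S \<in> sets borel" "\<forall>x. emeasure (\<nu> n) ((+) x ` S) \<le> \<epsilon>"
    then show "emeasure \<mu> ((+) x ` S) \<le> \<epsilon>"
      by (intro small_translates[of S n]) auto
  qed (simp add: \<mu>_def)
qed

text \<open>
  For a bounded sequence \<open>\<xi>\<close> with dense span and uniformly distributed \<open>t n\<close>, the law of \<open>\<Sum>n. t n *\<^sub>R \<xi> n\<close> has a factor
  carried by a segment in each direction \<open>\<xi> n\<close>, and it is therefore null on sets that are null along \<open>\<xi> n\<close>.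
\<close>
lemma aronszajn_null_imp_haar_null:
  fixes S :: "'a::{banach, second_countable_topology} set"
  assumes "aronszajn_null S"
  shows "haar_null S"
proof -
  obtain D :: "'a set" where D: "countable D" "\<And>U. open U \<Longrightarrow> U \<noteq> {} \<Longrightarrow> \<exists>d\<in>D. d \<in> U"
    using countable_dense_setE by blast
  have "D \<noteq> {}"
    using D(2)[of UNIV] by auto
  define d where "d = from_nat_into D"
  have d: "range d = D"
    unfolding d_def using D(1) \<open>D \<noteq> {}\<close> by (intro range_from_nat_into)
  define \<xi> where "\<xi> = (\<lambda>n. ((1 / 2) ^ n / (1 + norm (d n))) *\<^sub>R d n)"
  have \<xi>: "norm (\<xi> n) \<le> (1 / 2) ^ n" for n
  proof -
    have "norm (\<xi> n) = (1 / 2) ^ n * (norm (d n) / (1 + norm (d n)))"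
      by (simp add: \<xi>_def)
    also have "\<dots> \<le> (1 / 2) ^ n * 1"
      by (intro mult_left_mono) (auto simp: divide_le_eq_1 add_pos_nonneg)
    finally show ?thesis
      by simp
  qed
  have "D \<subseteq> span (range \<xi>)"
  proof
    fix z
    assume "z \<in> D"
    then obtain n where n: "z = d n"
      using d by auto
    have "0 < 1 + norm (d n)"
      by (simp add: add_pos_nonneg)
    then have "z = ((1 + norm (d n)) / (1 / 2) ^ n) *\<^sub>R \<xi> n"
      by (simp add: \<xi>_def n)
    then show "z \<in> span (range \<xi>)"
      using span_scale[OF span_base[of "\<xi> n" "range \<xi>"]] by (metis rangeI)
  qed
  then have "\<exists>y\<in>span (range \<xi>). dist y x < e" if "e > 0" for x e
    using D(2)[of "ball x e"] that by (auto simp: dist_commute)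
  then have dense: "closure (span (range \<xi>)) = UNIV"
    by (auto simp: closure_approachable)
  obtain E where E: "\<And>n. E n \<in> sets borel" "S = (\<Union>n. E n)" "\<And>n. null_along (\<xi> n) (E n)"
    using assms dense unfolding aronszajn_null_iff splits_along_def by blast
  define U where "U = uniform_measure lborel {0..1::real}"
  interpret U: prob_space U
    unfolding U_def by (rule prob_space_uniform_measure) auto
  have U[measurable_cong]: "sets U = sets borel"
    by (simp add: U_def)
  define \<nu> where "\<nu> = (\<lambda>n. distr U borel (\<lambda>t. t *\<^sub>R \<xi> n))"
  have scale[measurable]: "(\<lambda>t. t *\<^sub>R \<xi> n) \<in> U \<rightarrow>\<^sub>M borel" for n
    by measurable
  have sets_\<nu>: "sets (\<nu> n) = sets borel" for n
    by (simp add: \<nu>_def)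
  have prob_\<nu>: "prob_space (\<nu> n)" for n
    unfolding \<nu>_def by (rule U.prob_space_distr) measurable
  have small: "AE x in \<nu> n. norm x \<le> (1 / 2) ^ n" for n
  proof -
    have "AE t in U. t \<in> {0..1}"
      unfolding U_def by (rule AE_uniform_measureI) auto
    then have "AE t in U. norm (t *\<^sub>R \<xi> n) \<le> (1 / 2) ^ n"
    proof eventually_elim
      case (elim t)
      then have "\<bar>t\<bar> * norm (\<xi> n) \<le> 1 * (1 / 2) ^ n"
        using \<xi>[of n] by (intro mult_mono) auto
      then show ?case
        by simp
    qed
    then show ?thesis
      unfolding \<nu>_def by (subst AE_distr_iff) auto
  qed
  obtain \<mu> :: "'a measure" where \<mu>: "sets \<mu> = sets borel" "prob_space \<mu>"
    "\<forall>n. \<forall>S\<in>sets borel. \<forall>\<epsilon>. (\<forall>x. emeasure (\<nu> n) ((+) x ` S) \<le> \<epsilon>) \<longrightarrow>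
       (\<forall>x. emeasure \<mu> ((+) x ` S) \<le> \<epsilon>)"
    using random_series[of \<nu>, OF sets_\<nu> prob_\<nu> small] by blast
  have null: "emeasure \<mu> ((+) x ` E n) = 0" for n x
  proof -
    have "emeasure (\<nu> n) ((+) y ` E n) \<le> 0" for y
    proof -
      have "(\<lambda>t. t *\<^sub>R \<xi> n) -` ((+) y ` E n) \<inter> space U = {t. - y + t *\<^sub>R \<xi> n \<in> E n}"
        by (simp add: vimage_def in_translate_iff U_def)
      then have "emeasure (\<nu> n) ((+) y ` E n) = emeasure U {t. - y + t *\<^sub>R \<xi> n \<in> E n}"
        unfolding \<nu>_def by (simp only: emeasure_distr[OF scale translate_borel[OF E(1)]])
      also have "\<dots> \<le> emeasure lborel {t. - y + t *\<^sub>R \<xi> n \<in> E n}"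
        unfolding U_def using line_section_borel[OF E(1), of "- y" "\<xi> n" n]
        by (subst emeasure_uniform_measure) (auto simp: divide_ennreal_def intro!: emeasure_mono)
      also have "\<dots> = 0"
        using E(3) by (simp only: null_along_def)
      finally show ?thesis .
    qed
    then show ?thesis
      using \<mu>(3)[rule_format, of "E n" n 0 x] E(1)[of n] by simp
  qed
  have "emeasure \<mu> ((+) x ` S) = 0" for x
  proof -
    have "(\<Union>n. (+) x ` E n) \<in> null_sets \<mu>"
      using null translate_borel[OF E(1)] \<mu>(1) by (intro null_sets_UN) auto
    then show ?thesis
      unfolding E(2) image_UN by (rule null_setsD1)
  qed
  then show ?thesis
    using \<mu> assms unfolding haar_null_def aronszajn_null_def by blast
qed

section \<open>Differentiability of Lipschitz functions\<close>

definition dir_differentiable :: "('a::real_normed_vector \<Rightarrow> real) \<Rightarrow> 'a \<Rightarrow> 'a set" where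
  "dir_differentiable f v = {x. \<exists>d. ((\<lambda>t. (f (x + t *\<^sub>R v) - f x) / t) \<longlongrightarrow> d) (at (0::real))}"

definition dir_additive :: "('a::real_normed_vector \<Rightarrow> real) \<Rightarrow> 'a \<Rightarrow> 'a \<Rightarrow> 'a set" where
  "dir_additive f v w = {x. ((\<lambda>t. (f (x + t *\<^sub>R (v + w)) - f (x + t *\<^sub>R v) - f (x + t *\<^sub>R w) + f x) / t)
     \<longlongrightarrow> 0) (at (0::real))}"

lemma eventually_at_0_real_iff:
  "eventually P (at (0::real)) \<longleftrightarrow> (\<exists>j. \<forall>t. t \<noteq> 0 \<and> \<bar>t\<bar> < 1 / real (Suc j) \<longrightarrow> P t)"
proof
  assume "eventually P (at (0::real))"
  then obtain d where d: "d > 0" "\<And>t. t \<noteq> 0 \<Longrightarrow> \<bar>t\<bar> < d \<Longrightarrow> P t"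
    unfolding eventually_at by (auto simp: dist_real_def)
  obtain j where "1 / real (Suc j) < d"
    using reals_Archimedean[OF d(1)] by (auto simp: inverse_eq_divide)
  then show "\<exists>j. \<forall>t. t \<noteq> 0 \<and> \<bar>t\<bar> < 1 / real (Suc j) \<longrightarrow> P t"
    using d(2) by (intro exI[of _ j]) auto
next
  assume "\<exists>j. \<forall>t. t \<noteq> 0 \<and> \<bar>t\<bar> < 1 / real (Suc j) \<longrightarrow> P t"
  then obtain j where "\<forall>t. t \<noteq> 0 \<and> \<bar>t\<bar> < 1 / real (Suc j) \<longrightarrow> P t"
    by auto
  then show "eventually P (at (0::real))"
    unfolding eventually_at by (intro exI[of _ "1 / real (Suc j)"]) (auto simp: dist_real_def)
qed

lemma exists_inverse_Suc_less:
  assumes "(0::real) < e"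
  shows "\<exists>k. c / real (Suc k) < e"
proof -
  obtain k :: nat where "c / e < real k"
    using reals_Archimedean2 by blast
  then have "c < e * real (Suc k)"
    using assms by (simp add: field_simps)
  then show ?thesis
    by (intro exI[of _ k]) (simp add: field_simps)
qed

text \<open>
  In this criterion and in the next one, all inequalities are non-strict and all scales are countably many.
  For continuous \<open>f\<close> they exhibit the sets of convergence of difference quotients as Borel sets.
\<close>
lemma tendsto_at_0_iff_real:
  fixes q :: "real \<Rightarrow> real"
  shows "(q \<longlongrightarrow> d) (at 0) \<longleftrightarrow>
    (\<forall>k. \<exists>j. \<forall>t. t \<noteq> 0 \<and> \<bar>t\<bar> < 1 / real (Suc j) \<longrightarrow> \<bar>q t - d\<bar> \<le> 1 / real (Suc k))" (is "?L \<longleftrightarrow> ?R")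
proof
  assume ?L
  then show ?R
    unfolding tendsto_iff dist_real_def eventually_at_0_real_iff
    by (metis less_eq_real_def of_nat_0_less_iff zero_less_Suc zero_less_divide_1_iff)
next
  assume R: ?R
  show ?L
    unfolding tendsto_iff dist_real_def eventually_at_0_real_iff
  proof (intro allI impI)
    fix e :: real
    assume "0 < e"
    then obtain k where k: "1 / real (Suc k) < e"
      using exists_inverse_Suc_less[of e 1] by auto
    obtain j where "\<forall>t. t \<noteq> 0 \<and> \<bar>t\<bar> < 1 / real (Suc j) \<longrightarrow> \<bar>q t - d\<bar> \<le> 1 / real (Suc k)"
      using R by blast
    then show "\<exists>j. \<forall>t. t \<noteq> 0 \<and> \<bar>t\<bar> < 1 / real (Suc j) \<longrightarrow> \<bar>q t - d\<bar> < e"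
      using k by (intro exI[of _ j]) force
  qed
qed

lemma convergent_at_0_iff_Cauchy:
  fixes q :: "real \<Rightarrow> real"
  shows "(\<exists>d. (q \<longlongrightarrow> d) (at 0)) \<longleftrightarrow>
    (\<forall>k. \<exists>j. \<forall>s t. s \<noteq> 0 \<and> \<bar>s\<bar> < 1 / real (Suc j) \<and> t \<noteq> 0 \<and> \<bar>t\<bar> < 1 / real (Suc j)
       \<longrightarrow> \<bar>q s - q t\<bar> \<le> 1 / real (Suc k))" (is "?L \<longleftrightarrow> ?R")
proof -
  have "?L \<longleftrightarrow> cauchy_filter (filtermap q (at 0))"
  proof
    assume "cauchy_filter (filtermap q (at 0))"
    then show ?L
      using complete_UNIV[where 'a = real]
      unfolding complete_uniform filterlim_def by (auto simp: filtermap_bot_iff)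
  qed (auto simp: filterlim_def intro: nhds_imp_cauchy_filter)
  also have "\<dots> \<longleftrightarrow> ?R"
    unfolding cauchy_filter_metric_filtermap dist_real_def
  proof (intro iffI allI impI)
    fix k
    assume "\<forall>e>0. \<exists>P. eventually P (at 0) \<and> (\<forall>x y. P x \<and> P y \<longrightarrow> \<bar>q x - q y\<bar> < e)"
    then obtain P where P: "eventually P (at 0)" "\<And>x y. P x \<Longrightarrow> P y \<Longrightarrow> \<bar>q x - q y\<bar> < 1 / real (Suc k)"
      by (metis of_nat_0_less_iff zero_less_Suc zero_less_divide_1_iff)
    then obtain j where "\<And>t. t \<noteq> 0 \<and> \<bar>t\<bar> < 1 / real (Suc j) \<Longrightarrow> P t"
      unfolding eventually_at_0_real_iff by blast
    then show "\<exists>j. \<forall>s t. s \<noteq> 0 \<and> \<bar>s\<bar> < 1 / real (Suc j) \<and> t \<noteq> 0 \<and> \<bar>t\<bar> < 1 / real (Suc j)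
       \<longrightarrow> \<bar>q s - q t\<bar> \<le> 1 / real (Suc k)"
      using P(2) by (intro exI[of _ j]) (auto intro: less_imp_le)
  next
    fix e :: real
    assume R: ?R and "0 < e"
    then obtain k where k: "1 / real (Suc k) < e"
      using exists_inverse_Suc_less[of e 1] by auto
    obtain j where "\<forall>s t. s \<noteq> 0 \<and> \<bar>s\<bar> < 1 / real (Suc j) \<and> t \<noteq> 0 \<and> \<bar>t\<bar> < 1 / real (Suc j)
       \<longrightarrow> \<bar>q s - q t\<bar> \<le> 1 / real (Suc k)"
      using R by blast
    then show "\<exists>P. eventually P (at 0) \<and> (\<forall>x y. P x \<and> P y \<longrightarrow> \<bar>q x - q y\<bar> < e)"
      using k unfolding eventually_at_0_real_iff
      by (intro exI[of _ "\<lambda>t. t \<noteq> 0 \<and> \<bar>t\<bar> < 1 / real (Suc j)"]) (auto intro: order_le_less_trans)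
  qed
  finally show ?thesis .
qed

lemma dir_differentiable_borel:
  assumes cont: "continuous_on UNIV f"
  shows "dir_differentiable f v \<in> sets borel"
proof -
  define q where "q = (\<lambda>t x. (f (x + t *\<^sub>R v) - f x) / t)"
  have contq: "continuous_on UNIV (q t)" if "t \<noteq> 0" for t
    unfolding q_def using that
    by (intro continuous_intros continuous_on_compose2[OF cont]) auto
  define C where "C = (\<lambda>k j. \<Inter>(s, t)\<in>{(s, t). s \<noteq> 0 \<and> \<bar>s\<bar> < 1 / real (Suc j) \<and> t \<noteq> 0 \<and> \<bar>t\<bar> < 1 / real (Suc j)}.
     {x. \<bar>q s x - q t x\<bar> \<le> 1 / real (Suc k)})"
  have "dir_differentiable f v = (\<Inter>k. \<Union>j. C k j)"
    unfolding dir_differentiable_def convergent_at_0_iff_Cauchy C_def q_def by auto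
  moreover have "closed (C k j)" for k j
    unfolding C_def
    by (intro closed_INT) (auto intro!: closed_Collect_le continuous_intros contq)
  ultimately show ?thesis
    by (auto intro!: sets.countable_INT sets.countable_UN borel_closed)
qed

lemma dir_additive_borel:
  assumes cont: "continuous_on UNIV f"
  shows "dir_additive f v w \<in> sets borel"
proof -
  define q where "q = (\<lambda>t x. (f (x + t *\<^sub>R (v + w)) - f (x + t *\<^sub>R v) - f (x + t *\<^sub>R w) + f x) / t)"
  have contq: "continuous_on UNIV (q t)" if "t \<noteq> 0" for t
    unfolding q_def using that
    by (intro continuous_intros continuous_on_compose2[OF cont]) auto
  define C where "C = (\<lambda>k j. \<Inter>t\<in>{t. t \<noteq> 0 \<and> \<bar>t\<bar> < 1 / real (Suc j)}. {x. \<bar>q t x - 0\<bar> \<le> 1 / real (Suc k)})"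
  have "dir_additive f v w = (\<Inter>k. \<Union>j. C k j)"
    unfolding dir_additive_def tendsto_at_0_iff_real C_def q_def by auto
  moreover have "closed (C k j)" for k j
    unfolding C_def
    by (intro closed_INT) (auto intro!: closed_Collect_le continuous_intros contq)
  ultimately show ?thesis
    by (auto intro!: sets.countable_INT sets.countable_UN borel_closed)
qed

lemma hadamard_imp_dir_differentiable:
  assumes "hadamard_differentiable f x"
  shows "x \<in> dir_differentiable f v"
proof -
  obtain D where "has_gateaux_derivative f D x"
    using assms unfolding hadamard_differentiable_def by blast
  then show ?thesis
    unfolding has_gateaux_derivative_def dir_differentiable_def by (intro CollectI exI) (rule spec)
qed

lemma hadamard_imp_dir_additive:
  assumes "hadamard_differentiable f x"
  shows "x \<in> dir_additive f v w"
proof -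
  obtain D where D: "\<And>h. ((\<lambda>t. (f (x + t *\<^sub>R h) - f x) / t) \<longlongrightarrow> blinfun_apply D h) (at (0::real))"
    using assms unfolding hadamard_differentiable_def has_gateaux_derivative_def by blast
  have "((\<lambda>t. (f (x + t *\<^sub>R (v + w)) - f x) / t - (f (x + t *\<^sub>R v) - f x) / t - (f (x + t *\<^sub>R w) - f x) / t)
      \<longlongrightarrow> blinfun_apply D (v + w) - blinfun_apply D v - blinfun_apply D w) (at (0::real))"
    by (intro tendsto_intros D)
  moreover have "(f (x + t *\<^sub>R (v + w)) - f x) / t - (f (x + t *\<^sub>R v) - f x) / t - (f (x + t *\<^sub>R w) - f x) / t
      = (f (x + t *\<^sub>R (v + w)) - f (x + t *\<^sub>R v) - f (x + t *\<^sub>R w) + f x) / t" for t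
    by (cases "t = 0") (simp_all add: field_simps)
  ultimately show ?thesis
    by (simp add: dir_additive_def blinfun.add_right)
qed

text \<open>
  The difference quotients of a Lipschitz function are equicontinuous in the direction. So convergence and
  additivity pass from a dense set of directions to all directions, and convergence is uniform on compact sets
  of directions.
\<close>
lemma lipschitz_hadamard_if_dense:
  fixes f :: "'a::real_normed_vector \<Rightarrow> real"
  assumes lip: "L-lipschitz_on UNIV f" and dense: "closure Q = UNIV"
    and diff: "\<And>v. v \<in> Q \<Longrightarrow> x \<in> dir_differentiable f v"
    and add: "\<And>v w. v \<in> Q \<Longrightarrow> w \<in> Q \<Longrightarrow> x \<in> dir_additive f v w"
  shows "hadamard_differentiable f x"
proof -
  have L: "L \<ge> 0" "\<bar>f y - f z\<bar> \<le> L * norm (y - z)" for y z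
    using lip by (auto simp: lipschitz_on_def dist_norm)
  define q where "q = (\<lambda>v t. (f (x + t *\<^sub>R v) - f x) / t)"
  have q_lip: "\<bar>q v t - q w t\<bar> \<le> L * norm (v - w)" for v w t
  proof (cases "t = 0")
    case False
    have "q v t - q w t = (f (x + t *\<^sub>R v) - f (x + t *\<^sub>R w)) / t"
      by (simp add: q_def diff_divide_distrib)
    also have "\<bar>\<dots>\<bar> \<le> L * norm (v - w)"
      using L(2)[of "x + t *\<^sub>R v" "x + t *\<^sub>R w"] False
      by (simp add: abs_divide divide_le_eq algebra_simps flip: scaleR_diff_right)
    finally show ?thesis .
  qed (use L in \<open>simp add: q_def\<close>)
  have near: "\<exists>v'\<in>Q. L * norm (v - v') \<le> e" if "e > 0" for v e
  proof -
    have "v \<in> closure Q"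
      using dense by auto
    moreover have "0 < e / (L + 1)"
      using that L(1) by simp
    ultimately obtain v' where v': "v' \<in> Q" "dist v' v < e / (L + 1)"
      unfolding closure_approachable by blast
    then have "norm (v - v') * (L + 1) < e"
      using L(1) by (subst (asm) pos_less_divide_eq) (auto simp: dist_norm norm_minus_commute)
    then have "(L + 1) * norm (v - v') < e"
      by (simp add: mult.commute)
    moreover have "L * norm (v - v') \<le> (L + 1) * norm (v - v')"
      by (intro mult_right_mono) auto
    ultimately show ?thesis
      using v'(1) by (intro bexI[of _ v']) auto
  qed
  have "\<exists>d. (q v \<longlongrightarrow> d) (at 0)" for v
    unfolding convergent_at_0_iff_Cauchy
  proof
    fix k
    define \<eta> where "\<eta> = 1 / (3 * real (Suc k))"
    have \<eta>: "0 < \<eta>" "1 / real (Suc k) = 3 * \<eta>" "1 / real (Suc (3 * k + 2)) = \<eta>"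
      by (simp_all add: \<eta>_def field_simps)
    obtain v' where v': "v' \<in> Q" "L * norm (v - v') \<le> \<eta>"
      using near[OF \<eta>(1)] by blast
    have "(\<exists>d. (q v' \<longlongrightarrow> d) (at 0))"
      using diff[OF v'(1)] by (simp add: dir_differentiable_def q_def)
    then obtain j where j: "\<And>s t. s \<noteq> 0 \<Longrightarrow> \<bar>s\<bar> < 1 / real (Suc j) \<Longrightarrow> t \<noteq> 0 \<Longrightarrow> \<bar>t\<bar> < 1 / real (Suc j)
       \<Longrightarrow> \<bar>q v' s - q v' t\<bar> \<le> \<eta>"
      unfolding convergent_at_0_iff_Cauchy \<eta>(3)[symmetric] by metis
    show "\<exists>j. \<forall>s t. s \<noteq> 0 \<and> \<bar>s\<bar> < 1 / real (Suc j) \<and> t \<noteq> 0 \<and> \<bar>t\<bar> < 1 / real (Suc j)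
       \<longrightarrow> \<bar>q v s - q v t\<bar> \<le> 1 / real (Suc k)"
    proof (intro exI[of _ j] allI impI)
      fix s t
      assume "s \<noteq> 0 \<and> \<bar>s\<bar> < 1 / real (Suc j) \<and> t \<noteq> 0 \<and> \<bar>t\<bar> < 1 / real (Suc j)"
      then have "\<bar>q v' s - q v' t\<bar> \<le> \<eta>"
        using j by blast
      then show "\<bar>q v s - q v t\<bar> \<le> 1 / real (Suc k)"
        unfolding \<eta>(2) using q_lip[of v s v'] q_lip[of v t v'] v'(2) by linarith
    qed
  qed
  then obtain d where d: "\<And>v. (q v \<longlongrightarrow> d v) (at 0)"
    by metis
  have d_lip: "\<bar>d v - d w\<bar> \<le> L * norm (v - w)" for v w
  proof (rule tendsto_upperbound)
    show "((\<lambda>t. \<bar>q v t - q w t\<bar>) \<longlongrightarrow> \<bar>d v - d w\<bar>) (at 0)"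
      by (intro tendsto_intros d)
  qed (auto simp: q_lip)
  have d_scale: "d (c *\<^sub>R v) = c * d v" for c v
  proof (cases "c = 0")
    case True
    have "(q 0 \<longlongrightarrow> 0) (at 0)"
      by (simp add: q_def)
    then have "d 0 = 0"
      using tendsto_unique[OF _ d[of 0]] by auto
    then show ?thesis
      using True by simp
  next
    case False
    have "filterlim (\<lambda>t. c * t) (at 0) (at (0::real))"
    proof (rule filterlim_atI)
      show "((\<lambda>t. c * t) \<longlongrightarrow> 0) (at 0)"
        by (auto intro!: tendsto_eq_intros)
      show "eventually (\<lambda>t. c * t \<noteq> 0) (at (0::real))"
        using False by (auto simp: eventually_at intro!: exI[of _ 1])
    qed
    then have "((\<lambda>t. q v (c * t)) \<longlongrightarrow> d v) (at 0)"
      using d[of v] by (rule filterlim_compose[rotated])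
    then have "((\<lambda>t. c * q v (c * t)) \<longlongrightarrow> c * d v) (at 0)"
      by (intro tendsto_intros)
    moreover have "c * q v (c * t) = q (c *\<^sub>R v) t" for t
      using False by (simp add: q_def mult.commute)
    ultimately show ?thesis
      using tendsto_unique[OF _ d[of "c *\<^sub>R v"]] by simp
  qed
  have d_add_Q: "d (v + w) = d v + d w" if "v \<in> Q" "w \<in> Q" for v w
  proof -
    have "((\<lambda>t. q (v + w) t - q v t - q w t) \<longlongrightarrow> d (v + w) - d v - d w) (at 0)"
      by (intro tendsto_intros d)
    moreover have "((\<lambda>t. q (v + w) t - q v t - q w t) \<longlongrightarrow> 0) (at 0)"
    proof -
      have "q (v + w) t - q v t - q w t
          = (f (x + t *\<^sub>R (v + w)) - f (x + t *\<^sub>R v) - f (x + t *\<^sub>R w) + f x) / t" for t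
        by (cases "t = 0") (simp_all add: q_def field_simps)
      then show ?thesis
        using add[OF that] by (simp add: dir_additive_def)
    qed
    ultimately have "d (v + w) - d v - d w = 0"
      by (rule tendsto_unique[rotated]) simp
    then show ?thesis
      by simp
  qed
  have d_add: "d (v + w) = d v + d w" for v w
  proof (rule ccontr)
    assume neq: "d (v + w) \<noteq> d v + d w"
    define e where "e = \<bar>d (v + w) - (d v + d w)\<bar> / 5"
    have e: "0 < e" "\<bar>d (v + w) - (d v + d w)\<bar> = 5 * e"
      using neq by (simp_all add: e_def)
    obtain v' w' where v': "v' \<in> Q" "L * norm (v - v') \<le> e" and w': "w' \<in> Q" "L * norm (w - w') \<le> e"
      using near[OF e(1)] by metis
    have "\<bar>d (v + w) - d (v' + w')\<bar> \<le> L * norm ((v - v') + (w - w'))"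
      using d_lip[of "v + w" "v' + w'"] by (simp add: algebra_simps)
    also have "\<dots> \<le> L * (norm (v - v') + norm (w - w'))"
      using L(1) by (intro mult_left_mono norm_triangle_ineq)
    also have "\<dots> \<le> 2 * e"
      using v'(2) w'(2) by (simp add: distrib_left)
    finally have "\<bar>d (v + w) - d (v' + w')\<bar> \<le> 2 * e" .
    moreover have "\<bar>d v - d v'\<bar> \<le> e" "\<bar>d w - d w'\<bar> \<le> e"
      using d_lip[of v v'] d_lip[of w w'] v'(2) w'(2) by linarith+
    ultimately show False
      using d_add_Q[OF v'(1) w'(1)] e by linarith
  qed
  have "d 0 = 0"
    using d_scale[of 0 0] by simp
  then have "\<bar>d v\<bar> \<le> norm v * L" for v
    using d_lip[of v 0] by (simp add: mult.commute)
  then have lin: "bounded_linear d"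
    by (intro bounded_linear_intro[of _ L]) (auto simp: d_add d_scale)
  define D where "D = Blinfun d"
  have D: "blinfun_apply D = d"
    unfolding D_def by (rule bounded_linear_Blinfun_apply[OF lin])
  have "uniform_limit K (\<lambda>t h. (f (x + t *\<^sub>R h) - f x) / t) (blinfun_apply D) (at (0::real))"
    if K: "compact K" for K
  proof (rule uniform_limitI)
    fix e :: real
    assume e: "0 < e"
    define r where "r = e / (3 * (L + 1))"
    have r: "r > 0" "L * r \<le> e / 3"
      using e L(1) by (auto simp: r_def field_simps)
    obtain F where F: "finite F" "K \<subseteq> (\<Union>v\<in>F. ball v r)"
      using K r(1) unfolding compact_eq_totally_bounded by blast
    have "eventually (\<lambda>t. \<forall>v\<in>F. \<bar>q v t - d v\<bar> < e / 3) (at 0)"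
      using F(1)
    proof (rule eventually_ball_finite)
      show "\<forall>v\<in>F. eventually (\<lambda>t. \<bar>q v t - d v\<bar> < e / 3) (at 0)"
        using tendstoD[OF d, of "e / 3"] e by (auto simp: dist_real_def)
    qed
    then show "eventually (\<lambda>t. \<forall>h\<in>K. dist ((f (x + t *\<^sub>R h) - f x) / t) (blinfun_apply D h) < e) (at 0)"
    proof eventually_elim
      case (elim t)
      show ?case
      proof
        fix h
        assume "h \<in> K"
        then obtain v where v: "v \<in> F" "dist v h < r"
          using F(2) by auto
        have "L * norm (h - v) \<le> L * r"
          using v(2) L(1) by (intro mult_left_mono) (auto simp: dist_norm norm_minus_commute)
        then have "\<bar>q h t - q v t\<bar> \<le> e / 3" "\<bar>d h - d v\<bar> \<le> e / 3"
          using q_lip[of h t v] d_lip[of h v] r(2) by linarith+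
        moreover have "\<bar>q v t - d v\<bar> < e / 3"
          using elim v(1) by auto
        ultimately have "\<bar>q h t - d h\<bar> < e"
          by linarith
        then show "dist ((f (x + t *\<^sub>R h) - f x) / t) (blinfun_apply D h) < e"
          by (simp add: D q_def dist_real_def)
      qed
    qed
  qed
  moreover have "has_gateaux_derivative f D x"
    using d by (simp add: has_gateaux_derivative_def D q_def)
  ultimately show ?thesis
    unfolding hadamard_differentiable_def by blast
qed

lemma null_along_not_dir_differentiable:
  fixes f :: "'a::{real_normed_vector, second_countable_topology} \<Rightarrow> real"
  assumes lip: "L-lipschitz_on UNIV f"
  shows "null_along v (- dir_differentiable f v)"
  unfolding null_along_def
proof
  fix x
  define h where "h = (\<lambda>s. f (x + s *\<^sub>R v))"
  have "(L * norm v)-lipschitz_on UNIV h"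
  proof (rule lipschitz_onI)
    fix s t :: real
    have "dist (h s) (h t) \<le> L * norm ((s - t) *\<^sub>R v)"
      using lipschitz_onD[OF lip, of "x + s *\<^sub>R v" "x + t *\<^sub>R v"]
      by (simp add: h_def dist_norm algebra_simps)
    then show "dist (h s) (h t) \<le> L * norm v * dist s t"
      by (simp add: dist_real_def mult_ac)
  qed (use lipschitz_on_nonneg[OF lip] in auto)
  from lipschitz_real_differentiable_ae[OF this]
  have "negligible {s. x + s *\<^sub>R v \<in> - dir_differentiable f v}"
    by (simp add: h_def dir_differentiable_def algebra_simps)
  moreover have "- dir_differentiable f v \<in> sets borel"
    using dir_differentiable_borel[OF lipschitz_on_continuous_on[OF lip], of v] by auto
  ultimately show "emeasure lborel {t. x + t *\<^sub>R v \<in> - dir_differentiable f v} = 0"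
    using null_on_lborel_iff_negligible line_section_borel by blast
qed

text \<open>
  The points at which the difference quotients in direction \<open>w\<close> stay within \<open>1 / (k + 1)\<close> of \<open>p\<close> at scales below
  \<open>1 / (j + 1)\<close>, while the second difference in directions \<open>v\<close> and \<open>w\<close>, divided by the step, exceeds four times this
  tolerance at arbitrarily small scales. The factor four leaves room for the two quotients and for the Lipschitz error in
  the porosity argument.
\<close>
definition porous_piece :: "('a::real_normed_vector \<Rightarrow> real) \<Rightarrow> 'a \<Rightarrow> 'a \<Rightarrow> real \<Rightarrow> nat \<Rightarrow> nat \<Rightarrow> 'a set" where
  "porous_piece f v w p k j = {x.
     (\<forall>t. t \<noteq> 0 \<and> \<bar>t\<bar> < 1 / real (Suc j) \<longrightarrow> \<bar>(f (x + t *\<^sub>R w) - f x) / t - p\<bar> \<le> 1 / real (Suc k)) \<and>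
     (\<forall>i. \<exists>t. t \<noteq> 0 \<and> \<bar>t\<bar> < 1 / real (Suc i) \<and>
        4 / real (Suc k) < \<bar>(f (x + t *\<^sub>R (v + w)) - f (x + t *\<^sub>R v) - f (x + t *\<^sub>R w) + f x) / t\<bar>)}"

lemma porous_piece_borel:
  assumes cont: "continuous_on UNIV f"
  shows "porous_piece f v w p k j \<in> sets borel"
proof -
  define q where "q = (\<lambda>t x. (f (x + t *\<^sub>R (v + w)) - f (x + t *\<^sub>R v) - f (x + t *\<^sub>R w) + f x) / t)"
  define q' where "q' = (\<lambda>t x. (f (x + t *\<^sub>R w) - f x) / t)"
  have contq: "continuous_on UNIV (q t)" "continuous_on UNIV (q' t)" if "t \<noteq> 0" for t
    unfolding q_def q'_def using that
    by (intro continuous_intros continuous_on_compose2[OF cont]; auto)+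
  define C where "C = (\<Inter>t\<in>{t. t \<noteq> 0 \<and> \<bar>t\<bar> < 1 / real (Suc j)}. {x. \<bar>q' t x - p\<bar> \<le> 1 / real (Suc k)})"
  define O' where "O' = (\<lambda>i. \<Union>t\<in>{t. t \<noteq> 0 \<and> \<bar>t\<bar> < 1 / real (Suc i)}. {x. 4 / real (Suc k) < \<bar>q t x\<bar>})"
  have "closed C"
    unfolding C_def
    by (intro closed_INT) (auto intro!: closed_Collect_le continuous_intros contq)
  moreover have "(\<Inter>i. O' i) \<in> sets borel"
    unfolding O'_def
    by (intro countable_INT_open_borel open_UN) (auto intro!: open_Collect_less continuous_intros contq)
  moreover have "porous_piece f v w p k j = C \<inter> (\<Inter>i. O' i)"
    unfolding porous_piece_def C_def O'_def q_def q'_def by auto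
  ultimately show ?thesis
    by auto
qed

lemma dir_differentiable_minus_additive_subset:
  "dir_differentiable f w - dir_additive f v w \<subseteq> (\<Union>p\<in>\<rat>. \<Union>k. \<Union>j. porous_piece f v w p k j)"
proof
  fix x
  assume x: "x \<in> dir_differentiable f w - dir_additive f v w"
  obtain d where d: "((\<lambda>t. (f (x + t *\<^sub>R w) - f x) / t) \<longlongrightarrow> d) (at (0::real))"
    using x by (auto simp: dir_differentiable_def)
  define q where "q = (\<lambda>t. (f (x + t *\<^sub>R (v + w)) - f (x + t *\<^sub>R v) - f (x + t *\<^sub>R w) + f x) / t)"
  have "\<not> (q \<longlongrightarrow> 0) (at 0)"
    using x by (simp add: dir_additive_def q_def)
  then obtain l where l: "\<And>i. \<exists>t. t \<noteq> 0 \<and> \<bar>t\<bar> < 1 / real (Suc i) \<and> \<not> \<bar>q t - 0\<bar> \<le> 1 / real (Suc l)"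
    unfolding tendsto_at_0_iff_real by blast
  define k where "k = 4 * l + 3"
  have k: "4 / real (Suc k) = 1 / real (Suc l)"
    by (simp add: k_def field_simps)
  define \<eta> where "\<eta> = 1 / (2 * real (Suc k))"
  have \<eta>: "0 < \<eta>" "1 / real (Suc k) = 2 * \<eta>"
    by (simp_all add: \<eta>_def del: of_nat_Suc)
  obtain p where p: "p \<in> \<rat>" "d < p" "p < d + \<eta>"
    using Rats_dense_in_real[of d "d + \<eta>"] \<eta>(1) by auto
  have "eventually (\<lambda>t. \<bar>(f (x + t *\<^sub>R w) - f x) / t - d\<bar> < \<eta>) (at 0)"
    using tendstoD[OF d \<eta>(1)] by (simp add: dist_real_def)
  then obtain j where j: "\<And>t. t \<noteq> 0 \<Longrightarrow> \<bar>t\<bar> < 1 / real (Suc j) \<Longrightarrow>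
      \<bar>(f (x + t *\<^sub>R w) - f x) / t - d\<bar> < \<eta>"
    unfolding eventually_at_0_real_iff by blast
  have "x \<in> porous_piece f v w p k j"
    unfolding porous_piece_def
  proof (intro CollectI conjI allI impI)
    fix t :: real
    assume "t \<noteq> 0 \<and> \<bar>t\<bar> < 1 / real (Suc j)"
    then show "\<bar>(f (x + t *\<^sub>R w) - f x) / t - p\<bar> \<le> 1 / real (Suc k)"
      unfolding \<eta>(2) using j[of t] p by linarith
  next
    fix i
    show "\<exists>t. t \<noteq> 0 \<and> \<bar>t\<bar> < 1 / real (Suc i) \<and>
        4 / real (Suc k) < \<bar>(f (x + t *\<^sub>R (v + w)) - f (x + t *\<^sub>R v) - f (x + t *\<^sub>R w) + f x) / t\<bar>"
      using l[of i] unfolding k q_def not_le diff_0_right .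
  qed
  then show "x \<in> (\<Union>p\<in>\<rat>. \<Union>k. \<Union>j. porous_piece f v w p k j)"
    using p(1) by blast
qed

text \<open>
  If the second difference of \<open>f\<close> at \<open>x\<close> is large for a step \<open>t\<close>, then the increments of \<open>f\<close> in direction \<open>w\<close> at \<open>x\<close> and
  at \<open>x + t *\<^sub>R v\<close> differ substantially. All points of the piece have nearly the same increments, and increments
  are stable under small displacements; so no point of the piece lies near \<open>x + t *\<^sub>R v\<close>. This is porosity in
  direction \<open>v\<close>.
\<close>
lemma null_along_porous_piece:
  fixes f :: "'a::{real_normed_vector, second_countable_topology} \<Rightarrow> real"
  assumes lip: "L-lipschitz_on UNIV f"
  shows "null_along v (porous_piece f v w p k j)"
  unfolding null_along_def
proof
  fix z
  have L: "L \<ge> 0" "\<bar>f y - f z\<bar> \<le> L * norm (y - z)" for y z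
    using lip by (auto simp: lipschitz_on_def dist_norm)
  define \<epsilon> where "\<epsilon> = 1 / real (Suc k)"
  have \<epsilon>: "\<epsilon> > 0"
    by (simp add: \<epsilon>_def)
  define c where "c = \<epsilon> / (2 * L * norm v + 1)"
  have Lv: "2 * L * norm v \<ge> 0"
    using L(1) by simp
  have c: "c > 0" "2 * L * norm v * c \<le> \<epsilon>"
  proof -
    show c: "c > 0"
      using \<epsilon> Lv by (simp add: c_def)
    have "(2 * L * norm v + 1) * c = \<epsilon>"
      using Lv by (simp add: c_def)
    then show "2 * L * norm v * c \<le> \<epsilon>"
      using c by (simp add: distrib_right)
  qed
  let ?P = "porous_piece f v w p k j"
  show "emeasure lborel {s. z + s *\<^sub>R v \<in> ?P} = 0"
  proof (rule porous_set_null[OF line_section_borel c(1)])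
    show "?P \<in> sets borel"
      by (rule porous_piece_borel[OF lipschitz_on_continuous_on[OF lip]])
    fix s d :: real
    assume s: "s \<in> {s. z + s *\<^sub>R v \<in> ?P}" and d: "0 < d"
    define x where "x = z + s *\<^sub>R v"
    have x: "x \<in> ?P"
      using s by (simp add: x_def)
    obtain i where i: "1 / real (Suc i) < min d (1 / real (Suc j))"
      using exists_inverse_Suc_less[of "min d (1 / real (Suc j))" 1] d by auto
    obtain t where t: "t \<noteq> 0" "\<bar>t\<bar> < 1 / real (Suc i)"
        "4 * \<epsilon> < \<bar>(f (x + t *\<^sub>R (v + w)) - f (x + t *\<^sub>R v) - f (x + t *\<^sub>R w) + f x) / t\<bar>"
      using x unfolding porous_piece_def \<epsilon>_def by (simp del: of_nat_Suc) blast
    have slope: "\<bar>f (y + t *\<^sub>R w) - f y - t * p\<bar> \<le> \<epsilon> * \<bar>t\<bar>" if "y \<in> ?P" for y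
    proof -
      have "\<bar>(f (y + t *\<^sub>R w) - f y) / t - p\<bar> \<le> \<epsilon>"
        using that t(1,2) i unfolding porous_piece_def \<epsilon>_def by force
      moreover have "(f (y + t *\<^sub>R w) - f y) / t - p = (f (y + t *\<^sub>R w) - f y - t * p) / t"
        using t(1) by (simp add: field_simps)
      ultimately show ?thesis
        using t(1) by (simp add: abs_divide divide_le_eq)
    qed
    have big: "4 * \<epsilon> * \<bar>t\<bar> < \<bar>f (x + t *\<^sub>R (v + w)) - f (x + t *\<^sub>R v) - f (x + t *\<^sub>R w) + f x\<bar>"
      using t(1,3) by (simp add: abs_divide less_divide_eq)
    have "s' \<notin> {s. z + s *\<^sub>R v \<in> ?P}" if s': "s' \<in> ball (s + t) (c * \<bar>t\<bar>)" for s'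
    proof
      assume "s' \<in> {s. z + s *\<^sub>R v \<in> ?P}"
      then have y: "z + s' *\<^sub>R v \<in> ?P"
        by simp
      define y where "y = z + s' *\<^sub>R v"
      define y0 where "y0 = x + t *\<^sub>R v"
      have "y0 - y = (s + t - s') *\<^sub>R v"
        by (simp add: y_def y0_def x_def algebra_simps)
      then have "norm (y0 - y) = \<bar>s + t - s'\<bar> * norm v"
        by simp
      also have "\<dots> \<le> (c * \<bar>t\<bar>) * norm v"
        using s' by (intro mult_right_mono) (auto simp: dist_real_def)
      finally have dist: "norm (y0 - y) \<le> c * \<bar>t\<bar> * norm v" .
      have "L * norm (y0 - y) \<le> L * (c * \<bar>t\<bar> * norm v)"
        using dist L(1) by (rule mult_left_mono)
      then have "2 * (L * norm (y0 - y)) \<le> (2 * L * norm v * c) * \<bar>t\<bar>"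
        by (simp add: algebra_simps)
      also have "\<dots> \<le> \<epsilon> * \<bar>t\<bar>"
        using c(2) by (rule mult_right_mono) simp
      finally have le: "2 * (L * norm (y0 - y)) \<le> \<epsilon> * \<bar>t\<bar>" .
      have "\<bar>f (y0 + t *\<^sub>R w) - f (y + t *\<^sub>R w)\<bar> \<le> L * norm (y0 - y)" "\<bar>f y0 - f y\<bar> \<le> L * norm (y0 - y)"
        using L(2)[of "y0 + t *\<^sub>R w" "y + t *\<^sub>R w"] L(2)[of y0 y] by simp_all
      moreover have "\<bar>f (y + t *\<^sub>R w) - f y - t * p\<bar> \<le> \<epsilon> * \<bar>t\<bar>" "\<bar>f (x + t *\<^sub>R w) - f x - t * p\<bar> \<le> \<epsilon> * \<bar>t\<bar>"
        using slope[OF y] slope[OF x] by (simp_all add: y_def)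
      moreover have "4 * \<epsilon> * \<bar>t\<bar> < \<bar>f (y0 + t *\<^sub>R w) - f y0 - f (x + t *\<^sub>R w) + f x\<bar>"
        using big by (simp add: y0_def algebra_simps)
      ultimately show False
        using le by (simp add: mult.assoc)
    qed
    then show "\<exists>t. t \<noteq> 0 \<and> \<bar>t\<bar> < d \<and> ball (s + t) (c * \<bar>t\<bar>) \<inter> {s. z + s *\<^sub>R v \<in> ?P} = {}"
      using t(1,2) i by (intro exI[of _ t]) auto
  qed
qed

lemma countable_dense_subset:
  fixes S :: "'a::{real_normed_vector, second_countable_topology} set"
  obtains Q where "countable Q" "Q \<subseteq> S" "closure Q = closure S"
proof -
  obtain Q where Q: "countable Q" "Q \<subseteq> S" "S \<subseteq> closure Q"
    using separable[of S] by blast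
  then have "closure Q = closure S"
    by (metis closure_closure closure_mono subset_antisym)
  then show thesis
    using Q that by blast
qed

lemma countable_dense_set:
  obtains Q :: "'a::{real_normed_vector, second_countable_topology} set"
  where "countable Q" "closure Q = UNIV"
proof -
  obtain Q :: "'a set" where "countable Q" "closure Q = closure UNIV"
    by (rule countable_dense_subset[of "UNIV :: 'a set"])
  then show thesis
    by (intro that[of Q]) auto
qed

text \<open>
  The exceptional set is described by an arbitrary countable dense set of directions. For a given sequence \<open>\<xi>\<close>
  this set is chosen inside the span of \<open>\<xi>\<close>, so that all pieces are null along directions of the span.
\<close>
theorem aronszajn_null_not_hadamard_lipschitz:
  fixes f :: "'a::{real_normed_vector, second_countable_topology} \<Rightarrow> real"
  assumes lip: "L-lipschitz_on UNIV f"
  shows "aronszajn_null {x. \<not> hadamard_differentiable f x}"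
proof (rule aronszajn_nullI)
  have cont: "continuous_on UNIV f"
    by (rule lipschitz_on_continuous_on[OF lip])
  have eq: "{x. \<not> hadamard_differentiable f x}
      = (\<Union>v\<in>Q. - dir_differentiable f v) \<union> (\<Union>v\<in>Q. \<Union>w\<in>Q. - dir_additive f v w)"
    if "closure Q = UNIV" for Q
  proof -
    have "hadamard_differentiable f x \<longleftrightarrow>
        (\<forall>v\<in>Q. x \<in> dir_differentiable f v) \<and> (\<forall>v\<in>Q. \<forall>w\<in>Q. x \<in> dir_additive f v w)" for x
      using lipschitz_hadamard_if_dense[OF lip that, of x] hadamard_imp_dir_differentiable[of f x]
        hadamard_imp_dir_additive[of f x] by metis
    then show ?thesis
      by auto
  qed
  obtain Q :: "'a set" where Q: "countable Q" "closure Q = UNIV"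
    by (rule countable_dense_set)
  show "{x. \<not> hadamard_differentiable f x} \<in> sets borel"
    unfolding eq[OF Q(2)]
    using Q(1) dir_differentiable_borel[OF cont] dir_additive_borel[OF cont]
    by (intro sets.Un sets.countable_UN' ) auto
  fix \<xi> :: "nat \<Rightarrow> 'a"
  assume \<xi>: "closure (span (range \<xi>)) = UNIV"
  obtain Q where Q: "countable Q" "Q \<subseteq> span (range \<xi>)" "closure Q = UNIV"
    using countable_dense_subset[of "span (range \<xi>)"] \<xi> by metis
  define \<T> where "\<T> = (\<lambda>v. - dir_differentiable f v) ` Q \<union>
      (\<lambda>(v, w, p, k, j). porous_piece f v w p k j) ` (Q \<times> Q \<times> \<rat> \<times> UNIV \<times> UNIV)"
  have "countable \<T>"
    unfolding \<T>_def using Q(1)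
    by (intro countable_Un countable_image countable_SIGMA) (auto simp: countable_rat)
  moreover have "{x. \<not> hadamard_differentiable f x} \<subseteq> \<Union>\<T>"
  proof
    fix x
    assume "x \<in> {x. \<not> hadamard_differentiable f x}"
    then consider v where "v \<in> Q" "x \<notin> dir_differentiable f v"
      | v w where "v \<in> Q" "w \<in> Q" "x \<in> dir_differentiable f w - dir_additive f v w"
      unfolding eq[OF Q(3)] by blast
    then show "x \<in> \<Union>\<T>"
    proof cases
      case 1
      then show ?thesis
        by (auto simp: \<T>_def)
    next
      case 2
      then obtain p k j where "p \<in> \<rat>" "x \<in> porous_piece f v w p k j"
        using dir_differentiable_minus_additive_subset[of f w v] by blast
      then show ?thesis
        using 2(1,2) unfolding \<T>_def by (intro UnionI[of "porous_piece f v w p k j"]) force+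
    qed
  qed
  moreover have "T \<in> sets borel \<and> (\<exists>e\<in>span (range \<xi>). null_along e T)" if T: "T \<in> \<T>" for T
  proof -
    consider v where "v \<in> Q" "T = - dir_differentiable f v"
      | v w p k j where "v \<in> Q" "T = porous_piece f v w p k j"
      using T unfolding \<T>_def by auto
    then show ?thesis
    proof cases
      case 1
      then show ?thesis
        using Q(2) null_along_not_dir_differentiable[OF lip] dir_differentiable_borel[OF cont]
        by (intro conjI bexI[of _ v]) auto
    next
      case 2
      then show ?thesis
        using Q(2) null_along_porous_piece[OF lip] porous_piece_borel[OF cont]
        by (intro conjI bexI[of _ v]) auto
    qed
  qed
  ultimately show "\<exists>\<T>. countable \<T> \<and> {x. \<not> hadamard_differentiable f x} \<subseteq> \<Union>\<T> \<and>
        (\<forall>T\<in>\<T>. T \<in> sets borel \<and> (\<exists>e\<in>span (range \<xi>). null_along e T))"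
    by blast
qed

section \<open>From Lipschitz bounds at points to differentiability\<close>

definition pointwise_lipschitz :: "('a::real_normed_vector \<Rightarrow> real) \<Rightarrow> 'a \<Rightarrow> bool" where
  "pointwise_lipschitz g x \<longleftrightarrow> (\<exists>L. \<exists>\<delta>>0. \<forall>y\<in>ball x \<delta>. \<bar>g y - g x\<bar> \<le> L * norm (y - x))"

text \<open>
  The largest function with Lipschitz constant \<open>i\<close> that lies below \<open>g\<close> on \<open>B\<close>.
\<close>
definition lipschitz_minorant :: "nat \<Rightarrow> 'a set \<Rightarrow> ('a::real_normed_vector \<Rightarrow> real) \<Rightarrow> 'a \<Rightarrow> real" where
  "lipschitz_minorant i B g z = (INF y\<in>B. g y + real i * norm (z - y))"

lemma lipschitz_minorant_touching:
  fixes g :: "'a::real_normed_vector \<Rightarrow> real"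
  assumes x: "x \<in> B" and above: "\<And>y. y \<in> B \<Longrightarrow> g x \<le> g y + real i * norm (x - y)"
  shows "(real i)-lipschitz_on UNIV (lipschitz_minorant i B g)"
    and "\<And>z. z \<in> B \<Longrightarrow> lipschitz_minorant i B g z \<le> g z"
    and "lipschitz_minorant i B g x = g x"
proof -
  let ?u = "lipschitz_minorant i B g"
  have bdd: "bdd_below ((\<lambda>y. g y + real i * norm (z - y)) ` B)" for z
  proof (rule bdd_belowI2)
    fix y
    assume y: "y \<in> B"
    have "norm (x - y) \<le> norm (z - y) + norm (z - x)"
      using norm_triangle_ineq[of "x - z" "z - y"] by (simp add: norm_minus_commute)
    then have "real i * norm (x - y) \<le> real i * (norm (z - y) + norm (z - x))"
      by (rule mult_left_mono) simp
    then show "g x - real i * norm (z - x) \<le> g y + real i * norm (z - y)"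
      using above[OF y] by (simp add: distrib_left)
  qed
  have le: "?u z \<le> ?u z' + real i * norm (z - z')" for z z'
  proof -
    have "?u z - real i * norm (z - z') \<le> ?u z'"
      unfolding lipschitz_minorant_def[of i B g z']
    proof (rule cINF_greatest)
      fix y
      assume y: "y \<in> B"
      have "?u z \<le> g y + real i * norm (z - y)"
        unfolding lipschitz_minorant_def by (rule cINF_lower[OF bdd y])
      also have "real i * norm (z - y) \<le> real i * (norm (z' - y) + norm (z - z'))"
        using norm_triangle_ineq[of "z - z'" "z' - y"] by (intro mult_left_mono) auto
      finally show "?u z - real i * norm (z - z') \<le> g y + real i * norm (z' - y)"
        by (simp add: distrib_left)
    qed (use x in auto)
    then show ?thesis
      by simp
  qed
  show "(real i)-lipschitz_on UNIV ?u"
  proof (rule lipschitz_onI)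
    fix z z'
    show "dist (?u z) (?u z') \<le> real i * dist z z'"
      using le[of z z'] le[of z' z] by (simp add: dist_norm norm_minus_commute abs_le_iff)
  qed auto
  show le_g: "?u z \<le> g z" if "z \<in> B" for z
    using cINF_lower[OF bdd that, of z] by (simp add: lipschitz_minorant_def)
  have "g x \<le> ?u x"
    unfolding lipschitz_minorant_def using x above by (intro cINF_greatest) auto
  then show "?u x = g x"
    using le_g[OF x] by simp
qed

text \<open>
  The difference \<open>v - u\<close> has a minimum at \<open>x\<close>, so that \<open>u\<close> and \<open>v\<close> have the same derivative there; the difference
  quotients of \<open>g\<close> lie between those of \<open>u\<close> and \<open>v\<close>.
\<close>
lemma hadamard_differentiable_sandwich:
  fixes g :: "'a::real_normed_vector \<Rightarrow> real"
  assumes u: "hadamard_differentiable u x" and v: "hadamard_differentiable v x"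
    and \<delta>: "\<delta> > 0" and le: "\<And>y. y \<in> ball x \<delta> \<Longrightarrow> u y \<le> g y \<and> g y \<le> v y"
    and eq: "u x = g x" "v x = g x"
  shows "hadamard_differentiable g x"
proof -
  define q where "q = (\<lambda>f t h. (f (x + t *\<^sub>R h) - f x) / t :: real)"
  obtain D where D: "\<And>h. ((\<lambda>t. q u t h) \<longlongrightarrow> blinfun_apply D h) (at (0::real))"
      "\<And>K. compact K \<Longrightarrow> uniform_limit K (q u) (blinfun_apply D) (at (0::real))"
    using u unfolding hadamard_differentiable_def has_gateaux_derivative_def q_def by blast
  obtain D' where D': "\<And>h. ((\<lambda>t. q v t h) \<longlongrightarrow> blinfun_apply D' h) (at (0::real))"
      "\<And>K. compact K \<Longrightarrow> uniform_limit K (q v) (blinfun_apply D') (at (0::real))"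
    using v unfolding hadamard_differentiable_def has_gateaux_derivative_def q_def by blast
  have small: "eventually (\<lambda>t. \<forall>h\<in>K. x + t *\<^sub>R h \<in> ball x \<delta>) (at (0::real))" if K: "bounded K" for K
  proof -
    obtain M where M: "M > 0" "\<And>h. h \<in> K \<Longrightarrow> norm h \<le> M"
      using K bounded_pos[of K] by metis
    show ?thesis
      unfolding eventually_at
    proof (intro exI[of _ "\<delta> / M"] conjI impI ballI)
      fix t :: real and h
      assume t: "t \<noteq> 0 \<and> dist t 0 < \<delta> / M" and h: "h \<in> K"
      have "\<bar>t\<bar> * norm h \<le> \<bar>t\<bar> * M"
        using M(2)[OF h] by (intro mult_left_mono) auto
      also have "\<dots> < \<delta>"
        using t M(1) by (simp add: field_simps)
      finally show "x + t *\<^sub>R h \<in> ball x \<delta>"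
        by (simp add: dist_norm)
    qed (use M \<delta> in auto)
  qed
  have between: "\<bar>q g t h - l\<bar> \<le> max \<bar>q u t h - l\<bar> \<bar>q v t h - l\<bar>" if "x + t *\<^sub>R h \<in> ball x \<delta>" for t h l
  proof -
    have *: "u (x + t *\<^sub>R h) \<le> g (x + t *\<^sub>R h)" "g (x + t *\<^sub>R h) \<le> v (x + t *\<^sub>R h)"
      using le[OF that] by auto
    have "q u t h \<le> q g t h \<and> q g t h \<le> q v t h \<or> q v t h \<le> q g t h \<and> q g t h \<le> q u t h"
    proof (cases "t \<ge> 0")
      case True
      then have "q u t h \<le> q g t h \<and> q g t h \<le> q v t h"
        using * eq unfolding q_def by (intro conjI divide_right_mono) auto
      then show ?thesis ..
    next
      case False
      then have "q v t h \<le> q g t h \<and> q g t h \<le> q u t h"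
        using * eq unfolding q_def by (intro conjI divide_right_mono_neg) auto
      then show ?thesis ..
    qed
    then show ?thesis
      by linarith
  qed
  have D_le: "blinfun_apply D h \<le> blinfun_apply D' h" for h
  proof (rule tendsto_le)
    show "((\<lambda>t. q v t h) \<longlongrightarrow> blinfun_apply D' h) (at_right (0::real))"
      "((\<lambda>t. q u t h) \<longlongrightarrow> blinfun_apply D h) (at_right (0::real))"
      using D(1) D'(1) by (auto intro: filterlim_mono[OF _ order_refl at_le])
    have "eventually (\<lambda>t. x + t *\<^sub>R h \<in> ball x \<delta>) (at_right (0::real))"
      using filter_leD[OF at_le small[of "{h}"], of "{0<..}"] by auto
    moreover have "eventually (\<lambda>t. t > 0) (at_right (0::real))"
      by (simp add: eventually_at_right_less)
    ultimately show "eventually (\<lambda>t. q u t h \<le> q v t h) (at_right (0::real))"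
    proof eventually_elim
      case (elim t)
      have "u (x + t *\<^sub>R h) \<le> v (x + t *\<^sub>R h)"
        using le[OF elim(1)] by linarith
      then show ?case
        using elim(2) eq by (auto simp: q_def intro!: divide_right_mono)
    qed
  qed auto
  have D_eq: "blinfun_apply D' = blinfun_apply D"
  proof
    fix h
    show "blinfun_apply D' h = blinfun_apply D h"
      using D_le[of h] D_le[of "- h"] by (simp add: blinfun.minus_right)
  qed
  have lim: "uniform_limit K (q g) (blinfun_apply D) (at (0::real))" if K: "compact K" for K
  proof (rule uniform_limitI)
    fix e :: real
    assume e: "0 < e"
    have "eventually (\<lambda>t. \<forall>h\<in>K. dist (q u t h) (blinfun_apply D h) < e) (at 0)"
      using uniform_limitD[OF D(2)[OF K] e] .
    moreover have "eventually (\<lambda>t. \<forall>h\<in>K. dist (q v t h) (blinfun_apply D h) < e) (at 0)"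
      using uniform_limitD[OF D'(2)[OF K] e] by (simp add: D_eq)
    ultimately show "eventually (\<lambda>t. \<forall>h\<in>K. dist (q g t h) (blinfun_apply D h) < e) (at 0)"
      using small[OF compact_imp_bounded[OF K]]
    proof eventually_elim
      case (elim t)
      show ?case
      proof
        fix h
        assume h: "h \<in> K"
        have "max \<bar>q u t h - blinfun_apply D h\<bar> \<bar>q v t h - blinfun_apply D h\<bar> < e"
          using elim(1,2) h by (auto simp: dist_real_def)
        then show "dist (q g t h) (blinfun_apply D h) < e"
          using between[of t h "blinfun_apply D h"] elim(3) h by (auto simp: dist_real_def)
      qed
    qed
  qed
  have "((\<lambda>t. q g t h) \<longlongrightarrow> blinfun_apply D h) (at (0::real))" for h
    using tendsto_uniform_limitI[OF lim[of "{h}"]] by simp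
  then show ?thesis
    unfolding hadamard_differentiable_def has_gateaux_derivative_def
    using lim unfolding q_def by blast
qed

text \<open>
  Maly's proof of the Stepanov theorem. If \<open>g\<close> satisfies a Lipschitz bound with constant at most \<open>i\<close> at \<open>x\<close>, then
  on a small ball around \<open>x\<close> the largest \<open>i\<close>-Lipschitz minorant and the smallest \<open>i\<close>-Lipschitz majorant of \<open>g\<close>
  touch \<open>g\<close> at \<open>x\<close>. Only balls with centres in a countable dense set, rational radii and integer constants
  are needed. The function \<open>g\<close> itself may be non-measurable.
\<close>
theorem hadamard_if_pointwise_lipschitz_ae:
  fixes g :: "'a::{real_normed_vector, second_countable_topology} \<Rightarrow> real"
  shows "\<exists>N. aronszajn_null N \<and> (\<forall>x. x \<notin> N \<longrightarrow> pointwise_lipschitz g x \<longrightarrow> hadamard_differentiable g x)"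
proof -
  obtain C :: "'a set" where C: "countable C" "closure C = UNIV"
    by (rule countable_dense_set)
  define u where "u = (\<lambda>(c, n, i). lipschitz_minorant i (ball c (1 / real (Suc n))) g)"
  define v where "v = (\<lambda>(c, n, i) x. - lipschitz_minorant i (ball c (1 / real (Suc n))) (\<lambda>y. - g y) x)"
  (* On a badly chosen ball the infimum is over sets without lower bound, and the minorant is a
     meaningless function. The case distinction makes the exceptional set null for every index. *)
  define bad where "bad = (\<lambda>h :: 'a \<Rightarrow> real. if \<exists>L. L-lipschitz_on UNIV h then {x. \<not> hadamard_differentiable h x} else {})"
  have bad: "aronszajn_null (bad h)" for h
    unfolding bad_def using aronszajn_null_not_hadamard_lipschitz[of _ h] aronszajn_null_empty by auto
  define N where "N = (\<Union>k\<in>C \<times> UNIV \<times> UNIV. bad (u k) \<union> bad (v k))"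
  have "aronszajn_null N"
    unfolding N_def using C(1)
    by (intro aronszajn_null_countable_Union aronszajn_null_Un bad countable_SIGMA) auto
  moreover have "hadamard_differentiable g x" if x: "x \<notin> N" and lip: "pointwise_lipschitz g x" for x
  proof -
    obtain L \<delta> where \<delta>: "\<delta> > 0" "\<And>y. y \<in> ball x \<delta> \<Longrightarrow> \<bar>g y - g x\<bar> \<le> L * norm (y - x)"
      using lip unfolding pointwise_lipschitz_def by blast
    obtain i :: nat where i: "L \<le> real i"
      using real_arch_simple by blast
    obtain n where n: "2 / real (Suc n) < \<delta>"
      using exists_inverse_Suc_less[OF \<delta>(1), of 2] by auto
    have "x \<in> closure C"
      using C(2) by simp
    then obtain c where c: "c \<in> C" "dist c x < 1 / real (Suc n)"
      unfolding closure_approachable by (meson of_nat_0_less_iff zero_less_Suc zero_less_divide_1_iff)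
    define B where "B = ball c (1 / real (Suc n))"
    have xB: "x \<in> B"
      using c(2) by (simp add: B_def)
    have "B \<subseteq> ball x \<delta>"
    proof
      fix y
      assume "y \<in> B"
      then have "dist c y < 1 / real (Suc n)"
        by (simp add: B_def)
      then have "dist x y < 1 / real (Suc n) + 1 / real (Suc n)"
        using c(2) dist_triangle[of x y c] by (simp add: dist_commute)
      also have "\<dots> = 2 / real (Suc n)"
        by simp
      finally show "y \<in> ball x \<delta>"
        using n by simp
    qed
    then have bound: "\<bar>g y - g x\<bar> \<le> real i * norm (x - y)" if "y \<in> B" for y
    proof -
      have "\<bar>g y - g x\<bar> \<le> L * norm (x - y)"
        using \<delta>(2)[of y] that \<open>B \<subseteq> ball x \<delta>\<close> by (auto simp: norm_minus_commute)
      also have "\<dots> \<le> real i * norm (x - y)"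
        using i by (intro mult_right_mono) auto
      finally show ?thesis .
    qed
    let ?k = "(c, n, i)"
    have U: "(real i)-lipschitz_on UNIV (u ?k)" "\<And>z. z \<in> B \<Longrightarrow> u ?k z \<le> g z" "u ?k x = g x"
      unfolding u_def prod.case B_def[symmetric]
      using lipschitz_minorant_touching[OF xB, of g i] bound by (force simp: abs_le_iff)+
    have V': "(real i)-lipschitz_on UNIV (lipschitz_minorant i B (\<lambda>y. - g y))"
      "\<And>z. z \<in> B \<Longrightarrow> lipschitz_minorant i B (\<lambda>y. - g y) z \<le> - g z"
      "lipschitz_minorant i B (\<lambda>y. - g y) x = - g x"
      using lipschitz_minorant_touching[OF xB, of "\<lambda>y. - g y" i] bound by (force simp: abs_le_iff)+
    have V: "(real i)-lipschitz_on UNIV (v ?k)" "\<And>z. z \<in> B \<Longrightarrow> g z \<le> v ?k z" "v ?k x = g x"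
      unfolding v_def prod.case B_def[symmetric] using V' by (force simp: lipschitz_on_def dist_minus)+
    have "?k \<in> C \<times> UNIV \<times> UNIV"
      using c(1) by simp
    then have "x \<notin> bad (u ?k)" "x \<notin> bad (v ?k)"
      using x unfolding N_def by blast+
    then have had: "hadamard_differentiable (u ?k) x" "hadamard_differentiable (v ?k) x"
      unfolding bad_def using U(1) V(1) by (auto split: if_splits)
    obtain e where e: "e > 0" "ball x e \<subseteq> B"
      using xB open_ball[of c "1 / real (Suc n)"] unfolding B_def open_contains_ball by blast
    show ?thesis
      by (rule hadamard_differentiable_sandwich[where g = g, OF had e(1) _ U(3) V(3)]) (use U(2) V(2) e(2) in auto)
  qed
  ultimately show ?thesis
    by blast
qed

section \<open>Cone-monotone functions\<close>

text \<open>
  Monotonicity near \<open>x\<close> in all directions of the ball around \<open>e\<close>, that is, with respect to the cone that this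
  ball generates.
\<close>
definition locally_cone_monotone :: "('a::real_normed_vector \<Rightarrow> real) \<Rightarrow> 'a \<Rightarrow> 'a \<Rightarrow> real \<Rightarrow> bool" where
  "locally_cone_monotone g x e r \<longleftrightarrow>
     (\<forall>y\<in>ball x r. \<forall>k\<in>ball e r. \<forall>t\<in>{0..1}. g (y - t *\<^sub>R k) \<le> g y)"

lemma locally_cone_monotoneD:
  assumes "locally_cone_monotone g x e r" "dist x a < r" "0 < s" "s \<le> 1" "norm (a - b - s *\<^sub>R e) < s * r"
  shows "g b \<le> g a"
proof -
  define k where "k = (1 / s) *\<^sub>R (a - b)"
  have "s *\<^sub>R (k - e) = a - b - s *\<^sub>R e"
    using assms(3) by (simp add: k_def algebra_simps)
  then have "s * norm (k - e) < s * r"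
    using assms(3,5) by (metis abs_of_pos norm_scaleR)
  then have "k \<in> ball e r"
    using assms(3) by (simp add: dist_norm norm_minus_commute)
  then have "g (a - s *\<^sub>R k) \<le> g a"
    using assms unfolding locally_cone_monotone_def by simp
  then show ?thesis
    using assms(3) by (simp add: k_def)
qed

text \<open>
  A \<open>G\<^sub>\<delta>\<close> set of points at which the symmetric difference quotients along \<open>e\<close> are unbounded. The interiors make
  it a Borel set for functions that are not measurable.
\<close>
definition steep_set :: "('a::real_normed_vector \<Rightarrow> real) \<Rightarrow> 'a \<Rightarrow> 'a set" where
  "steep_set g e = (\<Inter>k. interior {x. \<exists>t. 0 < t \<and> t * real (Suc k) < 1 \<and>
     real (Suc k) * t < g (x + (2 * t) *\<^sub>R e) - g (x - (2 * t) *\<^sub>R e)})"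

text \<open>
  For \<open>\<tau> = 2 * norm (y - x) / r\<close> the point \<open>y\<close> lies between \<open>x - \<tau> *\<^sub>R e\<close> and \<open>x + \<tau> *\<^sub>R e\<close> in the order of the cone. So a
  steep increment from \<open>x\<close> to \<open>y\<close> is a steep symmetric increment along \<open>e\<close> at \<open>x\<close>. Doubling the step gives room to
  move the base point, which puts \<open>x\<close> into the interiors in the definition of the steep set.
\<close>
lemma pointwise_lipschitz_if_not_steep:
  assumes mono: "locally_cone_monotone g x0 e r" and r: "r > 0"
    and x: "dist x0 x < r / 4" and not_steep: "x \<notin> steep_set g e"
  shows "pointwise_lipschitz g x"
proof (rule ccontr)
  note M = locally_cone_monotoneD[OF mono]
  assume not_lip: "\<not> pointwise_lipschitz g x"
  have "x \<in> interior {x. \<exists>t. 0 < t \<and> t * real (Suc k) < 1 \<and>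
     real (Suc k) * t < g (x + (2 * t) *\<^sub>R e) - g (x - (2 * t) *\<^sub>R e)}" for k
  proof -
    define \<tau>0 where "\<tau>0 = min (1 / real (Suc k)) (r / (2 * (r + 2 * norm e)))"
    have re: "r + 2 * norm e > 0"
      using r by (simp add: add_pos_nonneg)
    have \<tau>0: "\<tau>0 > 0"
      using r re by (simp add: \<tau>0_def)
    define \<delta> where "\<delta> = min (r / 4) (r * \<tau>0 / 2)"
    have \<delta>: "\<delta> > 0"
      using r \<tau>0 by (simp add: \<delta>_def)
    have "\<not> (\<forall>y\<in>ball x \<delta>. \<bar>g y - g x\<bar> \<le> (2 * real (Suc k) / r) * norm (y - x))"
      using not_lip \<delta> unfolding pointwise_lipschitz_def by blast
    then obtain y where y: "y \<in> ball x \<delta>" "\<bar>g y - g x\<bar> > (2 * real (Suc k) / r) * norm (y - x)"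
      unfolding not_le[symmetric] by blast
    define n where "n = norm (y - x)"
    have n: "0 < n" "n < \<delta>"
      using y by (auto simp: n_def dist_norm norm_minus_commute)
    define \<tau> where "\<tau> = 2 * n / r"
    have \<tau>: "0 < \<tau>" "\<tau> < \<tau>0" "n < \<tau> * r"
      using n r by (auto simp: \<tau>_def \<delta>_def field_simps)
    have "\<tau> * real (Suc k) < 1"
      using \<tau>(2) by (simp add: \<tau>0_def less_divide_eq)
    moreover have "\<tau> \<le> \<tau> * real (Suc k)"
      using \<tau>(1) by simp
    ultimately have \<tau>1: "\<tau> * real (Suc k) < 1" "\<tau> \<le> 1"
      by linarith+
    have "\<tau> < r / (2 * (r + 2 * norm e))"
      using \<tau>(2) by (simp add: \<tau>0_def)
    then have "\<tau> * (2 * (r + 2 * norm e)) < r"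
      using re by (subst (asm) pos_less_divide_eq) auto
    then have \<tau>2: "2 * (\<tau> * r) + 4 * (\<tau> * norm e) < r"
      by (simp add: algebra_simps)
    have pos: "0 \<le> \<tau> * r" "0 \<le> \<tau> * norm e" "0 < \<tau> * r"
      using \<tau>(1) r by auto
    have nx: "norm (x0 - x) < r / 4"
      using x by (simp add: dist_norm)
    have ball: "dist x0 (x' + c *\<^sub>R e) < r" if "norm (x - x') < \<tau> * r" "\<bar>c\<bar> \<le> 2 * \<tau>" for x' c
    proof -
      have "norm (x0 - (x' + c *\<^sub>R e)) \<le> norm (x0 - x) + norm (x - x') + norm (c *\<^sub>R e)"
        using norm_triangle_ineq[of "x0 - x" "x - x'"] norm_triangle_ineq4[of "x0 - x'" "c *\<^sub>R e"]
        by (simp add: algebra_simps)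
      moreover have "norm (c *\<^sub>R e) \<le> 2 * (\<tau> * norm e)"
        using mult_right_mono[OF that(2), of "norm e"] by simp
      ultimately have "norm (x0 - (x' + c *\<^sub>R e)) < r"
        using that(1) nx \<tau>2 pos by linarith
      then show ?thesis
        by (simp add: dist_norm)
    qed
    (* the point y and the point x lie between the two endpoints *)
    have 1: "g y \<le> g (x + \<tau> *\<^sub>R e)"
      by (rule M[OF ball \<tau>(1) \<tau>1(2)]) (use \<tau> n pos in \<open>auto simp: n_def norm_minus_commute\<close>)
    have 2: "g (x - \<tau> *\<^sub>R e) \<le> g y"
    proof (rule M[OF _ \<tau>(1) \<tau>1(2)])
      show "dist x0 y < r"
        using ball[of y 0] n(1) \<tau> by (simp add: n_def norm_minus_commute)
    qed (use \<tau>(3) in \<open>simp add: n_def\<close>)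
    have 3: "g x \<le> g (x + \<tau> *\<^sub>R e)"
      by (rule M[OF ball \<tau>(1) \<tau>1(2)]) (use \<tau> pos in auto)
    have 4: "g (x - \<tau> *\<^sub>R e) \<le> g x"
      by (rule M[OF _ \<tau>(1) \<tau>1(2)]) (use \<tau> pos x r in auto)
    have "real (Suc k) * \<tau> = (2 * real (Suc k) / r) * norm (y - x)"
      using r by (simp add: \<tau>_def n_def)
    then have steep: "real (Suc k) * \<tau> < g (x + \<tau> *\<^sub>R e) - g (x - \<tau> *\<^sub>R e)"
      using y(2) 1 2 3 4 by linarith
    have "x' \<in> {x. \<exists>t. 0 < t \<and> t * real (Suc k) < 1 \<and>
       real (Suc k) * t < g (x + (2 * t) *\<^sub>R e) - g (x - (2 * t) *\<^sub>R e)}" if x': "x' \<in> ball x (\<tau> * r)" for x'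
    proof -
      have d: "norm (x - x') < \<tau> * r"
        using x' by (simp add: dist_norm)
      have "g (x + \<tau> *\<^sub>R e) \<le> g (x' + (2 * \<tau>) *\<^sub>R e)"
      proof (rule M[OF ball[OF d] \<tau>(1) \<tau>1(2)])
        have eq: "x' + (2 * \<tau>) *\<^sub>R e - (x + \<tau> *\<^sub>R e) - \<tau> *\<^sub>R e = x' - x"
          by (simp add: algebra_simps flip: scaleR_2)
        show "norm (x' + (2 * \<tau>) *\<^sub>R e - (x + \<tau> *\<^sub>R e) - \<tau> *\<^sub>R e) < \<tau> * r"
          unfolding eq using d by (simp only: norm_minus_commute)
      qed (use \<tau> in auto)
      moreover have "g (x' - (2 * \<tau>) *\<^sub>R e) \<le> g (x - \<tau> *\<^sub>R e)"
      proof (rule M[OF _ \<tau>(1) \<tau>1(2)])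
        show "dist x0 (x - \<tau> *\<^sub>R e) < r"
          using ball[of x "- \<tau>"] \<tau> pos by simp
        have eq: "x - \<tau> *\<^sub>R e - (x' - (2 * \<tau>) *\<^sub>R e) - \<tau> *\<^sub>R e = x - x'"
          by (simp add: algebra_simps flip: scaleR_2)
        show "norm (x - \<tau> *\<^sub>R e - (x' - (2 * \<tau>) *\<^sub>R e) - \<tau> *\<^sub>R e) < \<tau> * r"
          unfolding eq by (rule d)
      qed
      ultimately show ?thesis
        using steep \<tau>(1) \<tau>1(1) by (intro CollectI exI[of _ \<tau>]) linarith
    qed
    then show ?thesis
      by (intro interiorI[of "ball x (\<tau> * r)"]) (use pos in auto)
  qed
  then show False
    using not_steep by (auto simp: steep_set_def)
qed

lemma steep_set_borel: "steep_set g e \<in> sets borel"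
  unfolding steep_set_def by (rule countable_INT_open_borel) simp

text \<open>
  A step of length \<open>2 * t\<close> along \<open>e\<close> is dominated by one of length \<open>3 * t\<close> along a nearby direction \<open>e'\<close>. So on lines in
  direction \<open>e'\<close>, where \<open>g\<close> is monotone, the steep set consists of points of infinite derivates.
\<close>
lemma null_along_steep_set:
  fixes g :: "'a::{real_normed_vector, second_countable_topology} \<Rightarrow> real"
  assumes mono: "locally_cone_monotone g x0 e r" and r: "r > 0" and e': "3 * norm (e' - e) < r"
  shows "null_along e' (ball x0 (r / 4) \<inter> steep_set g e)"
  unfolding null_along_def
proof
  fix z
  note M = locally_cone_monotoneD[OF mono]
  define S where "S = {s::real. z + s *\<^sub>R e' \<in> ball x0 (r / 4) \<inter> steep_set g e}"
  have S: "S \<in> sets borel"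
    unfolding S_def by (intro line_section_borel sets.Int steep_set_borel) auto
  (* The line is cut into intervals so short that three adjacent ones stay in the region of
     monotonicity and have total length at most 1, the range of the steps in the definition. *)
  define h where "h = min (1 / 8) (r / (8 * (norm e' + 1)))"
  have e'1: "norm e' + 1 > 0"
    by (simp add: add_nonneg_pos)
  have h: "h > 0" "h \<le> 1 / 8" "h * norm e' \<le> r / 8"
  proof -
    show "h > 0"
      using r e'1 by (simp add: h_def)
    show "h \<le> 1 / 8"
      unfolding h_def by (rule min.cobounded1)
    have "h \<le> r / (8 * (norm e' + 1))"
      unfolding h_def by (rule min.cobounded2)
    then have "h * (8 * (norm e' + 1)) \<le> r"
      using e'1 by (subst (asm) pos_le_divide_eq) auto
    then show "h * norm e' \<le> r / 8"
      using \<open>h > 0\<close> by (simp add: algebra_simps)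
  qed
  define G where "G = (\<lambda>s. g (z + s *\<^sub>R e'))"
  have null: "emeasure lborel (S \<inter> {of_int j * h..of_int j * h + h}) = 0" for j :: int
  proof (cases "S \<inter> {of_int j * h..of_int j * h + h} = {}")
    case False
    then obtain s1 where s1: "s1 \<in> S" "of_int j * h \<le> s1" "s1 \<le> of_int j * h + h"
      by auto
    define a where "a = of_int j * h"
    have near: "dist x0 (z + s *\<^sub>R e') < r" if "s \<in> {a - h..a + h + h}" for s
    proof -
      have "\<bar>s - s1\<bar> * norm e' \<le> 2 * h * norm e'"
        using that s1 by (intro mult_right_mono) (auto simp: a_def)
      then have "\<bar>s - s1\<bar> * norm e' \<le> r / 4"
        using h(3) by simp
      moreover have "norm (x0 - (z + s1 *\<^sub>R e')) < r / 4"
        using s1(1) by (simp add: S_def dist_norm)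
      moreover have "norm (x0 - (z + s *\<^sub>R e')) \<le> norm (x0 - (z + s1 *\<^sub>R e')) + \<bar>s - s1\<bar> * norm e'"
      proof -
        have eq: "x0 - (z + s *\<^sub>R e') = (x0 - (z + s1 *\<^sub>R e')) - (s - s1) *\<^sub>R e'"
          by (simp add: algebra_simps)
        show ?thesis
          unfolding eq norm_scaleR[symmetric] by (rule norm_triangle_ineq4)
      qed
      ultimately have "norm (x0 - (z + s *\<^sub>R e')) < r"
        using r by linarith
      then show ?thesis
        by (simp add: dist_norm)
    qed
    show ?thesis
    proof (rule null_set_monotone_infinite_derivate)
      show "mono_on {a - h..a + h + h} G"
      proof (rule mono_onI)
        fix s t
        assume st: "s \<in> {a - h..a + h + h}" "t \<in> {a - h..a + h + h}" "s \<le> t"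
        show "G s \<le> G t"
        proof (cases "s = t")
          case False
          show ?thesis
            unfolding G_def
          proof (rule M[OF near[OF st(2)], of "t - s"])
            have "z + t *\<^sub>R e' - (z + s *\<^sub>R e') - (t - s) *\<^sub>R e = (t - s) *\<^sub>R (e' - e)"
              by (simp add: algebra_simps)
            moreover have "(t - s) * norm (e' - e) < (t - s) * r"
              using e' st(3) False norm_ge_zero[of "e' - e"] by (intro mult_strict_left_mono) linarith+
            ultimately show "norm (z + t *\<^sub>R e' - (z + s *\<^sub>R e') - (t - s) *\<^sub>R e) < (t - s) * r"
              using st(3) by simp
          qed (use st False h in auto)
        qed simp
      qed
      show "a - h < a" "a + h < a + h + h"
        using h by auto
      show "S \<inter> {of_int j * h..of_int j * h + h} \<in> sets borel"
        using S by auto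
      fix s k
      assume s: "s \<in> S \<inter> {of_int j * h..of_int j * h + h}"
      define x where "x = z + s *\<^sub>R e'"
      have x: "norm (x0 - x) < r / 4" "x \<in> steep_set g e"
        using s by (auto simp: S_def x_def dist_norm)
      define c where "c = 3 * norm e' + 2 * norm e + 1"
      have c: "c > 0" "3 * norm e' \<le> c" "2 * norm e \<le> c"
        by (auto simp: c_def add_nonneg_pos)
      obtain K :: nat where K: "max (3 * real (Suc k)) (4 * c / r) \<le> real K"
        using real_arch_simple by blast
      obtain t where t: "0 < t" "t * real (Suc K) < 1"
          "real (Suc K) * t < g (x + (2 * t) *\<^sub>R e) - g (x - (2 * t) *\<^sub>R e)"
        using x(2) interior_subset unfolding steep_set_def by blast
      have "3 * real (Suc k) \<le> real (Suc K)" "4 * c / r \<le> real (Suc K)"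
        using K by auto
      then have "3 * real (Suc k) * t \<le> real (Suc K) * t" "4 * c / r * t \<le> real (Suc K) * t"
        using mult_right_mono[of "3 * real (Suc k)" "real (Suc K)" t] mult_right_mono[of "4 * c / r" "real (Suc K)" t] t(1)
        by simp_all
      moreover have "real (Suc K) * t < 1"
        using t(2) by (simp only: mult.commute)
      ultimately have "4 * c / r * t < 1" and t3: "3 * t * real (Suc k) \<le> t * real (Suc K)"
        by (linarith, simp add: algebra_simps)
      have "c * t = 4 * c / r * t * (r / 4)"
        using r by simp
      also have "\<dots> < 1 * (r / 4)"
        using \<open>4 * c / r * t < 1\<close> r by (intro mult_strict_right_mono) auto
      finally have ct: "c * t < r / 4"
        by simp
      have t1: "t \<le> 1"
      proof -
        have "t * 1 \<le> t * real (Suc K)"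
          using t(1) by (intro mult_left_mono) auto
        then show ?thesis
          using t(2) by simp
      qed
      have small: "3 * t * norm e' < r / 4" "2 * t * norm e < r / 4"
      proof -
        have "3 * norm e' * t < r / 4" "2 * norm e * t < r / 4"
          using mult_right_mono[OF c(2), of t] mult_right_mono[OF c(3), of t] t(1) ct by linarith+
        then show "3 * t * norm e' < r / 4" "2 * t * norm e < r / 4"
          by (simp_all add: mult_ac)
      qed
      have diff: "norm ((3 * t) *\<^sub>R (e' - e)) < t * r"
        unfolding norm_scaleR using mult_strict_left_mono[OF e' t(1)] t(1) by (simp add: mult_ac)
      have "g (x + (2 * t) *\<^sub>R e) \<le> g (x + (3 * t) *\<^sub>R e')"
      proof (rule M[OF _ t(1) t1])
        show "dist x0 (x + (3 * t) *\<^sub>R e') < r"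
          using norm_triangle_ineq4[of "x0 - x" "(3 * t) *\<^sub>R e'"] small(1) x(1) t(1) r
          by (simp add: dist_norm diff_diff_eq)
        have eq: "x + (3 * t) *\<^sub>R e' - (x + (2 * t) *\<^sub>R e) - t *\<^sub>R e = (3 * t) *\<^sub>R (e' - e)"
          by (simp add: algebra_simps flip: scaleR_add_left)
        show "norm (x + (3 * t) *\<^sub>R e' - (x + (2 * t) *\<^sub>R e) - t *\<^sub>R e) < t * r"
          unfolding eq by (rule diff)
      qed
      moreover have "g (x - (3 * t) *\<^sub>R e') \<le> g (x - (2 * t) *\<^sub>R e)"
      proof (rule M[OF _ t(1) t1])
        show "dist x0 (x - (2 * t) *\<^sub>R e) < r"
          using norm_triangle_ineq[of "x0 - x" "(2 * t) *\<^sub>R e"] small(2) x(1) t(1) r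
          by (simp add: dist_norm algebra_simps)
        have eq: "x - (2 * t) *\<^sub>R e - (x - (3 * t) *\<^sub>R e') - t *\<^sub>R e = (3 * t) *\<^sub>R (e' - e)"
          by (simp add: algebra_simps flip: scaleR_add_left)
        show "norm (x - (2 * t) *\<^sub>R e - (x - (3 * t) *\<^sub>R e') - t *\<^sub>R e) < t * r"
          unfolding eq by (rule diff)
      qed
      moreover have "x + (3 * t) *\<^sub>R e' = z + (s + 3 * t) *\<^sub>R e'" "x - (3 * t) *\<^sub>R e' = z + (s - 3 * t) *\<^sub>R e'"
        by (simp_all add: x_def algebra_simps)
      ultimately have "real (Suc K) * t < G (s + 3 * t) - G (s - 3 * t)"
        using t(3) by (simp add: G_def)
      then have "real (Suc k) * (3 * t) < G (s + 3 * t) - G (s - 3 * t)"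
        using t3 by (simp add: mult.commute mult.left_commute)
      moreover have "3 * t * real (Suc k) < 1"
        using t3 t(2) by linarith
      ultimately show "a \<le> s \<and> s \<le> a + h \<and> (\<exists>t. 0 < t \<and> t * real (Suc k) < 1 \<and> G (s + t) - G (s - t) > real (Suc k) * t)"
        using s t(1) by (intro conjI exI[of _ "3 * t"]) (auto simp: a_def)
    qed
  qed simp
  have "S = (\<Union>j. S \<inter> {of_int j * h..of_int j * h + h})"
  proof -
    have "s \<in> {of_int \<lfloor>s / h\<rfloor> * h..of_int \<lfloor>s / h\<rfloor> * h + h}" for s
      using floor_divide_lower[OF h(1), of s] floor_divide_upper[OF h(1), of s]
      by (simp add: algebra_simps)
    then show ?thesis
      by blast
  qed
  moreover have "(\<Union>j. S \<inter> {of_int j * h..of_int j * h + h}) \<in> null_sets lborel"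
    using null S by (intro null_sets_UN) auto
  ultimately show "emeasure lborel {s::real. z + s *\<^sub>R e' \<in> ball x0 (r / 4) \<inter> steep_set g e} = 0"
    unfolding S_def[symmetric] by (metis null_setsD1)
qed

lemma aronszajn_null_steep_set:
  fixes g :: "'a::{real_normed_vector, second_countable_topology} \<Rightarrow> real"
  assumes mono: "locally_cone_monotone g x0 e r" and r: "r > 0"
  shows "aronszajn_null (ball x0 (r / 4) \<inter> steep_set g e)"
proof (rule aronszajn_nullI)
  show borel: "ball x0 (r / 4) \<inter> steep_set g e \<in> sets borel"
    by (intro sets.Int steep_set_borel) auto
  fix \<xi> :: "nat \<Rightarrow> 'a"
  assume "closure (span (range \<xi>)) = UNIV"
  then have "e \<in> closure (span (range \<xi>))"
    by simp
  then obtain e' where e': "e' \<in> span (range \<xi>)" "dist e' e < r / 3"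
    using r unfolding closure_approachable by (meson divide_pos_pos zero_less_numeral)
  then have "null_along e' (ball x0 (r / 4) \<inter> steep_set g e)"
    by (intro null_along_steep_set[OF mono r]) (simp add: dist_norm)
  then show "\<exists>\<T>. countable \<T> \<and> ball x0 (r / 4) \<inter> steep_set g e \<subseteq> \<Union>\<T> \<and>
        (\<forall>T\<in>\<T>. T \<in> sets borel \<and> (\<exists>e\<in>span (range \<xi>). null_along e T))"
    using e'(1) borel by (intro exI[of _ "{ball x0 (r / 4) \<inter> steep_set g e}"]) auto
qed

text \<open>
  The cone may change from point to point; countably many of the neighbourhoods cover the space.
\<close>
theorem cone_monotone_hadamard_ae:
  fixes g :: "'a::{real_normed_vector, second_countable_topology} \<Rightarrow> real"
  assumes mono: "\<And>x. \<exists>e r. r > 0 \<and> locally_cone_monotone g x e r"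
  shows "\<exists>N. aronszajn_null N \<and> (\<forall>x. x \<notin> N \<longrightarrow> hadamard_differentiable g x)"
proof -
  obtain e r where er: "\<And>x. r x > 0" "\<And>x. locally_cone_monotone g x (e x) (r x)"
    using mono by metis
  obtain \<F> where \<F>: "\<F> \<subseteq> (\<lambda>x. ball x (r x / 4)) ` UNIV" "countable \<F>"
      "\<Union>\<F> = (\<Union>x. ball x (r x / 4))"
    using Lindelof[of "(\<lambda>x. ball x (r x / 4)) ` UNIV"] by auto
  then obtain C where C: "countable C" "\<F> = (\<lambda>x. ball x (r x / 4)) ` C"
    using countable_subset_image[of \<F> "\<lambda>x. ball x (r x / 4)" UNIV] by auto
  have cover: "\<exists>c\<in>C. dist c x < r c / 4" for x
  proof -
    have "x \<in> (\<Union>x. ball x (r x / 4))"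
      using er(1)[of x] by (intro UN_I[of x]) auto
    then have "x \<in> \<Union>\<F>"
      using \<F>(3) by simp
    then show ?thesis
      unfolding C(2) by auto
  qed
  obtain N where N: "aronszajn_null N"
      "\<And>x. x \<notin> N \<Longrightarrow> pointwise_lipschitz g x \<Longrightarrow> hadamard_differentiable g x"
    using hadamard_if_pointwise_lipschitz_ae[of g] by blast
  define N' where "N' = (\<Union>c\<in>C. ball c (r c / 4) \<inter> steep_set g (e c))"
  have "aronszajn_null (N \<union> N')"
    unfolding N'_def using N(1) C(1) er
    by (intro aronszajn_null_Un aronszajn_null_countable_Union aronszajn_null_steep_set)
  moreover have "hadamard_differentiable g x" if "x \<notin> N \<union> N'" for x
  proof -
    obtain c where "c \<in> C" "dist c x < r c / 4"
      using cover by blast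
    then show ?thesis
      using that pointwise_lipschitz_if_not_steep[OF er(2) er(1)] by (intro N(2)) (auto simp: N'_def)
  qed
  ultimately show ?thesis
    by blast
qed

section \<open>Category and the topological essential infimum\<close>

lemma dense_INT_open:
  fixes U :: "nat \<Rightarrow> 'a::banach set"
  assumes "\<And>n. open (U n)" "\<And>n. closure (U n) = UNIV"
  shows "closure (\<Inter>n. U n) = UNIV"
proof -
  have "euclidean closure_of \<Inter>(range U) = topspace euclidean"
  proof (rule Baire_category)
    show "completely_metrizable_space (euclidean :: 'a topology) \<or>
        locally_compact_space (euclidean :: 'a topology) \<and> regular_space (euclidean :: 'a topology)"
      using completely_metrizable_space_euclidean by blast
  qed (use assms in auto)
  then show ?thesis
    by simp
qed

lemma first_categoryE:
  assumes "first_category S"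
  obtains N :: "nat \<Rightarrow> 'a::topological_space set"
  where "\<forall>n. nowhere_dense (N n)" "S = (\<Union>n. N n)"
proof -
  obtain N :: "nat \<Rightarrow> 'a set" where "(\<forall>n. nowhere_dense (N n)) \<and> S = (\<Union>n. N n)"
    using assms unfolding first_category_def ..
  then show thesis
    by (intro that[of N]) simp_all
qed

lemma first_category_subset:
  fixes S T :: "'a::topological_space set"
  assumes "first_category T" "S \<subseteq> T"
  shows "first_category S"
proof -
  obtain N :: "nat \<Rightarrow> 'a set" where N: "\<forall>n. nowhere_dense (N n)" "T = (\<Union>n. N n)"
    by (rule first_categoryE[OF assms(1)])
  have "nowhere_dense (N n \<inter> S)" for n
  proof -
    have "interior (closure (N n \<inter> S)) \<subseteq> interior (closure (N n))"
      by (intro interior_mono closure_mono) simp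
    then show ?thesis
      using N(1)[rule_format, of n] unfolding nowhere_dense_def by simp
  qed
  then show ?thesis
    unfolding first_category_def using N(2) assms(2) by (intro exI[of _ "\<lambda>n. N n \<inter> S"]) auto
qed

lemma first_category_countable_Union:
  assumes "countable I" "\<And>i. i \<in> I \<Longrightarrow> first_category (S i)"
  shows "first_category (\<Union>i\<in>I. S i)"
proof -
  have "\<forall>i. \<exists>N. i \<in> I \<longrightarrow> (\<forall>n::nat. nowhere_dense (N n)) \<and> S i = (\<Union>n. N n)"
    using assms(2) unfolding first_category_def by blast
  then obtain N where N: "\<And>i n. i \<in> I \<Longrightarrow> nowhere_dense (N i n)" "\<And>i. i \<in> I \<Longrightarrow> S i = (\<Union>n::nat. N i n)"
    by metis
  define M where "M = from_nat_into (insert {} ((\<lambda>(i, n). N i n) ` (I \<times> UNIV)))"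
  have "countable (insert {} ((\<lambda>(i, n). N i n) ` (I \<times> (UNIV :: nat set))))"
    using assms(1) by (intro countable_insert countable_image countable_SIGMA) auto
  then have M: "range M = insert {} ((\<lambda>(i, n). N i n) ` (I \<times> UNIV))"
    unfolding M_def by (intro range_from_nat_into) auto
  have "nowhere_dense (M k)" for k
  proof -
    have "M k \<in> insert {} ((\<lambda>(i, n). N i n) ` (I \<times> UNIV))"
      using M by auto
    then show ?thesis
      using N(1) by (auto simp: nowhere_dense_def)
  qed
  moreover have "(\<Union>i\<in>I. S i) = (\<Union>k. M k)"
    unfolding M using N(2) by auto
  ultimately show ?thesis
    unfolding first_category_def by blast
qed

lemma nowhere_dense_imp_first_category: "nowhere_dense S \<Longrightarrow> first_category S"
  unfolding first_category_def by (intro exI[of _ "\<lambda>_. S"]) auto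

lemma open_first_category_empty:
  fixes V :: "'a::banach set"
  assumes "open V" "first_category V"
  shows "V = {}"
proof -
  obtain N :: "nat \<Rightarrow> 'a set" where N: "\<forall>n. nowhere_dense (N n)" "V = (\<Union>n. N n)"
    by (rule first_categoryE[OF assms(2)])
  have "closure (\<Inter>n. - closure (N n)) = UNIV"
  proof (rule dense_INT_open)
    fix n
    show "closure (- closure (N n)) = UNIV"
      unfolding closure_complement using N(1)[rule_format, of n] unfolding nowhere_dense_def by (rule ssubst) simp
  qed (rule open_Compl[OF closed_closure])
  moreover have "V \<inter> (\<Inter>n. - closure (N n)) = {}"
    using N(2) by (auto dest: subsetD[OF closure_subset])
  ultimately show ?thesis
    using open_Int_closure_eq_empty[OF assms(1)] by auto
qed

definition small_oscillation :: "('a::topological_space \<Rightarrow> real) \<Rightarrow> nat \<Rightarrow> 'a set" where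
  "small_oscillation f n = \<Union>{V. open V \<and> (\<forall>y\<in>V. \<forall>z\<in>V. dist (f y) (f z) < 1 / real (Suc n))}"

lemma isCont_iff_small_oscillation:
  fixes f :: "'a::metric_space \<Rightarrow> real"
  shows "isCont f x \<longleftrightarrow> (\<forall>n. x \<in> small_oscillation f n)"
proof
  assume cont: "isCont f x"
  show "\<forall>n. x \<in> small_oscillation f n"
  proof
    fix n
    define V where "V = ball (f x) (1 / (2 * real (Suc n)))"
    have "open V" "f x \<in> V"
      by (simp_all add: V_def)
    then obtain A where A: "open A" "x \<in> A" "\<And>y. y \<in> A \<Longrightarrow> f y \<in> V"
      using cont[unfolded continuous_at_open, rule_format, of V] by auto
    have "dist (f y) (f z) < 1 / real (Suc n)" if "y \<in> A" "z \<in> A" for y z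
    proof -
      have "dist (f y) (f z) \<le> dist (f x) (f y) + dist (f x) (f z)"
        using dist_triangle[of "f y" "f z" "f x"] by (simp add: dist_commute)
      also have "\<dots> < 1 / (2 * real (Suc n)) + 1 / (2 * real (Suc n))"
        using A(3)[OF that(1)] A(3)[OF that(2)] unfolding V_def mem_ball by linarith
      also have "\<dots> = 1 / real (Suc n)"
        by (simp add: field_simps)
      finally show ?thesis .
    qed
    then show "x \<in> small_oscillation f n"
      unfolding small_oscillation_def using A(1,2) by blast
  qed
next
  assume osc: "\<forall>n. x \<in> small_oscillation f n"
  show "isCont f x"
    unfolding continuous_at_eps_delta
  proof (intro allI impI)
    fix e :: real
    assume "0 < e"
    then obtain n where n: "1 / real (Suc n) < e"
      using exists_inverse_Suc_less[of e 1] by auto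
    obtain V where V: "open V" "x \<in> V" "\<And>y z. y \<in> V \<Longrightarrow> z \<in> V \<Longrightarrow> dist (f y) (f z) < 1 / real (Suc n)"
      using osc[rule_format, of n] unfolding small_oscillation_def by auto
    obtain d where d: "d > 0" "ball x d \<subseteq> V"
      using V(1,2) by (meson open_contains_ball)
    have "dist (f y) (f x) < e" if "dist y x < d" for y
      using V(3)[of y x] V(2) d(2) that n by (auto simp: dist_commute)
    then show "\<exists>d>0. \<forall>y. dist y x < d \<longrightarrow> dist (f y) (f x) < e"
      using d(1) by auto
  qed
qed

text \<open>
  The continuity points form a dense \<open>G\<^sub>\<delta>\<close> set, and so do their reflections; by the Baire category theorem the two
  sets meet densely.
\<close>
lemma dense_symmetric_continuity:
  fixes f :: "'a::banach \<Rightarrow> real"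
  assumes "densely_continuous f"
  shows "closure {y. isCont f y \<and> isCont f (c - y)} = UNIV"
proof -
  obtain D where D: "closure D = UNIV" "\<And>x. x \<in> D \<Longrightarrow> isCont f x"
    using assms unfolding densely_continuous_def by blast
  define U where "U = small_oscillation f"
  have op: "open (U n)" for n
    unfolding U_def small_oscillation_def by auto
  have dense: "closure (U n) = UNIV" for n
  proof -
    have "D \<subseteq> U n"
      using D(2) isCont_iff_small_oscillation[where f = f] unfolding U_def by blast
    from closure_mono[OF this] show ?thesis
      using D(1) by auto
  qed
  define V where "V = (\<lambda>n. (\<lambda>y. c - y) -` U n)"
  have cont: "continuous_on UNIV (\<lambda>y. c - y)"
    by (intro continuous_intros)
  have opV: "open (V n)" for n
    unfolding V_def by (rule open_vimage[OF op cont])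
  have meets: "W \<inter> (U n \<inter> V n) \<noteq> {}" if W: "open W" "W \<noteq> {}" for W n
  proof -
    define W' where "W' = (\<lambda>y. c - y) -` (W \<inter> U n)"
    have "W \<inter> U n \<noteq> {}"
      using open_Int_closure_eq_empty[OF W(1), of "U n"] dense W(2) by auto
    then obtain w where "w \<in> W \<inter> U n"
      by auto
    then have "c - w \<in> W'"
      by (simp add: W'_def)
    moreover have "open W'"
      unfolding W'_def using W(1) op by (intro open_vimage[OF _ cont]) auto
    ultimately have "W' \<inter> U n \<noteq> {}"
      using open_Int_closure_eq_empty[of W' "U n"] dense by auto
    then obtain y where "y \<in> W'" "y \<in> U n"
      by auto
    then have "c - y \<in> W \<inter> (U n \<inter> V n)"
      by (auto simp: W'_def V_def)
    then show ?thesis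
      by auto
  qed
  have "closure (U n \<inter> V n) = UNIV" for n
  proof (rule ccontr)
    assume "closure (U n \<inter> V n) \<noteq> UNIV"
    then have "- closure (U n \<inter> V n) \<inter> (U n \<inter> V n) \<noteq> {}"
      by (intro meets) auto
    then show False
      using closure_subset[of "U n \<inter> V n"] by auto
  qed
  then have "closure (\<Inter>n. U n \<inter> V n) = UNIV"
    using op opV by (intro dense_INT_open) auto
  moreover have "(\<Inter>n. U n \<inter> V n) = {y. isCont f y \<and> isCont f (c - y)}"
    unfolding isCont_iff_small_oscillation U_def V_def by auto
  ultimately show ?thesis
    by simp
qed

lemma strictly_quasiconvexD:
  assumes "strictly_quasiconvex f" "x \<noteq> y" "0 < c" "c < 1"
  shows "f (c *\<^sub>R x + (1 - c) *\<^sub>R y) < max (f x) (f y)"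
  using assms unfolding strictly_quasiconvex_def by auto

lemma strictly_quasiconvex_le_max:
  assumes "strictly_quasiconvex f" "0 \<le> c" "c \<le> 1"
  shows "f (c *\<^sub>R x + (1 - c) *\<^sub>R y) \<le> max (f x) (f y)"
proof (cases "x = y \<or> c = 0 \<or> c = 1")
  case True
  moreover have "c *\<^sub>R x + (1 - c) *\<^sub>R x = x"
    by (simp add: algebra_simps)
  ultimately show ?thesis
    by auto
next
  case False
  then show ?thesis
    using strictly_quasiconvexD[OF assms(1), of x y c] assms(2,3) by auto
qed

lemma convex_sublevel:
  assumes "strictly_quasiconvex f"
  shows "convex (sublevel f \<alpha>)"
  unfolding convex_alt sublevel_def
proof (intro ballI allI impI CollectI)
  fix x y and u :: real
  assume "x \<in> {x. ereal (f x) \<le> \<alpha>}" "y \<in> {x. ereal (f x) \<le> \<alpha>}" "0 \<le> u \<and> u \<le> 1"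
  then show "ereal (f ((1 - u) *\<^sub>R x + u *\<^sub>R y)) \<le> \<alpha>"
    using strictly_quasiconvex_le_max[OF assms, of "1 - u" x y]
    by (cases \<alpha>) (auto simp: max_def split: if_splits)
qed

lemma not_first_category_if_top_ess_inf_less:
  assumes "top_ess_inf f < ereal \<alpha>"
  shows "\<not> first_category (strict_sublevel f (ereal \<alpha>))"
proof
  assume "first_category (strict_sublevel f (ereal \<alpha>))"
  then have "ereal \<alpha> \<le> top_ess_inf f"
    unfolding top_ess_inf_def by (intro SUP_upper) auto
  then show False
    using assms by simp
qed

lemma first_category_strict_sublevel_top_ess_inf:
  "first_category (strict_sublevel f (top_ess_inf f))"
proof -
  have "first_category (strict_sublevel f (ereal q))" if "ereal q < top_ess_inf f" for q
  proof -
    obtain \<beta> where "first_category (strict_sublevel f (ereal \<beta>))" "q < \<beta>"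
      using \<open>ereal q < top_ess_inf f\<close> unfolding top_ess_inf_def less_SUP_iff by auto
    then show ?thesis
      by (elim first_category_subset) (auto simp: strict_sublevel_def)
  qed
  moreover have "countable {q \<in> \<rat>. ereal q < top_ess_inf f}"
    by (rule countable_subset[OF _ countable_rat]) auto
  ultimately have "first_category (\<Union>q\<in>{q \<in> \<rat>. ereal q < top_ess_inf f}. strict_sublevel f (ereal q))"
    by (intro first_category_countable_Union) auto
  moreover have "strict_sublevel f (top_ess_inf f)
      \<subseteq> (\<Union>q\<in>{q \<in> \<rat>. ereal q < top_ess_inf f}. strict_sublevel f (ereal q))"
  proof
    fix x
    assume "x \<in> strict_sublevel f (top_ess_inf f)"
    then have "ereal (f x) < top_ess_inf f"
      by (simp add: strict_sublevel_def)
    then obtain q where "ereal (f x) < ereal (real_of_rat q)" "ereal (real_of_rat q) < top_ess_inf f"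
      using ereal_dense3 by blast
    then show "x \<in> (\<Union>q\<in>{q \<in> \<rat>. ereal q < top_ess_inf f}. strict_sublevel f (ereal q))"
      by (intro UN_I[of "real_of_rat q"]) (simp_all add: strict_sublevel_def)
  qed
  ultimately show ?thesis
    by (rule first_category_subset)
qed

text \<open>
  Otherwise the strict sublevel set at the essential infimum, which is of first category, would contain a
  neighbourhood of \<open>x\<close>.
\<close>
lemma top_ess_inf_le_if_isCont:
  fixes f :: "'a::banach \<Rightarrow> real"
  assumes "isCont f x"
  shows "top_ess_inf f \<le> ereal (f x)"
proof (rule ccontr)
  assume "\<not> top_ess_inf f \<le> ereal (f x)"
  then obtain \<beta> where \<beta>: "ereal (f x) < ereal \<beta>" "ereal \<beta> < top_ess_inf f"
    using ereal_dense2[of "ereal (f x)" "top_ess_inf f"] by (auto simp: not_le)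
  have "open {..<\<beta>}" "f x \<in> {..<\<beta>}"
    using \<beta>(1) by auto
  then obtain A where A: "open A" "x \<in> A" "\<And>y. y \<in> A \<Longrightarrow> f y < \<beta>"
    using assms[unfolded continuous_at_open, rule_format, of "{..<\<beta>}"] by auto
  have "ereal (f y) < top_ess_inf f" if "y \<in> A" for y
    using A(3)[OF that] \<beta>(2) by (metis ereal_less_eq(3) le_less_trans less_imp_le)
  then have "A \<subseteq> strict_sublevel f (top_ess_inf f)"
    by (auto simp: strict_sublevel_def)
  then have "first_category A"
    using first_category_strict_sublevel_top_ess_inf first_category_subset by blast
  then show False
    using open_first_category_empty[OF A(1)] A(2) by auto
qed

lemma isCont_closure_sublevel:
  assumes "isCont f x" "x \<in> closure (sublevel f \<alpha>)"
  shows "ereal (f x) \<le> \<alpha>"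
proof (rule ccontr)
  assume "\<not> ereal (f x) \<le> \<alpha>"
  then obtain \<beta> where \<beta>: "\<alpha> < ereal \<beta>" "ereal \<beta> < ereal (f x)"
    using ereal_dense2[of \<alpha> "ereal (f x)"] by (auto simp: not_le)
  have "open {\<beta><..}" "f x \<in> {\<beta><..}"
    using \<beta>(2) by auto
  then obtain A where A: "open A" "x \<in> A" "\<And>y. y \<in> A \<Longrightarrow> \<beta> < f y"
    using assms(1)[unfolded continuous_at_open, rule_format, of "{\<beta><..}"] by auto
  have "A \<inter> sublevel f \<alpha> \<noteq> {}"
    using open_Int_closure_eq_empty[OF A(1), of "sublevel f \<alpha>"] A(2) assms(2) by auto
  then obtain y where "\<beta> < f y" "ereal (f y) \<le> \<alpha>"
    using A(3) by (auto simp: sublevel_def)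
  then have "ereal (f y) < ereal \<beta>"
    using \<beta>(1) by (meson le_less_trans)
  with \<open>\<beta> < f y\<close> show False
    by simp
qed

text \<open>
  At the continuity points in the interior of the closure of this sublevel set, \<open>f\<close> equals the essential infimum.
  Among these points there is one that is the midpoint of two different ones.
\<close>
lemma nowhere_dense_sublevel_top_ess_inf:
  fixes f :: "'a::banach \<Rightarrow> real"
  assumes nontrivial: "\<exists>x::'a. x \<noteq> 0" and qc: "strictly_quasiconvex f" and dc: "densely_continuous f"
  shows "nowhere_dense (sublevel f (top_ess_inf f))"
  unfolding nowhere_dense_def
proof (rule ccontr)
  let ?m = "top_ess_inf f"
  define U where "U = interior (closure (sublevel f ?m))"
  assume "interior (closure (sublevel f ?m)) \<noteq> {}"
  then have U: "open U" "U \<noteq> {}" "U \<subseteq> closure (sublevel f ?m)"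
    by (auto simp: U_def interior_subset)
  have eq: "ereal (f x) = ?m" if "isCont f x" "x \<in> U" for x
  proof (rule antisym)
    show "ereal (f x) \<le> ?m"
      by (rule isCont_closure_sublevel[OF that(1) subsetD[OF U(3) that(2)]])
  qed (rule top_ess_inf_le_if_isCont[OF that(1)])
  obtain D where D: "closure D = UNIV" "\<And>x. x \<in> D \<Longrightarrow> isCont f x"
    using dc unfolding densely_continuous_def by blast
  obtain x where x: "x \<in> U" "isCont f x"
    using open_Int_closure_eq_empty[OF U(1), of D] U(2) D by auto
  obtain r where r: "r > 0" "ball x r \<subseteq> U"
    using U(1) x(1) by (meson open_contains_ball)
  obtain v :: 'a where v: "v \<noteq> 0"
    using nontrivial by auto
  define w where "w = x + (r / (2 * norm v)) *\<^sub>R v"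
  have "w \<noteq> x" "dist x w < r"
    using v r(1) by (auto simp: w_def dist_norm)
  then have "w \<in> ball x r - {x}"
    by simp
  then have "(ball x r - {x}) \<inter> {y. isCont f y \<and> isCont f (2 *\<^sub>R x - y)} \<noteq> {}"
    using open_Int_closure_eq_empty[of "ball x r - {x}" "{y. isCont f y \<and> isCont f (2 *\<^sub>R x - y)}"]
      dense_symmetric_continuity[OF dc, of "2 *\<^sub>R x"] by (auto simp: open_delete)
  then obtain y where "y \<in> (ball x r - {x}) \<inter> {y. isCont f y \<and> isCont f (2 *\<^sub>R x - y)}"
    by blast
  then have y: "y \<in> ball x r" "y \<noteq> x" "isCont f y" "isCont f (2 *\<^sub>R x - y)"
    by auto
  have reflect: "x - (2 *\<^sub>R x - y) = y - x"
    by (simp add: scaleR_2)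
  have y': "2 *\<^sub>R x - y \<in> ball x r"
    using y(1) unfolding mem_ball dist_norm reflect by (simp only: norm_minus_commute)
  have "y \<noteq> 2 *\<^sub>R x - y"
  proof
    assume "y = 2 *\<^sub>R x - y"
    then have "2 *\<^sub>R y = 2 *\<^sub>R x"
      by (simp add: scaleR_2 algebra_simps)
    then show False
      using y(2) by simp
  qed
  then have "f ((1 / 2) *\<^sub>R y + (1 - 1 / 2) *\<^sub>R (2 *\<^sub>R x - y)) < max (f y) (f (2 *\<^sub>R x - y))"
    by (intro strictly_quasiconvexD[OF qc]) auto
  moreover have "(1 / 2) *\<^sub>R y + (1 - 1 / 2) *\<^sub>R (2 *\<^sub>R x - y) = x"
    by (simp add: scaleR_diff_right)
  ultimately have "f x < max (f y) (f (2 *\<^sub>R x - y))"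
    by simp
  moreover have "f y = f x" "f (2 *\<^sub>R x - y) = f x"
    using eq[OF x(2,1)] eq[OF y(3)] eq[OF y(4)] y(1) y' r(2) by (metis ereal.inject subsetD)+
  ultimately show False
    by simp
qed

section \<open>Truncations of quasiconvex functions\<close>

lemma ball_subset_strict_sublevel:
  fixes f :: "'a::banach \<Rightarrow> real"
  assumes dc: "densely_continuous f" and \<alpha>: "top_ess_inf f < ereal \<alpha>"
  obtains a \<rho> where "\<rho> > 0" "\<And>y. y \<in> ball a \<rho> \<Longrightarrow> f y < \<alpha>"
proof -
  obtain \<beta> where \<beta>: "top_ess_inf f < ereal \<beta>" "ereal \<beta> < ereal \<alpha>"
    using ereal_dense2[OF \<alpha>] by auto
  define U where "U = interior (closure (strict_sublevel f (ereal \<beta>)))"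
  have "\<not> nowhere_dense (strict_sublevel f (ereal \<beta>))"
    using not_first_category_if_top_ess_inf_less[OF \<beta>(1)] nowhere_dense_imp_first_category by blast
  then have U: "open U" "U \<noteq> {}" "U \<subseteq> closure (strict_sublevel f (ereal \<beta>))"
    by (auto simp: U_def nowhere_dense_def interior_subset)
  obtain D where D: "closure D = UNIV" "\<And>x. x \<in> D \<Longrightarrow> isCont f x"
    using dc unfolding densely_continuous_def by blast
  obtain x where x: "x \<in> U" "isCont f x"
    using open_Int_closure_eq_empty[OF U(1), of D] U(2) D by auto
  have "strict_sublevel f (ereal \<beta>) \<subseteq> sublevel f (ereal \<beta>)"
    by (auto simp: strict_sublevel_def sublevel_def)
  then have "x \<in> closure (sublevel f (ereal \<beta>))"
    using U(3) x(1) closure_mono by blast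
  then have "f x < \<alpha>"
    using isCont_closure_sublevel[OF x(2)] \<beta>(2) by fastforce
  then have "open {..<\<alpha>}" "f x \<in> {..<\<alpha>}"
    by auto
  then obtain A where A: "open A" "x \<in> A" "\<And>y. y \<in> A \<Longrightarrow> f y < \<alpha>"
    using x(2)[unfolded continuous_at_open, rule_format, of "{..<\<alpha>}"] by auto
  obtain \<rho> where "\<rho> > 0" "ball x \<rho> \<subseteq> A"
    using A(1,2) by (meson open_contains_ball)
  then show thesis
    using A(3) that by blast
qed

text \<open>
  From a point \<open>y\<close> near \<open>x\<close>, the step \<open>k\<close> near \<open>x - a\<close> leads into the ball on which \<open>f < \<alpha>\<close>. Quasiconvexity bounds \<open>f\<close> on the
  segment by its values at the endpoints, and the truncation removes the value at the far end.
\<close>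
lemma truncation_locally_cone_monotone:
  fixes f :: "'a::real_normed_vector \<Rightarrow> real"
  assumes qc: "strictly_quasiconvex f" and ball: "\<And>y. y \<in> ball a \<rho> \<Longrightarrow> f y < \<alpha>"
  shows "locally_cone_monotone (\<lambda>y. max (f y) \<alpha>) x (x - a) (\<rho> / 2)"
  unfolding locally_cone_monotone_def
proof (intro ballI)
  fix y k and t :: real
  assume y: "y \<in> ball x (\<rho> / 2)" and k: "k \<in> ball (x - a) (\<rho> / 2)" and t: "t \<in> {0..1}"
  have "a - (y - k) = (x - y) - (x - a - k)"
    by simp
  then have "norm (a - (y - k)) \<le> norm (x - y) + norm (x - a - k)"
    by (metis norm_triangle_ineq4)
  then have "y - k \<in> ball a \<rho>"
    using y k by (simp add: dist_norm)
  then have "f (y - k) < \<alpha>"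
    by (rule ball)
  moreover have "f (t *\<^sub>R (y - k) + (1 - t) *\<^sub>R y) \<le> max (f (y - k)) (f y)"
    using t by (intro strictly_quasiconvex_le_max[OF qc]) auto
  moreover have "t *\<^sub>R (y - k) + (1 - t) *\<^sub>R y = y - t *\<^sub>R k"
    by (simp add: algebra_simps)
  ultimately show "max (f (y - t *\<^sub>R k)) \<alpha> \<le> max (f y) \<alpha>"
    by auto
qed

text \<open>
  The difference quotients of the truncation are bounded on compact sets of directions, so its values stay
  above \<open>\<alpha>\<close> near \<open>x\<close> in these directions, where it coincides with \<open>f\<close>.
\<close>
lemma hadamard_differentiable_truncation:
  fixes f :: "'a::real_normed_vector \<Rightarrow> real"
  assumes had: "hadamard_differentiable (\<lambda>y. max (f y) \<alpha>) x" and x: "\<alpha> < f x"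
  shows "hadamard_differentiable f x"
proof -
  define g where "g = (\<lambda>y. max (f y) \<alpha>)"
  have gx: "g x = f x"
    using x by (simp add: g_def)
  obtain D where D: "has_gateaux_derivative g D x"
    "\<And>K. compact K \<Longrightarrow> uniform_limit K (\<lambda>t h. (g (x + t *\<^sub>R h) - g x) / t) (blinfun_apply D) (at (0::real))"
    using had unfolding hadamard_differentiable_def g_def by blast
  have eq: "eventually (\<lambda>t. \<forall>h\<in>K. f (x + t *\<^sub>R h) = g (x + t *\<^sub>R h)) (at (0::real))" if K: "compact K" for K
  proof -
    obtain M where M: "M > 0" "\<And>h. h \<in> K \<Longrightarrow> norm h \<le> M"
      using compact_imp_bounded[OF K] bounded_pos[of K] by metis
    define B where "B = norm D * M + 1"
    have B: "B > 0"
      using M(1) by (simp add: B_def add_nonneg_pos)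
    have "eventually (\<lambda>t. \<bar>t\<bar> < (f x - \<alpha>) / B) (at (0::real))"
      unfolding eventually_at using x B by (intro exI[of _ "(f x - \<alpha>) / B"]) (auto simp: dist_real_def)
    moreover have "eventually (\<lambda>t. t \<noteq> 0) (at (0::real))"
      by (auto simp: eventually_at intro!: exI[of _ 1])
    ultimately show ?thesis
      using uniform_limitD[OF D(2)[OF K] zero_less_one]
    proof eventually_elim
      case (elim t)
      show ?case
      proof
        fix h
        assume h: "h \<in> K"
        have "\<bar>(g (x + t *\<^sub>R h) - g x) / t - blinfun_apply D h\<bar> < 1"
          using elim(3) h by (auto simp: dist_real_def)
        moreover have "\<bar>blinfun_apply D h\<bar> \<le> norm D * M"
          using norm_blinfun[of D h] mult_left_mono[OF M(2)[OF h], of "norm D"] by simp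
        ultimately have "\<bar>(g (x + t *\<^sub>R h) - g x) / t\<bar> \<le> B"
          unfolding B_def by linarith
        then have "\<bar>g (x + t *\<^sub>R h) - g x\<bar> \<le> B * \<bar>t\<bar>"
          using elim(2) by (simp add: abs_divide divide_le_eq)
        also have "\<dots> < f x - \<alpha>"
          using elim(1) B by (simp add: pos_less_divide_eq mult.commute)
        finally have "\<alpha> < g (x + t *\<^sub>R h)"
          using gx by linarith
        then show "f (x + t *\<^sub>R h) = g (x + t *\<^sub>R h)"
          by (simp add: g_def max_def split: if_splits)
      qed
    qed
  qed
  have lim: "uniform_limit K (\<lambda>t h. (f (x + t *\<^sub>R h) - f x) / t) (blinfun_apply D) (at (0::real))"
    if K: "compact K" for K
  proof (rule uniform_limitI)
    fix e :: real
    assume "0 < e"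
    from uniform_limitD[OF D(2)[OF K] this] eq[OF K]
    show "eventually (\<lambda>t. \<forall>h\<in>K. dist ((f (x + t *\<^sub>R h) - f x) / t) (blinfun_apply D h) < e) (at 0)"
      by eventually_elim (simp add: gx)
  qed
  then have "((\<lambda>t. (f (x + t *\<^sub>R h) - f x) / t) \<longlongrightarrow> blinfun_apply D h) (at (0::real))" for h
    using tendsto_uniform_limitI[OF lim[of "{h}"]] by simp
  then show ?thesis
    unfolding hadamard_differentiable_def has_gateaux_derivative_def using lim by blast
qed

theorem hadamard_ae_above_top_ess_inf:
  fixes f :: "'a::{banach, second_countable_topology} \<Rightarrow> real"
  assumes qc: "strictly_quasiconvex f" and dc: "densely_continuous f"
  shows "\<exists>N. aronszajn_null N \<and> (\<forall>x. x \<notin> N \<longrightarrow> x \<notin> sublevel f (top_ess_inf f) \<longrightarrow> hadamard_differentiable f x)"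
proof -
  define I where "I = {\<alpha> \<in> \<rat>. top_ess_inf f < ereal \<alpha>}"
  have I: "countable I"
    unfolding I_def by (rule countable_subset[OF _ countable_rat]) auto
  have "\<exists>N. aronszajn_null N \<and> (\<forall>x. x \<notin> N \<longrightarrow> hadamard_differentiable (\<lambda>y. max (f y) \<alpha>) x)"
    if \<alpha>: "\<alpha> \<in> I" for \<alpha>
  proof -
    obtain a \<rho> where \<rho>: "\<rho> > 0" "\<And>y. y \<in> ball a \<rho> \<Longrightarrow> f y < \<alpha>"
      using ball_subset_strict_sublevel[OF dc, of \<alpha>] \<alpha> unfolding I_def by blast
    show ?thesis
    proof (rule cone_monotone_hadamard_ae)
      fix x
      show "\<exists>e r. r > 0 \<and> locally_cone_monotone (\<lambda>y. max (f y) \<alpha>) x e r"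
        using truncation_locally_cone_monotone[OF qc \<rho>(2)] \<rho>(1)
        by (intro exI[of _ "x - a"] exI[of _ "\<rho> / 2"]) auto
    qed
  qed
  then obtain N where N: "\<And>\<alpha>. \<alpha> \<in> I \<Longrightarrow> aronszajn_null (N \<alpha>)"
      "\<And>\<alpha> x. \<alpha> \<in> I \<Longrightarrow> x \<notin> N \<alpha> \<Longrightarrow> hadamard_differentiable (\<lambda>y. max (f y) \<alpha>) x"
    by metis
  have "aronszajn_null (\<Union>\<alpha>\<in>I. N \<alpha>)"
    by (rule aronszajn_null_countable_Union[OF I N(1)])
  moreover have "hadamard_differentiable f x"
    if x: "x \<notin> (\<Union>\<alpha>\<in>I. N \<alpha>)" "x \<notin> sublevel f (top_ess_inf f)" for x
  proof -
    have "top_ess_inf f < ereal (f x)"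
      using x(2) by (simp add: sublevel_def)
    then obtain q where q: "top_ess_inf f < ereal (real_of_rat q)" "ereal (real_of_rat q) < ereal (f x)"
      using ereal_dense3 by blast
    then have "real_of_rat q \<in> I"
      by (simp add: I_def)
    then show ?thesis
      using hadamard_differentiable_truncation[OF N(2)] x(1) q(2) by auto
  qed
  ultimately show ?thesis
    by blast
qed

section \<open>Sublinear functionals and nested convex sets\<close>

definition sublinear :: "('a::real_vector \<Rightarrow> real) \<Rightarrow> bool" where
  "sublinear p \<longleftrightarrow> (\<forall>x y. p (x + y) \<le> p x + p y) \<and> (\<forall>c x. 0 \<le> c \<longrightarrow> p (c *\<^sub>R x) = c * p x)"

lemma sublinearI:
  assumes "\<And>x y. p (x + y) \<le> p x + p y" and zero: "p 0 = 0"
    and le: "\<And>c x. 0 < c \<Longrightarrow> p (c *\<^sub>R x) \<le> c * p x"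
  shows "sublinear p"
  unfolding sublinear_def
proof (intro conjI allI impI assms(1))
  fix c :: real and x
  assume c: "0 \<le> c"
  show "p (c *\<^sub>R x) = c * p x"
  proof (cases "c = 0")
    case False
    with c have c: "0 < c"
      by simp
    have "p ((1 / c) *\<^sub>R (c *\<^sub>R x)) \<le> 1 / c * p (c *\<^sub>R x)"
      using c by (intro le) simp
    then have "c * p x \<le> p (c *\<^sub>R x)"
      using c by (simp add: field_simps)
    with le[OF c, of x] show ?thesis
      by simp
  qed (simp add: zero)
qed

lemma sublinearD:
  assumes "sublinear p"
  shows "p (x + y) \<le> p x + p y" "0 \<le> c \<Longrightarrow> p (c *\<^sub>R x) = c * p x" "p 0 = 0" "- p (- x) \<le> p x"
proof -
  show 1: "p (x + y) \<le> p x + p y" for x y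
    using assms by (simp add: sublinear_def)
  show 2: "0 \<le> c \<Longrightarrow> p (c *\<^sub>R x) = c * p x" for c x
    using assms by (simp add: sublinear_def)
  show "p 0 = 0"
    using 2[of 0 0] by simp
  then show "- p (- x) \<le> p x"
    using 1[of x "- x"] by simp
qed

lemma sublinear_INF_chain:
  fixes C :: "('a::real_vector \<Rightarrow> real) set"
  assumes ne: "C \<noteq> {}" and sub: "\<And>q. q \<in> C \<Longrightarrow> sublinear q"
    and bdd: "\<And>x. bdd_below ((\<lambda>q. q x) ` C)"
    and chain: "\<And>q q'. q \<in> C \<Longrightarrow> q' \<in> C \<Longrightarrow> q \<le> q' \<or> q' \<le> q"
  shows "sublinear (\<lambda>x. INF q\<in>C. q x)"
proof (rule sublinearI)
  define u where "u = (\<lambda>x. INF q\<in>C. q x)"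
  have lower: "u x \<le> q x" if "q \<in> C" for q x
    unfolding u_def by (rule cINF_lower[OF bdd that])
  have greatest: "a \<le> u x" if "\<And>q. q \<in> C \<Longrightarrow> a \<le> q x" for a x
    unfolding u_def using ne that by (rule cINF_greatest)
  fix x y
  have pair: "u (x + y) \<le> q x + q' y" if q: "q \<in> C" "q' \<in> C" for q q'
  proof -
    obtain q'' where q'': "q'' \<in> C" "q'' \<le> q" "q'' \<le> q'"
      using chain[OF q] q by blast
    have "u (x + y) \<le> q'' x + q'' y"
      using lower[OF q''(1), of "x + y"] sublinearD(1)[OF sub[OF q''(1)], of x y] by linarith
    also have "\<dots> \<le> q x + q' y"
      using q''(2,3) by (intro add_mono) (auto simp: le_fun_def)
    finally show ?thesis .
  qed
  have "u (x + y) - q' y \<le> u x" if "q' \<in> C" for q'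
    using pair[OF _ that] by (intro greatest) (simp add: algebra_simps)
  then have "u (x + y) - u x \<le> u y"
    by (intro greatest) (simp add: algebra_simps)
  then show "(INF q\<in>C. q (x + y)) \<le> (INF q\<in>C. q x) + (INF q\<in>C. q y)"
    by (simp add: u_def)
next
  have "(INF q\<in>C. q 0) = (INF q\<in>C. 0)"
    using sublinearD(3)[OF sub] by (intro INF_cong) auto
  then show "(INF q\<in>C. q 0) = 0"
    using ne by simp
next
  fix c :: real and x
  assume c: "0 < c"
  have "(INF q\<in>C. q (c *\<^sub>R x)) / c \<le> (INF q\<in>C. q x)"
  proof (rule cINF_greatest[OF ne])
    fix q
    assume q: "q \<in> C"
    have "(INF q\<in>C. q (c *\<^sub>R x)) \<le> q (c *\<^sub>R x)"
      by (rule cINF_lower[OF bdd q])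
    also have "\<dots> = c * q x"
      using c by (intro sublinearD(2)[OF sub[OF q]]) simp
    finally show "(INF q\<in>C. q (c *\<^sub>R x)) / c \<le> q x"
      using c by (simp add: field_simps)
  qed
  then show "(INF q\<in>C. q (c *\<^sub>R x)) \<le> c * (INF q\<in>C. q x)"
    using c by (simp add: field_simps)
qed

text \<open>
  The functional \<open>r\<close> below is the largest sublinear minorant of \<open>q\<close> that is linear in direction \<open>y\<close>. By minimality it
  is \<open>q\<close> itself, and its defining inequality at \<open>t = 1\<close> is superadditivity.
\<close>
lemma minimal_sublinear_additive:
  fixes q :: "'a::real_vector \<Rightarrow> real"
  assumes sub: "sublinear q" and minimal: "\<And>q'. sublinear q' \<Longrightarrow> q' \<le> q \<Longrightarrow> q' = q"
  shows "q (x + y) = q x + q y"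
proof -
  note q = sublinearD[OF sub]
  define r where "r = (\<lambda>x. INF t\<in>{0..}. q (x + t *\<^sub>R y) - t * q y)"
  have bdd: "bdd_below ((\<lambda>t. q (x + t *\<^sub>R y) - t * q y) ` {0..})" for x
  proof (rule bdd_belowI2)
    fix t :: real
    assume "t \<in> {0..}"
    then have "t * q y = q (t *\<^sub>R y)"
      by (simp add: q(2))
    also have "\<dots> \<le> q (x + t *\<^sub>R y) + q (- x)"
      using q(1)[of "x + t *\<^sub>R y" "- x"] by simp
    finally show "- q (- x) \<le> q (x + t *\<^sub>R y) - t * q y"
      by simp
  qed
  have lower: "r x \<le> q (x + t *\<^sub>R y) - t * q y" if "0 \<le> t" for x t
    unfolding r_def using that by (intro cINF_lower[OF bdd]) simp
  have greatest: "a \<le> r x" if "\<And>t. 0 \<le> t \<Longrightarrow> a \<le> q (x + t *\<^sub>R y) - t * q y" for a x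
    unfolding r_def using that by (intro cINF_greatest) auto
  have "sublinear r"
  proof (rule sublinearI)
    fix x x'
    have *: "r (x + x') \<le> (q (x + t *\<^sub>R y) - t * q y) + (q (x' + t' *\<^sub>R y) - t' * q y)"
      if "0 \<le> t" "0 \<le> t'" for t t'
    proof -
      have "r (x + x') \<le> q ((x + x') + (t + t') *\<^sub>R y) - (t + t') * q y"
        using that by (intro lower) simp
      also have "(x + x') + (t + t') *\<^sub>R y = (x + t *\<^sub>R y) + (x' + t' *\<^sub>R y)"
        by (simp add: algebra_simps)
      also have "q \<dots> - (t + t') * q y \<le> (q (x + t *\<^sub>R y) - t * q y) + (q (x' + t' *\<^sub>R y) - t' * q y)"
        using q(1)[of "x + t *\<^sub>R y" "x' + t' *\<^sub>R y"] by (simp add: algebra_simps)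
      finally show ?thesis .
    qed
    have "r (x + x') - (q (x' + t' *\<^sub>R y) - t' * q y) \<le> r x" if "0 \<le> t'" for t'
      using *[OF _ that] by (intro greatest) (simp add: algebra_simps)
    then have "r (x + x') - r x \<le> r x'"
      by (intro greatest) (simp add: algebra_simps)
    then show "r (x + x') \<le> r x + r x'"
      by simp
  next
    show "r 0 = 0"
    proof (rule antisym)
      show "r 0 \<le> 0"
        using lower[of 0 0] by (simp add: q(3))
      show "0 \<le> r 0"
        by (rule greatest) (simp add: q(2))
    qed
  next
    fix c :: real and x
    assume c: "0 < c"
    have "r (c *\<^sub>R x) / c \<le> r x"
    proof (rule greatest)
      fix t :: real
      assume t: "0 \<le> t"
      have "r (c *\<^sub>R x) \<le> q (c *\<^sub>R x + (c * t) *\<^sub>R y) - (c * t) * q y"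
        using c t by (intro lower) simp
      also have "c *\<^sub>R x + (c * t) *\<^sub>R y = c *\<^sub>R (x + t *\<^sub>R y)"
        by (simp add: algebra_simps)
      also have "q \<dots> - (c * t) * q y = c * (q (x + t *\<^sub>R y) - t * q y)"
        using c by (subst q(2)) (auto simp: algebra_simps)
      finally show "r (c *\<^sub>R x) / c \<le> q (x + t *\<^sub>R y) - t * q y"
        using c by (simp add: field_simps)
    qed
    then show "r (c *\<^sub>R x) \<le> c * r x"
      using c by (simp add: field_simps)
  qed
  moreover have "r \<le> q"
    using lower[of 0] by (auto simp: le_fun_def)
  ultimately have "r = q"
    by (rule minimal)
  then have "q x \<le> q (x + y) - q y"
    using lower[of 1 x] by simp
  then show ?thesis
    using q(1)[of x y] by simp
qed

text \<open>
  Zorn's lemma gives a minimal sublinear functional below \<open>p\<close>; minimal ones are linear.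
\<close>
theorem hahn_banach_sublinear:
  fixes p :: "'a::real_vector \<Rightarrow> real"
  assumes p: "sublinear p"
  shows "\<exists>\<phi>. linear \<phi> \<and> (\<forall>x. \<phi> x \<le> p x)"
proof -
  define A where "A = {q. sublinear q \<and> q \<le> p}"
  have "\<exists>m\<in>A. \<forall>a\<in>A. m \<ge> a \<longrightarrow> a = m"
  proof (rule predicate_Zorn)
    show "partial_order_on A (relation_of (\<ge>) A)"
      by (auto simp: partial_order_on_def preorder_on_def refl_on_def trans_def antisym_def relation_of_def)
    fix C
    assume C: "C \<in> Chains (relation_of (\<ge>) A)"
    show "\<exists>u\<in>A. \<forall>a\<in>C. a \<ge> u"
    proof (cases "C = {}")
      case True
      then show ?thesis
        using p by (auto simp: A_def)
    next
      case False
      have CA: "C \<subseteq> A" and chain: "\<And>q q'. q \<in> C \<Longrightarrow> q' \<in> C \<Longrightarrow> q \<le> q' \<or> q' \<le> q"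
        using C by (auto simp: Chains_def relation_of_def)
      have bdd: "bdd_below ((\<lambda>q. q x) ` C)" for x
      proof (rule bdd_belowI2)
        fix q
        assume "q \<in> C"
        then have "sublinear q" "q (- x) \<le> p (- x)"
          using CA by (auto simp: A_def le_fun_def)
        then show "- p (- x) \<le> q x"
          using sublinearD(4)[of q x] by linarith
      qed
      define u where "u = (\<lambda>x. INF q\<in>C. q x)"
      have "sublinear u"
        unfolding u_def using CA by (intro sublinear_INF_chain[OF False _ bdd chain]) (auto simp: A_def)
      moreover have lower: "u \<le> q" if "q \<in> C" for q
        unfolding u_def le_fun_def using cINF_lower[OF bdd that] by blast
      moreover have "u \<le> p"
      proof -
        obtain q where "q \<in> C"
          using False by auto
        then have "u \<le> q" "q \<le> p"
          using lower CA by (auto simp: A_def)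
        then show ?thesis
          by (rule order_trans)
      qed
      ultimately show ?thesis
        by (intro bexI[of _ u]) (auto simp: A_def)
    qed
  qed
  then obtain q where q: "sublinear q" "q \<le> p" "\<And>q'. sublinear q' \<Longrightarrow> q' \<le> q \<Longrightarrow> q' = q"
    unfolding A_def by (auto dest: order_trans)
  have add: "q (x + y) = q x + q y" for x y
    by (rule minimal_sublinear_additive[OF q(1,3)])
  have neg: "q (- x) = - q x" for x
    using add[of x "- x"] sublinearD(3)[OF q(1)] by simp
  have "q (c *\<^sub>R x) = c * q x" for c x
  proof (cases "c \<ge> 0")
    case False
    then have "q ((- c) *\<^sub>R x) = (- c) * q x"
      by (intro sublinearD(2)[OF q(1)]) simp
    then show ?thesis
      using neg[of "c *\<^sub>R x"] by simp
  qed (rule sublinearD(2)[OF q(1)])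
  then have "linear q"
    using add by (intro linearI) auto
  then show ?thesis
    using q(2) by (auto simp: le_fun_def)
qed

text \<open>
  The sublinear functional compares a vector with the cone generated by \<open>D - x\<close> and rewards each multiple \<open>t\<close> by
  \<open>t * d\<close>. The distance condition keeps it from being \<open>-\<infinity>\<close>. A linear minorant \<open>\<phi>\<close> satisfies \<open>\<phi> (c - x) \<le> - d\<close>, as the
  choice \<open>t = 1\<close> shows.
\<close>
lemma separating_functional:
  fixes D :: "'a::real_normed_vector set"
  assumes conv: "convex D" and d: "0 < d" and far: "\<And>c. c \<in> D \<Longrightarrow> d \<le> norm (x - c)"
  obtains \<phi> :: "'a \<Rightarrow>\<^sub>L real" where "\<And>c. c \<in> D \<Longrightarrow> \<phi> c \<le> \<phi> x - d"
proof (cases "D = {}")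
  case True
  then show thesis
    using that by blast
next
  case False
  define I where "I = {0::real..} \<times> D"
  define F where "F = (\<lambda>z (t, c). norm (z - t *\<^sub>R (c - x)) - t * d)"
  define p where "p = (\<lambda>z. INF i\<in>I. F z i)"
  have I: "I \<noteq> {}"
    using False by (auto simp: I_def)
  have bdd: "bdd_below (F z ` I)" for z
  proof (rule bdd_belowI2)
    fix i
    assume "i \<in> I"
    then obtain t c where i: "i = (t, c)" "0 \<le> t" "c \<in> D"
      by (auto simp: I_def)
    have "t * d \<le> t * norm (c - x)"
      using far[OF i(3)] i(2) by (intro mult_left_mono) (auto simp: norm_minus_commute)
    also have "\<dots> = norm (t *\<^sub>R (c - x))"
      using i(2) by simp
    also have "\<dots> \<le> norm z + norm (z - t *\<^sub>R (c - x))"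
      using norm_triangle_ineq4[of z "z - t *\<^sub>R (c - x)"] by simp
    finally show "- norm z \<le> F z i"
      by (simp add: F_def i(1))
  qed
  have lower: "p z \<le> norm (z - t *\<^sub>R (c - x)) - t * d" if "0 \<le> t" "c \<in> D" for z t c
  proof -
    have "p z \<le> F z (t, c)"
      unfolding p_def using that by (intro cINF_lower[OF bdd]) (simp add: I_def)
    then show ?thesis
      by (simp add: F_def)
  qed
  have greatest: "a \<le> p z" if "\<And>t c. 0 \<le> t \<Longrightarrow> c \<in> D \<Longrightarrow> a \<le> norm (z - t *\<^sub>R (c - x)) - t * d" for a z
    unfolding p_def by (rule cINF_greatest[OF I]) (use that in \<open>auto simp: I_def F_def\<close>)
  have p_le: "p z \<le> norm z" for z
  proof -
    obtain c where "c \<in> D"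
      using False by auto
    then show ?thesis
      using lower[of 0 c z] by simp
  qed
  have "sublinear p"
  proof (rule sublinearI)
    fix z z'
    have *: "p (z + z') \<le> (norm (z - t *\<^sub>R (c - x)) - t * d) + (norm (z' - t' *\<^sub>R (c' - x)) - t' * d)"
      if tc: "0 \<le> t" "c \<in> D" "0 \<le> t'" "c' \<in> D" for t c t' c'
    proof (cases "t + t' = 0")
      case True
      then have "t = 0" "t' = 0"
        using tc by auto
      then show ?thesis
        using p_le[of "z + z'"] norm_triangle_ineq[of z z'] by simp
    next
      case False
      with tc have pos: "0 < t + t'"
        by simp
      define c'' where "c'' = (t / (t + t')) *\<^sub>R c + (t' / (t + t')) *\<^sub>R c'"
      have "c'' \<in> D"
        unfolding c''_def using tc pos
        by (intro convexD[OF conv]) (auto simp: add_divide_distrib[symmetric])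
      then have "p (z + z') \<le> norm (z + z' - (t + t') *\<^sub>R (c'' - x)) - (t + t') * d"
        using pos by (intro lower) simp_all
      also have "(t + t') *\<^sub>R (c'' - x) = t *\<^sub>R (c - x) + t' *\<^sub>R (c' - x)"
      proof -
        have "(t + t') *\<^sub>R c'' = t *\<^sub>R c + t' *\<^sub>R c'"
          unfolding c''_def scaleR_add_right scaleR_scaleR using pos by simp
        then show ?thesis
          by (simp add: algebra_simps)
      qed
      also have "norm (z + z' - (t *\<^sub>R (c - x) + t' *\<^sub>R (c' - x)))
          \<le> norm (z - t *\<^sub>R (c - x)) + norm (z' - t' *\<^sub>R (c' - x))"
        by (rule norm_diff_triangle_ineq[of z z', simplified])
      finally show ?thesis
        by (simp add: algebra_simps)
    qed
    have "p (z + z') - (norm (z' - t' *\<^sub>R (c' - x)) - t' * d) \<le> p z" if "0 \<le> t'" "c' \<in> D" for t' c'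
    proof (rule greatest)
      fix t :: real and c
      assume "0 \<le> t" "c \<in> D"
      from *[OF this that]
      show "p (z + z') - (norm (z' - t' *\<^sub>R (c' - x)) - t' * d) \<le> norm (z - t *\<^sub>R (c - x)) - t * d"
        by simp
    qed
    then have "p (z + z') - p z \<le> p z'"
      by (intro greatest) (simp add: algebra_simps)
    then show "p (z + z') \<le> p z + p z'"
      by simp
  next
    show "p 0 = 0"
    proof (rule antisym)
      show "p 0 \<le> 0"
        using p_le[of 0] by simp
      show "0 \<le> p 0"
      proof (rule greatest)
        fix t :: real and c
        assume tc: "0 \<le> t" "c \<in> D"
        have "t * d \<le> t * norm (x - c)"
          using far[OF tc(2)] tc(1) by (rule mult_left_mono)
        then show "0 \<le> norm (0 - t *\<^sub>R (c - x)) - t * d"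
          using tc(1) by (simp add: norm_minus_commute)
      qed
    qed
  next
    fix b :: real and z
    assume b: "0 < b"
    have "p (b *\<^sub>R z) / b \<le> p z"
    proof (rule greatest)
      fix t :: real and c
      assume tc: "0 \<le> t" "c \<in> D"
      have "p (b *\<^sub>R z) \<le> norm (b *\<^sub>R z - (b * t) *\<^sub>R (c - x)) - (b * t) * d"
        using b tc by (intro lower) simp_all
      also have "b *\<^sub>R z - (b * t) *\<^sub>R (c - x) = b *\<^sub>R (z - t *\<^sub>R (c - x))"
        by (simp add: algebra_simps)
      also have "norm \<dots> - (b * t) * d = b * (norm (z - t *\<^sub>R (c - x)) - t * d)"
        using b by (simp add: right_diff_distrib mult.assoc)
      finally show "p (b *\<^sub>R z) / b \<le> norm (z - t *\<^sub>R (c - x)) - t * d"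
        using b by (simp add: field_simps)
    qed
    then show "p (b *\<^sub>R z) \<le> b * p z"
      using b by (simp add: field_simps)
  qed
  then obtain \<phi> where \<phi>: "linear \<phi>" "\<And>z. \<phi> z \<le> p z"
    using hahn_banach_sublinear by blast
  have "\<bar>\<phi> z\<bar> \<le> norm z * 1" for z
    using \<phi>(2)[of z] \<phi>(2)[of "- z"] p_le[of z] p_le[of "- z"] linear_neg[OF \<phi>(1), of z] by simp
  then have lin: "bounded_linear \<phi>"
    using \<phi>(1) by (intro bounded_linear_intro[of _ 1]) (auto simp: linear_add linear_cmul)
  show thesis
  proof (rule that[of "Blinfun \<phi>"])
    fix c
    assume c: "c \<in> D"
    have "\<phi> (c - x) \<le> - d"
      using \<phi>(2)[of "c - x"] lower[of 1 c "c - x"] c by simp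
    then show "blinfun_apply (Blinfun \<phi>) c \<le> blinfun_apply (Blinfun \<phi>) x - d"
      by (simp add: bounded_linear_Blinfun_apply[OF lin] linear_diff[OF \<phi>(1)])
  qed
qed

text \<open>
  The weak compactness that is needed. The infimum over \<open>n\<close> of the support functionals of \<open>A n\<close> is sublinear on the
  dual space. A linear minorant is an element of the bidual, hence evaluation at a point \<open>x\<close>. A functional that
  separates \<open>x\<close> from some \<open>A n\<close> would contradict the domination by the support functional of \<open>A n\<close>.
\<close>
theorem reflexive_nested_convex_INT:
  fixes A :: "nat \<Rightarrow> 'a::real_normed_vector set"
  assumes refl: "reflexive_space TYPE('a)"
    and closed: "\<And>n. closed (A n)" and conv: "\<And>n. convex (A n)" and ne: "\<And>n. A n \<noteq> {}"
    and dec: "decseq A" and bdd: "bounded (A 0)"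
  shows "(\<Inter>n. A n) \<noteq> {}"
proof -
  obtain M where M: "M > 0" "\<And>c. c \<in> A 0 \<Longrightarrow> norm c \<le> M"
    using bdd bounded_pos[of "A 0"] by metis
  have M': "norm c \<le> M" if "c \<in> A n" for c n
    using M(2) decseqD[OF dec, of 0 n] that by auto
  define s where "s = (\<lambda>n (\<phi> :: 'a \<Rightarrow>\<^sub>L real). SUP c\<in>A n. blinfun_apply \<phi> c)"
  have bound: "\<bar>blinfun_apply \<phi> c\<bar> \<le> norm \<phi> * M" if "c \<in> A n" for \<phi> :: "'a \<Rightarrow>\<^sub>L real" and c n
  proof -
    have "\<bar>blinfun_apply \<phi> c\<bar> \<le> norm \<phi> * norm c"
      using norm_blinfun[of \<phi> c] by simp
    also have "\<dots> \<le> norm \<phi> * M"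
      using M'[OF that] by (intro mult_left_mono) auto
    finally show ?thesis .
  qed
  have bdd_above: "bdd_above (blinfun_apply \<phi> ` A n)" for \<phi> :: "'a \<Rightarrow>\<^sub>L real" and n
    using bound by (intro bdd_aboveI2[where M = "norm \<phi> * M"]) (auto simp: abs_le_iff)
  have upper: "blinfun_apply \<phi> c \<le> s n \<phi>" if "c \<in> A n" for \<phi> c n
    unfolding s_def by (rule cSUP_upper[OF that bdd_above])
  have least: "s n \<phi> \<le> a" if "\<And>c. c \<in> A n \<Longrightarrow> blinfun_apply \<phi> c \<le> a" for \<phi> n a
    unfolding s_def using ne that by (rule cSUP_least)
  have s_sub: "sublinear (s n)" for n
  proof (rule sublinearI)
    fix \<phi> \<psi>
    show "s n (\<phi> + \<psi>) \<le> s n \<phi> + s n \<psi>"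
      using upper by (intro least) (simp add: blinfun.add_left add_mono)
  next
    obtain c where "c \<in> A n"
      using ne by blast
    then show "s n 0 = 0"
      using upper[of c n 0] by (intro antisym least) auto
  next
    fix b :: real and \<phi>
    assume "0 < b"
    then show "s n (b *\<^sub>R \<phi>) \<le> b * s n \<phi>"
      using upper by (intro least) (simp add: blinfun.scaleR_left)
  qed
  have s_bound: "- (norm \<phi> * M) \<le> s n \<phi>" "s n \<phi> \<le> norm \<phi> * M" for n \<phi>
  proof -
    obtain c where c: "c \<in> A n"
      using ne by blast
    show "- (norm \<phi> * M) \<le> s n \<phi>"
      using upper[OF c, of \<phi>] bound[OF c, of \<phi>] by linarith
    show "s n \<phi> \<le> norm \<phi> * M"
      using bound by (intro least) (auto simp: abs_le_iff)
  qed
  define p where "p = (\<lambda>\<phi>. INF q\<in>range s. q \<phi>)"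
  have bdd_below: "bdd_below ((\<lambda>q. q \<phi>) ` range s)" for \<phi>
    using s_bound(1) by (intro bdd_belowI2[where m = "- (norm \<phi> * M)"]) auto
  have "sublinear p"
    unfolding p_def
  proof (rule sublinear_INF_chain)
    fix q q'
    assume "q \<in> range s" "q' \<in> range s"
    then obtain m n where mn: "q = s m" "q' = s n"
      by auto
    have "s n \<le> s m" if "m \<le> n" for m n
      using upper decseqD[OF dec that] by (auto simp: le_fun_def intro!: least)
    then show "q \<le> q' \<or> q' \<le> q"
      using mn by (meson nle_le)
  qed (use s_sub bdd_below in auto)
  then obtain \<Phi> where \<Phi>: "linear \<Phi>" "\<And>\<phi>. \<Phi> \<phi> \<le> p \<phi>"
    using hahn_banach_sublinear by blast
  have \<Phi>s: "\<Phi> \<phi> \<le> s n \<phi>" for \<phi> n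
  proof -
    have "p \<phi> \<le> s n \<phi>"
      unfolding p_def by (rule cINF_lower[OF bdd_below]) auto
    then show ?thesis
      using \<Phi>(2)[of \<phi>] by linarith
  qed
  have "\<bar>\<Phi> \<phi>\<bar> \<le> norm \<phi> * M" for \<phi>
    using \<Phi>s[of \<phi> 0] \<Phi>s[of "- \<phi>" 0] s_bound(2)[of 0 \<phi>] s_bound(2)[of 0 "- \<phi>"] linear_neg[OF \<Phi>(1), of \<phi>] by simp
  then have lin: "bounded_linear \<Phi>"
    using \<Phi>(1) by (intro bounded_linear_intro[of _ M]) (auto simp: linear_add linear_cmul)
  obtain x where x: "\<And>\<phi>. \<Phi> \<phi> = blinfun_apply \<phi> x"
    using refl[unfolded reflexive_space_def, rule_format, of "Blinfun \<Phi>"]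
    by (auto simp: bounded_linear_Blinfun_apply[OF lin])
  have "x \<in> A n" for n
  proof (rule ccontr)
    assume "x \<notin> A n"
    then have "x \<in> - A n" "open (- A n)"
      using closed by auto
    then obtain d where d: "d > 0" "ball x d \<subseteq> - A n"
      by (meson open_contains_ball)
    have "d \<le> norm (x - c)" if "c \<in> A n" for c
      using d(2) that by (force simp: dist_norm not_less)
    then obtain \<phi> :: "'a \<Rightarrow>\<^sub>L real" where "\<And>c. c \<in> A n \<Longrightarrow> \<phi> c \<le> \<phi> x - d"
      using separating_functional[OF conv d(1)] by blast
    then have "s n \<phi> \<le> \<phi> x - d"
      by (rule least)
    then show False
      using \<Phi>s[of \<phi> n] x[of \<phi>] d(1) by simp
  qed
  then show ?thesis
    by blast
qed

section \<open>Sparse translates of convex sets\<close>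

lemma infdist_le_iff:
  assumes "C \<noteq> {}"
  shows "infdist y C \<le> \<rho> \<longleftrightarrow> (\<forall>\<epsilon>>0. \<exists>c\<in>C. dist y c < \<rho> + \<epsilon>)"
proof
  assume le: "infdist y C \<le> \<rho>"
  show "\<forall>\<epsilon>>0. \<exists>c\<in>C. dist y c < \<rho> + \<epsilon>"
  proof (intro allI impI)
    fix \<epsilon> :: real
    assume "0 < \<epsilon>"
    then have "(INF c\<in>C. dist y c) < \<rho> + \<epsilon>"
      using le assms by (simp add: infdist_notempty)
    then show "\<exists>c\<in>C. dist y c < \<rho> + \<epsilon>"
      using assms by (subst (asm) cINF_less_iff) (auto intro: bdd_belowI2[where m = 0])
  qed
next
  assume R: "\<forall>\<epsilon>>0. \<exists>c\<in>C. dist y c < \<rho> + \<epsilon>"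
  show "infdist y C \<le> \<rho>"
  proof (rule field_le_epsilon)
    fix \<epsilon> :: real
    assume "0 < \<epsilon>"
    then obtain c where "c \<in> C" "dist y c < \<rho> + \<epsilon>"
      using R by blast
    then show "infdist y C \<le> \<rho> + \<epsilon>"
      by (intro infdist_le2[of c]) auto
  qed
qed

definition thickening :: "real \<Rightarrow> 'a::metric_space set \<Rightarrow> 'a set" where
  "thickening \<rho> C = {y. infdist y C \<le> \<rho>}"

lemma closed_thickening: "closed (thickening \<rho> C)"
  unfolding thickening_def by (intro closed_Collect_le continuous_intros)

lemma convex_thickening:
  fixes C :: "'a::real_normed_vector set"
  assumes "convex C" "C \<noteq> {}"
  shows "convex (thickening \<rho> C)"
proof (rule convexI)
  fix x y and u v :: real
  assume xy: "x \<in> thickening \<rho> C" "y \<in> thickening \<rho> C" and uv: "0 \<le> u" "0 \<le> v" "u + v = 1"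
  show "u *\<^sub>R x + v *\<^sub>R y \<in> thickening \<rho> C"
    unfolding thickening_def mem_Collect_eq infdist_le_iff[OF assms(2)]
  proof (intro allI impI)
    fix \<epsilon> :: real
    assume "0 < \<epsilon>"
    then obtain c c' where c: "c \<in> C" "norm (x - c) < \<rho> + \<epsilon>" "c' \<in> C" "norm (y - c') < \<rho> + \<epsilon>"
      using xy unfolding thickening_def mem_Collect_eq infdist_le_iff[OF assms(2)] dist_norm by metis
    have "(u *\<^sub>R x + v *\<^sub>R y) - (u *\<^sub>R c + v *\<^sub>R c') = u *\<^sub>R (x - c) + v *\<^sub>R (y - c')"
      by (simp add: algebra_simps)
    then have "norm ((u *\<^sub>R x + v *\<^sub>R y) - (u *\<^sub>R c + v *\<^sub>R c')) \<le> u * norm (x - c) + v * norm (y - c')"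
      using norm_triangle_ineq[of "u *\<^sub>R (x - c)" "v *\<^sub>R (y - c')"] uv by simp
    also have "\<dots> < \<rho> + \<epsilon>"
      by (rule convex_bound_lt[OF c(2,4) uv])
    finally show "\<exists>c\<in>C. dist (u *\<^sub>R x + v *\<^sub>R y) c < \<rho> + \<epsilon>"
      using convexD[OF assms(1) c(1,3) uv] by (intro bexI[of _ "u *\<^sub>R c + v *\<^sub>R c'"]) (auto simp: dist_norm)
  qed
qed

lemma thickening_thickening_subset:
  assumes "thickening \<rho> C \<noteq> {}"
  shows "thickening \<sigma> (thickening \<rho> C) \<subseteq> thickening (\<sigma> + \<rho>) C"
proof
  fix y
  assume "y \<in> thickening \<sigma> (thickening \<rho> C)"
  then have y: "\<exists>z\<in>thickening \<rho> C. dist y z < \<sigma> + \<epsilon>" if "0 < \<epsilon>" for \<epsilon>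
    using that by (simp add: thickening_def[of \<sigma>] infdist_le_iff[OF assms])
  show "y \<in> thickening (\<sigma> + \<rho>) C"
    unfolding thickening_def mem_Collect_eq
  proof (rule field_le_epsilon)
    fix \<epsilon> :: real
    assume "0 < \<epsilon>"
    then obtain z where "infdist z C \<le> \<rho>" "dist y z < \<sigma> + \<epsilon>"
      using y[of \<epsilon>] unfolding thickening_def by auto
    then show "infdist y C \<le> \<sigma> + \<rho> + \<epsilon>"
      using infdist_triangle[of y C z] by linarith
  qed
qed

lemma bounded_thickening:
  fixes C :: "'a::real_normed_vector set"
  assumes "bounded C" "C \<noteq> {}"
  shows "bounded (thickening \<rho> C)"
proof -
  obtain M where M: "\<And>c. c \<in> C \<Longrightarrow> norm c \<le> M"
    using assms(1) unfolding bounded_iff by blast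
  show ?thesis
    unfolding bounded_iff
  proof (intro exI[of _ "M + (\<rho> + 1)"] ballI)
    fix y
    assume "y \<in> thickening \<rho> C"
    then obtain c where c: "c \<in> C" "dist y c < \<rho> + 1"
      unfolding thickening_def mem_Collect_eq infdist_le_iff[OF assms(2)] by (meson zero_less_one)
    then show "norm y \<le> M + (\<rho> + 1)"
      using M[OF c(1)] norm_triangle_ineq2[of y c] by (simp add: dist_norm)
  qed
qed

text \<open>
  The cancellation law \<open>A + B \<subseteq> C + B \<Longrightarrow> A \<subseteq> C\<close> for a closed convex \<open>C\<close> and a ball \<open>B\<close>. Starting from \<open>b 0 = 0\<close>, each
  \<open>a + b n\<close> is written as an element of \<open>C\<close> plus \<open>b (Suc n)\<close>. Summing these equations shows that the averages of
  the elements of \<open>C\<close> differ from \<open>a\<close> by \<open>b n / n\<close>.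
\<close>
lemma convex_ball_cancellation:
  fixes C :: "'a::real_normed_vector set"
  assumes closed: "closed C" and conv: "convex C" and s: "0 \<le> s"
    and step: "\<And>b. norm b \<le> s \<Longrightarrow> \<exists>c\<in>C. norm (a + b - c) \<le> s"
  shows "a \<in> C"
proof -
  have "\<exists>g. \<forall>b. norm b \<le> s \<longrightarrow> g b \<in> C \<and> norm (a + b - g b) \<le> s"
    using step by metis
  then obtain g where g: "\<And>b. norm b \<le> s \<Longrightarrow> g b \<in> C" "\<And>b. norm b \<le> s \<Longrightarrow> norm (a + b - g b) \<le> s"
    by auto
  define b where "b = rec_nat 0 (\<lambda>_ b. a + b - g b)"
  have b_Suc: "b (Suc n) = a + b n - g (b n)" for n
    by (simp add: b_def)
  have b0: "b 0 = 0"
    by (simp add: b_def)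
  have b: "norm (b n) \<le> s" for n
    by (induction n) (use s g in \<open>auto simp: b_Suc b0\<close>)
  have sum: "(\<Sum>i<n. g (b i)) = real n *\<^sub>R a - b n" for n
    by (induction n) (auto simp: b0 b_Suc algebra_simps)
  define m where "m = (\<lambda>n. a - (1 / real (Suc n)) *\<^sub>R b (Suc n))"
  have "m n \<in> C" for n
  proof -
    have "m n = (\<Sum>i<Suc n. (1 / real (Suc n)) *\<^sub>R g (b i))"
      unfolding m_def scaleR_sum_right[symmetric] sum by (simp add: scaleR_diff_right del: of_nat_Suc)
    also have "\<dots> \<in> C"
      by (rule convex_sum[OF _ conv]) (use g(1) b in \<open>auto simp del: of_nat_Suc\<close>)
    finally show ?thesis .
  qed
  moreover have "m \<longlonglongrightarrow> a"
  proof -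
    have "norm (m n - a) \<le> s * (1 / real (Suc n))" for n
    proof -
      have "m n - a = - ((1 / real (Suc n)) *\<^sub>R b (Suc n))"
        by (simp add: m_def)
      then have "norm (m n - a) = (1 / real (Suc n)) * norm (b (Suc n))"
        by (simp only: norm_minus_cancel norm_scaleR abs_of_nonneg[OF divide_nonneg_nonneg] of_nat_0_le_iff zero_le_one)
      also have "\<dots> \<le> (1 / real (Suc n)) * s"
        using b by (intro mult_left_mono) auto
      finally show ?thesis
        by (simp add: mult.commute)
    qed
    moreover have "(\<lambda>n. s * (1 / real (Suc n))) \<longlonglongrightarrow> 0"
      using tendsto_mult_right_zero[OF lim_1_over_n[THEN LIMSEQ_Suc], of s] by simp
    ultimately show "m \<longlonglongrightarrow> a"
      by (intro LIM_zero_cancel[of m a] Lim_null_comparison[of "\<lambda>n. m n - a"]) auto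
  qed
  ultimately show ?thesis
    using closed closed_sequentially by blast
qed

text \<open>
  An approximate minimax theorem for a game with the finite set \<open>F\<close> on one side. If for all weights on \<open>F\<close> some \<open>x\<close>
  hits more than nine tenths of the total weight, then a finite sequence of elements \<open>x\<close> hits every single
  \<open>f\<close> at least three quarters of the time. The sequence always answers the current weights, and the weight of
  \<open>f\<close> is halved whenever \<open>f\<close> is hit. The total weight then decreases by the factor \<open>11 / 20\<close> in each round, which
  bounds from below the number of halvings of each weight.
\<close>
lemma multiplicative_weights:
  fixes H :: "'x \<Rightarrow> 'f \<Rightarrow> bool"
  assumes F: "finite F" "F \<noteq> {}"
    and often: "\<And>w. (\<And>f. f \<in> F \<Longrightarrow> 0 < w f) \<Longrightarrow> \<exists>x. 9 / 10 * (\<Sum>f\<in>F. w f) < (\<Sum>f\<in>{f\<in>F. H x f}. w f :: real)"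
  obtains T :: nat and xs :: "nat \<Rightarrow> 'x" where "0 < T" "\<And>t. \<exists>f\<in>F. H (xs t) f"
    "\<And>f. f \<in> F \<Longrightarrow> 3 * T \<le> 4 * card {t. t < T \<and> H (xs t) f}"
proof -
  have "\<forall>w. \<exists>x. (\<forall>f\<in>F. 0 < w f) \<longrightarrow> 9 / 10 * (\<Sum>f\<in>F. w f) < (\<Sum>f\<in>{f\<in>F. H x f}. w f :: real)"
    using often by blast
  from choice[OF this] obtain X where X: "\<And>w. \<forall>f\<in>F. 0 < w f \<Longrightarrow>
      9 / 10 * (\<Sum>f\<in>F. w f) < (\<Sum>f\<in>{f\<in>F. H (X w) f}. w f :: real)"
    by blast
  define W where "W = rec_nat (\<lambda>_. 1) (\<lambda>_ w f. w f * (if H (X w) f then 1 / 2 else 1))"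
  define xs where "xs = (\<lambda>n. X (W n))"
  have W0: "W 0 f = 1" for f
    by (simp add: W_def)
  have WS: "W (Suc n) f = W n f * (if H (xs n) f then 1 / 2 else 1)" for n f
    by (simp add: W_def xs_def)
  have W: "0 < W n f" for n f
    by (induction n) (auto simp: W0 WS)
  have hit: "9 / 10 * (\<Sum>f\<in>F. W n f) < (\<Sum>f\<in>{f\<in>F. H (xs n) f}. W n f)" for n
    unfolding xs_def using W by (intro X) auto
  have W_pow: "W n f = (1 / 2) ^ card {t. t < n \<and> H (xs t) f}" for n f
  proof (induction n)
    case (Suc n)
    show ?case
    proof (cases "H (xs n) f")
      case True
      then have "{t. t < Suc n \<and> H (xs t) f} = insert n {t. t < n \<and> H (xs t) f}"
        by (auto simp: less_Suc_eq)
      then show ?thesis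
        using True Suc by (simp add: WS)
    next
      case False
      then have "{t. t < Suc n \<and> H (xs t) f} = {t. t < n \<and> H (xs t) f}"
        by (auto simp: less_Suc_eq)
      then show ?thesis
        using False Suc by (simp add: WS)
    qed
  qed (simp add: W0)
  have total: "(\<Sum>f\<in>F. W n f) \<le> real (card F) * (11 / 20) ^ n" for n
  proof (induction n)
    case (Suc n)
    have "(\<Sum>f\<in>F. W (Suc n) f) = (\<Sum>f\<in>F. W n f - (if H (xs n) f then W n f / 2 else 0))"
      by (intro sum.cong) (auto simp: WS)
    also have "\<dots> = (\<Sum>f\<in>F. W n f) - (\<Sum>f\<in>{f\<in>F. H (xs n) f}. W n f) / 2"
      using F(1) by (simp add: sum_subtractf sum.If_cases Int_def sum_divide_distrib)
    also have "\<dots> \<le> 11 / 20 * (\<Sum>f\<in>F. W n f)"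
      using hit[of n] by simp
    also have "\<dots> \<le> 11 / 20 * (real (card F) * (11 / 20) ^ n)"
      using Suc by (intro mult_left_mono) auto
    finally show ?case
      by simp
  qed (simp add: W0)
  have cF: "0 < real (card F)"
    using F by (simp add: card_gt_0_iff)
  (* 14641 / 20000 is (11 / 20) ^ 4 divided by (1 / 2) ^ 3: in four rounds the total weight decreases
     by more than three halvings would achieve *)
  obtain S :: nat where S: "(14641 / 20000 :: real) ^ S < 1 / real (card F)"
    using real_arch_pow_inv[of "1 / real (card F)" "14641 / 20000"] cF by auto
  have S0: "0 < S"
  proof (rule ccontr)
    assume "\<not> 0 < S"
    then have "1 < 1 / real (card F)"
      using S by simp
    then show False
      using cF by (simp add: field_simps)
  qed
  show thesis
  proof (rule that[of "4 * S" xs])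
    show "0 < 4 * S"
      using S0 by simp
  next
    fix t
    show "\<exists>f\<in>F. H (xs t) f"
    proof (rule ccontr)
      assume "\<not> (\<exists>f\<in>F. H (xs t) f)"
      then have none: "{f\<in>F. H (xs t) f} = {}"
        by auto
      have "9 / 10 * (\<Sum>f\<in>F. W t f) < 0"
        using hit[of t] unfolding none sum.empty .
      then have "(\<Sum>f\<in>F. W t f) < 0"
        by simp
      moreover have "0 \<le> (\<Sum>f\<in>F. W t f)"
        using W by (intro sum_nonneg) (auto intro: less_imp_le)
      ultimately show False
        by simp
    qed
  next
    fix f
    assume f: "f \<in> F"
    let ?h = "card {t. t < 4 * S \<and> H (xs t) f}"
    have "(1 / 2) ^ ?h = W (4 * S) f"
      by (rule W_pow[symmetric])
    also have "\<dots> \<le> (\<Sum>f\<in>F. W (4 * S) f)"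
      using F(1) f W by (intro member_le_sum) (auto intro: less_imp_le)
    also have "\<dots> \<le> real (card F) * (11 / 20) ^ (4 * S)"
      by (rule total)
    also have "(11 / 20 :: real) ^ (4 * S) = (1 / 8) ^ S * (14641 / 20000) ^ S"
      by (simp add: power_mult power_mult_distrib[symmetric] power4_eq_xxxx)
    also have "real (card F) * ((1 / 8) ^ S * (14641 / 20000) ^ S) < (1 / 8) ^ S"
      using S cF by (simp add: field_simps)
    also have "(1 / 8 :: real) ^ S = (1 / 2) ^ (3 * S)"
      by (simp add: power_mult power3_eq_cube)
    finally have "(1 / 2 :: real) ^ ?h < (1 / 2) ^ (3 * S)" .
    then have "3 * S < ?h"
      by (subst (asm) power_strict_decreasing_iff) auto
    then show "3 * (4 * S) \<le> 4 * ?h"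
      by simp
  qed
qed

lemma weighted_pmf:
  fixes w :: "'f \<Rightarrow> real"
  assumes F: "finite F" "F \<noteq> {}" and w: "\<And>f. f \<in> F \<Longrightarrow> 0 < w f"
  obtains \<nu> where "set_pmf \<nu> = F" "\<And>S. measure_pmf.prob \<nu> S = (\<Sum>f\<in>F \<inter> S. w f) / (\<Sum>f\<in>F. w f)"
proof -
  define W where "W = (\<Sum>f\<in>F. w f)"
  have W: "0 < W"
    unfolding W_def using F w by (intro sum_pos) auto
  define g where "g = (\<lambda>f. if f \<in> F then w f / W else 0)"
  have g: "0 \<le> g f" for f
    using w W by (auto simp: g_def intro: less_imp_le)
  have "(\<integral>\<^sup>+f. ennreal (g f) \<partial>count_space UNIV) = (\<Sum>f\<in>F. ennreal (g f))"
    using F(1) by (intro nn_integral_count_space') (auto simp: g_def)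
  also have "\<dots> = ennreal (\<Sum>f\<in>F. g f)"
    using g by (intro sum_ennreal) auto
  also have "(\<Sum>f\<in>F. g f) = 1"
    using W by (simp add: g_def sum_divide_distrib[symmetric] W_def[symmetric])
  finally have one: "(\<integral>\<^sup>+f. ennreal (g f) \<partial>count_space UNIV) = 1"
    by simp
  define \<nu> where "\<nu> = embed_pmf g"
  have pmf: "pmf \<nu> f = g f" for f
    unfolding \<nu>_def by (rule pmf_embed_pmf[OF g one])
  have set: "set_pmf \<nu> = F"
    using w W by (force simp: set_pmf_eq pmf g_def)
  have "measure_pmf.prob \<nu> S = (\<Sum>f\<in>F \<inter> S. w f) / W" for S
  proof -
    have "measure_pmf.prob \<nu> S = measure_pmf.prob \<nu> (F \<inter> S)"
      using measure_Int_set_pmf[of \<nu> S] by (simp add: set Int_commute)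
    also have "\<dots> = (\<Sum>f\<in>F \<inter> S. g f)"
      using F(1) by (simp add: measure_measure_pmf_finite pmf)
    also have "\<dots> = (\<Sum>f\<in>F \<inter> S. w f) / W"
      by (simp add: g_def sum_divide_distrib)
    finally show ?thesis .
  qed
  then show thesis
    using that set unfolding W_def by blast
qed

text \<open>
  The average \<open>x\<close> of the translation vectors is the desired one. In at least three quarters of the rounds \<open>f\<close> is
  translated into \<open>C\<close>, and in the other rounds it lands within \<open>2 * r\<close> of \<open>C\<close>, since some other element of \<open>F\<close> is
  translated into \<open>C\<close>. By convexity \<open>f + x\<close> is within \<open>(1 / 4) * (2 * r)\<close> of \<open>C\<close>.
\<close>
lemma translate_of_finite_set_in_thickening:
  fixes C :: "'a::real_normed_vector set"
  assumes conv: "convex C" and F: "finite F" "F \<noteq> {}" "F \<subseteq> cball 0 r"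
    and often: "\<And>\<nu>. finite (set_pmf \<nu>) \<Longrightarrow> set_pmf \<nu> \<subseteq> cball 0 r \<Longrightarrow>
      \<exists>x. 9 / 10 < measure_pmf.prob \<nu> {f. f + x \<in> C}"
  shows "\<exists>x. \<forall>f\<in>F. f + x \<in> thickening (r / 2) C"
proof -
  have "\<exists>x. 9 / 10 * (\<Sum>f\<in>F. w f) < (\<Sum>f\<in>{f\<in>F. f + x \<in> C}. w f)"
    if w: "\<And>f. f \<in> F \<Longrightarrow> 0 < w f" for w :: "'a \<Rightarrow> real"
  proof -
    obtain \<nu> where \<nu>: "set_pmf \<nu> = F" "\<And>S. measure_pmf.prob \<nu> S = (\<Sum>f\<in>F \<inter> S. w f) / (\<Sum>f\<in>F. w f)"
      using weighted_pmf[where w = w, OF F(1,2) w] by blast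
    obtain x where x: "9 / 10 < measure_pmf.prob \<nu> {f. f + x \<in> C}"
      using often[of \<nu>] \<nu>(1) F by auto
    have "0 < (\<Sum>f\<in>F. w f)"
      using F w by (intro sum_pos) auto
    then show ?thesis
      using x unfolding \<nu>(2) Int_def by (intro exI[of _ x]) (simp add: pos_less_divide_eq)
  qed
  then obtain T :: nat and xs where T: "0 < T" "\<And>t. \<exists>f\<in>F. f + xs t \<in> C"
      "\<And>f. f \<in> F \<Longrightarrow> 3 * T \<le> 4 * card {t. t < T \<and> f + xs t \<in> C}"
    using multiplicative_weights[OF F(1,2), of "\<lambda>x f. f + x \<in> C"] by blast
  obtain g where g: "\<And>t. g t \<in> F" "\<And>t. g t + xs t \<in> C"
    using T(2) by metis
  define x where "x = (1 / real T) *\<^sub>R (\<Sum>t<T. xs t)"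
  have "f + x \<in> thickening (r / 2) C" if f: "f \<in> F" for f
  proof -
    define c where "c = (\<lambda>t. if f + xs t \<in> C then f + xs t else g t + xs t)"
    define c' where "c' = (\<Sum>t<T. (1 / real T) *\<^sub>R c t)"
    have "c' \<in> C"
      unfolding c'_def using T(1) g(2)
      by (intro convex_sum[OF _ conv]) (auto simp: c_def)
    moreover have "dist (f + x) c' \<le> r / 2"
    proof -
      let ?M = "{t. t < T \<and> f + xs t \<in> C}"
      have fx: "f + x = (\<Sum>t<T. (1 / real T) *\<^sub>R (f + xs t))"
        unfolding x_def scaleR_sum_right[symmetric] sum.distrib using T(1) by (simp add: scaleR_add_right sum_constant_scaleR)
      have "norm ((f + xs t) - c t) \<le> (if t \<in> ?M then 0 else 2 * r)" if "t < T" for t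
      proof (cases "f + xs t \<in> C")
        case False
        have "norm (f - g t) \<le> norm f + norm (g t)"
          by (rule norm_triangle_ineq4)
        also have "norm f \<le> r"
          using F(3) f by auto
        also have "norm (g t) \<le> r"
          using F(3) g(1)[of t] by auto
        finally show ?thesis
          using False that by (simp add: c_def)
      qed (use that in \<open>simp add: c_def\<close>)
      then have "(\<Sum>t<T. norm ((f + xs t) - c t)) \<le> (\<Sum>t<T. if t \<in> ?M then 0 else 2 * r)"
        by (intro sum_mono) auto
      also have "\<dots> = (\<Sum>t\<in>{..<T} - ?M. 2 * r)"
        by (rule sum.mono_neutral_cong_right) auto
      also have "\<dots> = real (card ({..<T} - ?M)) * (2 * r)"
        by (rule sum_constant)
      also have "real (card ({..<T} - ?M)) = real T - real (card ?M)"
      proof -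
        have "card ?M \<le> T"
          using card_mono[of "{..<T}" ?M] by auto
        then show ?thesis
          by (subst card_Diff_subset) (auto simp: of_nat_diff)
      qed
      also have "(real T - real (card ?M)) * (2 * r) \<le> (real T / 4) * (2 * r)"
      proof (intro mult_right_mono)
        have "real (3 * T) \<le> real (4 * card ?M)"
          using T(3)[OF f] of_nat_le_iff by blast
        then show "real T - real (card ?M) \<le> real T / 4"
          by simp
        show "0 \<le> 2 * r"
          using F(2,3) norm_ge_zero order_trans by fastforce
      qed
      finally have sum: "(\<Sum>t<T. norm ((f + xs t) - c t)) \<le> real T * (r / 2)"
        by (simp add: mult.commute)
      have "dist (f + x) c' = norm (\<Sum>t<T. (1 / real T) *\<^sub>R ((f + xs t) - c t))"
        unfolding dist_norm fx c'_def by (simp add: sum_subtractf[symmetric] scaleR_diff_right)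
      also have "\<dots> \<le> (\<Sum>t<T. (1 / real T) * norm ((f + xs t) - c t))"
        using T(1) by (intro sum_norm_le) simp
      also have "\<dots> = (1 / real T) * (\<Sum>t<T. norm ((f + xs t) - c t))"
        by (rule sum_distrib_left[symmetric])
      also have "\<dots> \<le> (1 / real T) * (real T * (r / 2))"
        using sum by (intro mult_left_mono) auto
      finally show ?thesis
        using T(1) by simp
    qed
    ultimately show ?thesis
      unfolding thickening_def mem_Collect_eq by (rule infdist_le2)
  qed
  then show ?thesis
    by blast
qed

lemma bounded_translate:
  fixes T :: "'a::real_normed_vector set"
  assumes "bounded T"
  shows "bounded ((+) a ` T)"
  using bounded_translation[OF assms, of a] by simp

text \<open>
  Otherwise each finite subset of the ball of radius \<open>r\<close> has a translate in the thickening of \<open>C\<close> by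
  \<open>r / 2 + r / 8\<close>, and by weak compactness so has the ball itself. As this width is smaller than \<open>r\<close>, cancellation
  would leave a ball of radius \<open>r / 4\<close> in \<open>C\<close>. The thickening by \<open>r / 8\<close> in the conclusion is the margin for the
  convolution in the next lemma.
\<close>
lemma sparse_translates:
  fixes C :: "'a::{real_normed_vector, second_countable_topology} set"
  assumes refl: "reflexive_space TYPE('a)"
    and C: "closed C" "convex C" "bounded C" "C \<noteq> {}" "interior C = {}" and r: "0 < r"
  shows "\<exists>\<nu>. finite (set_pmf \<nu>) \<and> set_pmf \<nu> \<subseteq> cball 0 r \<and>
    (\<forall>x. measure_pmf.prob \<nu> {f. f + x \<in> thickening (r / 8) C} \<le> 9 / 10)"
proof (rule ccontr)
  assume neg: "\<not> ?thesis"
  have often: "\<exists>x. 9 / 10 < measure_pmf.prob \<nu> {f. f + x \<in> thickening (r / 8) C}"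
    if "finite (set_pmf \<nu>)" "set_pmf \<nu> \<subseteq> cball 0 r" for \<nu>
    using neg that by (auto simp: not_le)
  have "C \<subseteq> thickening (r / 8) C"
    using r by (auto simp: thickening_def)
  then have ne: "thickening (r / 8) C \<noteq> {}"
    using C(4) by auto
  obtain Q where Q: "countable Q" "Q \<subseteq> cball 0 r" "cball (0::'a) r \<subseteq> closure Q"
    using separable[of "cball (0::'a) r"] by blast
  have "Q \<noteq> {}"
    using Q(3) r by auto
  define d where "d = from_nat_into Q"
  have d: "range d = Q"
    unfolding d_def using Q(1) \<open>Q \<noteq> {}\<close> by (intro range_from_nat_into)
  let ?D = "thickening (r / 2 + r / 8) C"
  define A where "A = (\<lambda>n. \<Inter>i\<le>n. (+) (- d i) ` ?D)"
  have in_A: "x \<in> A n \<longleftrightarrow> (\<forall>i\<le>n. d i + x \<in> ?D)" for x n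
    unfolding A_def INT_iff in_translate_iff by (simp add: add.commute Ball_def)
  have "(\<Inter>n. A n) \<noteq> {}"
  proof (rule reflexive_nested_convex_INT[OF refl])
    fix n
    show "closed (A n)"
      unfolding A_def by (intro closed_INT ballI closed_translation closed_thickening)
    show "convex (A n)"
      unfolding A_def using convex_thickening[OF C(2,4)] by (intro convex_INT convex_translation) auto
    have "finite (d ` {..n})" "d ` {..n} \<noteq> {}" "d ` {..n} \<subseteq> cball 0 r"
      using d Q(2) by auto
    from translate_of_finite_set_in_thickening[OF convex_thickening[OF C(2,4)] this often]
    obtain x where "\<forall>f\<in>d ` {..n}. f + x \<in> thickening (r / 2) (thickening (r / 8) C)"
      by blast
    then have "x \<in> A n"
      using thickening_thickening_subset[OF ne, of "r / 2"] unfolding in_A by auto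
    then show "A n \<noteq> {}"
      by auto
  next
    show "decseq A"
      by (rule decseq_SucI) (auto simp: in_A)
    have "bounded ((+) (- d 0) ` ?D)"
      by (rule bounded_translate[OF bounded_thickening[OF C(3,4)]])
    then show "bounded (A 0)"
      by (simp add: A_def)
  qed
  then obtain x where "x \<in> (\<Inter>n. A n)"
    by blast
  then have x: "d n + x \<in> ?D" for n
    using in_A[of x n] by auto
  have near: "y + x \<in> ?D" if "norm y \<le> r" for y
  proof -
    have "closed ((\<lambda>y. y + x) -` ?D)"
      by (intro closed_vimage closed_thickening continuous_intros)
    moreover have "Q \<subseteq> (\<lambda>y. y + x) -` ?D"
      using x d by auto
    ultimately have "closure Q \<subseteq> (\<lambda>y. y + x) -` ?D"
      by (rule closure_minimal[rotated])
    then show ?thesis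
      using Q(3) that by auto
  qed
  have "ball x (r / 4) \<subseteq> C"
  proof
    fix z
    assume z: "z \<in> ball x (r / 4)"
    show "z \<in> C"
    proof (rule convex_ball_cancellation[OF C(1,2), of "3 * r / 4"])
      fix b :: 'a
      assume b: "norm b \<le> 3 * r / 4"
      have "norm (z - x + b) \<le> norm (z - x) + norm b"
        by (rule norm_triangle_ineq)
      then have "norm (z - x + b) \<le> r"
        using z b by (simp add: dist_norm norm_minus_commute)
      then have "z + b \<in> ?D"
        using near[of "z - x + b"] by (simp add: algebra_simps)
      then have "\<forall>\<epsilon>>0. \<exists>c\<in>C. dist (z + b) c < r / 2 + r / 8 + \<epsilon>"
        unfolding thickening_def mem_Collect_eq infdist_le_iff[OF C(4)] .
      moreover have "0 < r / 8"
        using r by simp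
      ultimately obtain c where "c \<in> C" "dist (z + b) c < r / 2 + r / 8 + r / 8"
        by blast
      then show "\<exists>c\<in>C. norm (z + b - c) \<le> 3 * r / 4"
        by (intro bexI[of _ c]) (auto simp: dist_norm)
    qed (use r in simp)
  qed
  then have "x \<in> interior C"
    using r by (intro interiorI[of "ball x (r / 4)"]) auto
  then show False
    using C(5) by simp
qed

text \<open>
  The measure for \<open>k\<close> is convolved with one that lives on the much smaller scale \<open>s\<close>. If the sum \<open>a + b\<close> is
  translated close to \<open>C\<close>, then so is \<open>a\<close> because \<open>b\<close> is tiny; and given \<open>a\<close>, the second measure contributes another
  factor \<open>9 / 10\<close>.
\<close>
lemma sparse_translates_power:
  fixes C :: "'a::{real_normed_vector, second_countable_topology} set"
  assumes refl: "reflexive_space TYPE('a)"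
    and C: "closed C" "convex C" "bounded C" "C \<noteq> {}" "interior C = {}" and r: "0 < r"
  shows "\<exists>\<nu>. finite (set_pmf \<nu>) \<and> set_pmf \<nu> \<subseteq> cball 0 r \<and>
    (\<exists>\<rho>>0. \<forall>x. measure_pmf.prob \<nu> {f. f + x \<in> thickening \<rho> C} \<le> (9 / 10) ^ k)"
  using r
proof (induction k arbitrary: r)
  case 0
  then show ?case
    by (intro exI[of _ "return_pmf 0"] conjI exI[of _ 1]) auto
next
  case (Suc k)
  obtain \<nu> \<rho> where \<nu>: "finite (set_pmf \<nu>)" "set_pmf \<nu> \<subseteq> cball 0 (r / 2)" "\<rho> > 0"
      "\<And>x. measure_pmf.prob \<nu> {f. f + x \<in> thickening \<rho> C} \<le> (9 / 10) ^ k"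
    using Suc.IH[of "r / 2"] Suc.prems by auto
  define s where "s = min (\<rho> / 2) (r / 2)"
  have s: "0 < s" "s \<le> \<rho> / 2" "s \<le> r / 2"
    using \<nu>(3) Suc.prems by (auto simp: s_def)
  define \<rho>' where "\<rho>' = s / 8"
  have \<rho>': "\<rho>' > 0" "\<rho>' \<le> \<rho> / 2"
    using s(1,2) by (auto simp: \<rho>'_def)
  obtain \<nu>' where \<nu>': "finite (set_pmf \<nu>')" "set_pmf \<nu>' \<subseteq> cball 0 s"
      "\<And>x. measure_pmf.prob \<nu>' {f. f + x \<in> thickening \<rho>' C} \<le> 9 / 10"
    using sparse_translates[OF refl C s(1)] unfolding \<rho>'_def by blast
  define \<kappa> where "\<kappa> = bind_pmf \<nu> (\<lambda>a. map_pmf (\<lambda>b. a + b) \<nu>')"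
  have set: "set_pmf \<kappa> = (\<Union>a\<in>set_pmf \<nu>. (\<lambda>b. a + b) ` set_pmf \<nu>')"
    by (simp add: \<kappa>_def)
  have "finite (set_pmf \<kappa>)"
    unfolding set using \<nu>(1) \<nu>'(1) by auto
  moreover have "set_pmf \<kappa> \<subseteq> cball 0 r"
    unfolding set
  proof (intro UN_least image_subsetI)
    fix a b
    assume "a \<in> set_pmf \<nu>" "b \<in> set_pmf \<nu>'"
    then have "norm a \<le> r / 2" "norm b \<le> r / 2"
      using \<nu>(2) \<nu>'(2) s(3) by (auto simp: subset_iff intro: order_trans)
    then show "a + b \<in> cball 0 r"
      using norm_triangle_ineq[of a b] by simp
  qed
  moreover have "measure_pmf.prob \<kappa> {f. f + x \<in> thickening \<rho>' C} \<le> (9 / 10) ^ Suc k" for x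
  proof -
    have pointwise: "emeasure \<nu>' {b. a + b + x \<in> thickening \<rho>' C}
        \<le> ennreal (9 / 10) * indicator {f. f + x \<in> thickening \<rho> C} a" for a
    proof (cases "a + x \<in> thickening \<rho> C")
      case True
      have "measure_pmf.prob \<nu>' {b. a + b + x \<in> thickening \<rho>' C}
          \<le> measure_pmf.prob \<nu>' {b. b + (a + x) \<in> thickening \<rho>' C}"
        by (intro measure_pmf.finite_measure_mono) (auto simp: add_ac)
      also have "\<dots> \<le> 9 / 10"
        by (rule \<nu>'(3))
      finally show ?thesis
        using True by (simp add: measure_pmf.emeasure_eq_measure ennreal_leI)
    next
      case False
      have "a + b + x \<notin> thickening \<rho>' C" if b: "b \<in> set_pmf \<nu>'" for b
      proof
        assume "a + b + x \<in> thickening \<rho>' C"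
        then have "infdist (a + b + x) C \<le> \<rho> / 2"
          using \<rho>'(2) by (simp add: thickening_def)
        moreover have "dist (a + x) (a + b + x) \<le> \<rho> / 2"
          using \<nu>'(2) b s(2) by (force simp: dist_norm)
        ultimately have "infdist (a + x) C \<le> \<rho>"
          using infdist_triangle[of "a + x" C "a + b + x"] by linarith
        then show False
          using False by (simp add: thickening_def)
      qed
      then have "set_pmf \<nu>' \<inter> {b. a + b + x \<in> thickening \<rho>' C} = {}"
        by auto
      then have "measure_pmf.prob \<nu>' {b. a + b + x \<in> thickening \<rho>' C} = 0"
        by (simp add: measure_pmf_zero_iff)
      then show ?thesis
        by (simp add: measure_pmf.emeasure_eq_measure)
    qed
    have "emeasure \<kappa> {f. f + x \<in> thickening \<rho>' C} = (\<integral>\<^sup>+a. emeasure \<nu>' {b. a + b + x \<in> thickening \<rho>' C} \<partial>\<nu>)"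
      by (simp add: \<kappa>_def vimage_def)
    also have "\<dots> \<le> (\<integral>\<^sup>+a. ennreal (9 / 10) * indicator {f. f + x \<in> thickening \<rho> C} a \<partial>\<nu>)"
      by (intro nn_integral_mono pointwise)
    also have "\<dots> = ennreal (9 / 10) * emeasure \<nu> {f. f + x \<in> thickening \<rho> C}"
      by (simp add: nn_integral_cmult_indicator)
    also have "\<dots> \<le> ennreal (9 / 10) * ennreal ((9 / 10) ^ k)"
      using \<nu>(4)[of x] by (intro mult_left_mono) (auto simp: measure_pmf.emeasure_eq_measure intro: ennreal_leI)
    also have "\<dots> = ennreal ((9 / 10) ^ Suc k)"
      by (simp add: ennreal_mult[symmetric])
    finally show ?thesis
      by (simp add: measure_pmf.emeasure_eq_measure ennreal_le_iff)
  qed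
  ultimately show ?case
    using \<rho>'(1) by blast
qed

text \<open>
  The bounded parts \<open>B k\<close> of \<open>C\<close> increase with \<open>k\<close>. The random series built from a \<open>(9 / 10) ^ k\<close>-sparse measure for each
  \<open>B k\<close> gives every translate of \<open>B n\<close> at most the mass \<open>(9 / 10) ^ k\<close> for all \<open>k \<ge> n\<close>, hence no mass.
\<close>
theorem haar_null_closed_convex:
  fixes C :: "'a::{banach, second_countable_topology} set"
  assumes refl: "reflexive_space TYPE('a)"
    and C: "closed C" "convex C" "interior C = {}"
  shows "haar_null C"
proof -
  define B where "B = (\<lambda>k. C \<inter> cball 0 (real k))"
  have B: "closed (B k)" "convex (B k)" "bounded (B k)" "interior (B k) = {}" for k
    using C interior_mono[of "B k" C] by (auto simp: B_def convex_Int closed_Int intro: bounded_subset[OF bounded_cball])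
  have "\<exists>\<nu>. finite (set_pmf \<nu>) \<and> set_pmf \<nu> \<subseteq> cball 0 ((1 / 2) ^ k) \<and>
      (\<forall>x. measure_pmf.prob \<nu> {f. f + x \<in> B k} \<le> (9 / 10) ^ k)" for k
  proof (cases "B k = {}")
    case True
    then show ?thesis
      by (intro exI[of _ "return_pmf 0"]) auto
  next
    case False
    obtain \<nu> \<rho> where \<nu>: "finite (set_pmf \<nu>)" "set_pmf \<nu> \<subseteq> cball 0 ((1 / 2) ^ k)" "\<rho> > 0"
        "\<And>x. measure_pmf.prob \<nu> {f. f + x \<in> thickening \<rho> (B k)} \<le> (9 / 10) ^ k"
      using sparse_translates_power[OF refl B(1-3) False B(4), of "(1 / 2) ^ k" k] by auto
    have "measure_pmf.prob \<nu> {f. f + x \<in> B k} \<le> (9 / 10) ^ k" for x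
    proof -
      have "measure_pmf.prob \<nu> {f. f + x \<in> B k} \<le> measure_pmf.prob \<nu> {f. f + x \<in> thickening \<rho> (B k)}"
        using \<nu>(3) by (intro measure_pmf.finite_measure_mono) (auto simp: thickening_def)
      then show ?thesis
        using \<nu>(4)[of x] by linarith
    qed
    then show ?thesis
      using \<nu>(1,2) by blast
  qed
  then obtain \<nu> where \<nu>: "\<And>k. set_pmf (\<nu> k) \<subseteq> cball 0 ((1 / 2) ^ k)"
      "\<And>k x. measure_pmf.prob (\<nu> k) {f. f + x \<in> B k} \<le> (9 / 10) ^ k"
    by metis
  define M where "M = (\<lambda>k. distr (measure_pmf (\<nu> k)) borel (\<lambda>x. x))"
  have sets_M: "sets (M k) = sets borel" for k
    by (simp add: M_def)
  have prob_M: "prob_space (M k)" for k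
    unfolding M_def by (intro measure_pmf.prob_space_distr) simp
  have small: "AE x in M k. norm x \<le> (1 / 2) ^ k" for k
    unfolding M_def using \<nu>(1)[of k] by (subst AE_distr_iff) (auto simp: AE_measure_pmf_iff)
  obtain \<mu> :: "'a measure" where \<mu>: "sets \<mu> = sets borel" "prob_space \<mu>"
    "\<forall>n. \<forall>S\<in>sets borel. \<forall>\<epsilon>. (\<forall>x. emeasure (M n) ((+) x ` S) \<le> \<epsilon>) \<longrightarrow>
       (\<forall>x. emeasure \<mu> ((+) x ` S) \<le> \<epsilon>)"
    using random_series[of M, OF sets_M prob_M small] by blast
  have B_borel: "B k \<in> sets borel" for k
    using B(1) by auto
  have bound: "emeasure \<mu> ((+) x ` B k) \<le> ennreal ((9 / 10) ^ k)" for x k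
  proof (rule \<mu>(3)[rule_format, OF B_borel])
    fix x
    have "(+) x ` B k = {f. f + (- x) \<in> B k}"
      unfolding set_eq_iff in_translate_iff by simp
    then have "emeasure (M k) ((+) x ` B k) = emeasure (\<nu> k) {f. f + (- x) \<in> B k}"
      unfolding M_def using translate_borel[OF B_borel[of k], of x] by (subst emeasure_distr) auto
    then show "emeasure (M k) ((+) x ` B k) \<le> ennreal ((9 / 10) ^ k)"
      using \<nu>(2)[of k "- x"] by (simp add: measure_pmf.emeasure_eq_measure ennreal_leI)
  qed
  have null: "emeasure \<mu> ((+) x ` B n) = 0" for x n
  proof -
    have "(\<lambda>k. (9 / 10 :: real) ^ k) \<longlonglongrightarrow> 0"
      by (rule LIMSEQ_realpow_zero) auto
    then have lim: "(\<lambda>k. ennreal ((9 / 10) ^ k)) \<longlonglongrightarrow> ennreal 0"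
      by (rule tendsto_ennrealI)
    have le: "emeasure \<mu> ((+) x ` B n) \<le> ennreal ((9 / 10) ^ k)" if "n \<le> k" for k
    proof -
      have "B n \<subseteq> B k"
        using that by (auto simp: B_def intro: order_trans)
      then have "emeasure \<mu> ((+) x ` B n) \<le> emeasure \<mu> ((+) x ` B k)"
        using translate_borel[OF B_borel[of k], of x] \<mu>(1) by (intro emeasure_mono image_mono) auto
      then show ?thesis
        using bound[of x k] by (rule order_trans)
    qed
    have "\<exists>N. \<forall>k\<ge>N. emeasure \<mu> ((+) x ` B n) \<le> ennreal ((9 / 10) ^ k)"
      using le by blast
    with lim have "emeasure \<mu> ((+) x ` B n) \<le> ennreal 0"
      by (rule LIMSEQ_le_const)
    then show ?thesis
      by simp
  qed
  have C_eq: "C = (\<Union>n. B n)"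
    using real_arch_simple by (auto simp: B_def)
  have "emeasure \<mu> ((+) x ` C) = 0" for x
  proof -
    have "(\<Union>n. (+) x ` B n) \<in> null_sets \<mu>"
      using null translate_borel[OF B_borel] \<mu>(1) by (intro null_sets_UN) auto
    then show ?thesis
      unfolding C_eq image_UN by (rule null_setsD1)
  qed
  then show ?thesis
    unfolding haar_null_def using \<mu>(1,2) C(1) by (intro conjI exI[of _ \<mu>]) auto
qed

section \<open>Differentiability of strictly quasiconvex functions\<close>

theorem corollary5p6:
  fixes f :: "'a::{banach, second_countable_topology} \<Rightarrow> real"
    and m :: ereal
  assumes nontrivial: "\<exists>x::'a. x \<noteq> 0"
    and quasiconvex: "strictly_quasiconvex f"
    and continuous: "densely_continuous f"
    and m: "m = top_ess_inf f"
  shows "nowhere_dense (sublevel f m) \<and>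
         (\<exists>U. open U \<and> closure U = UNIV \<and>
              holds_except aronszajn_null U (hadamard_differentiable f)) \<and>
         ((\<exists>N. aronszajn_null N \<and> sublevel f m \<subseteq> N) \<longrightarrow>
              holds_except aronszajn_null UNIV (hadamard_differentiable f)) \<and>
         ((\<exists>N. haar_null N \<and> sublevel f m \<subseteq> N) \<longrightarrow>
              holds_except haar_null UNIV (hadamard_differentiable f)) \<and>
         (reflexive_space TYPE('a) \<longrightarrow>
              holds_except haar_null UNIV (hadamard_differentiable f))"
proof -
  have nd: "nowhere_dense (sublevel f m)"
    unfolding m by (rule nowhere_dense_sublevel_top_ess_inf[OF nontrivial quasiconvex continuous])
  obtain N where N: "aronszajn_null N"
      "\<And>x. x \<notin> N \<Longrightarrow> x \<notin> sublevel f m \<Longrightarrow> hadamard_differentiable f x"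
    using hadamard_ae_above_top_ess_inf[OF quasiconvex continuous] unfolding m by blast
  have "holds_except aronszajn_null (- closure (sublevel f m)) (hadamard_differentiable f)"
    unfolding holds_except_def using N closure_subset[of "sublevel f m"] by blast
  moreover have "closure (- closure (sublevel f m)) = UNIV"
    using nd unfolding nowhere_dense_def closure_complement by simp
  ultimately have dense_open: "\<exists>U. open U \<and> closure U = UNIV \<and>
      holds_except aronszajn_null U (hadamard_differentiable f)"
    by (intro exI[of _ "- closure (sublevel f m)"]) (simp add: open_Compl)
  have aronszajn: "holds_except aronszajn_null UNIV (hadamard_differentiable f)"
    if "aronszajn_null N'" "sublevel f m \<subseteq> N'" for N'
    unfolding holds_except_def
    using aronszajn_null_Un[OF N(1) that(1)] N(2) that(2) by (intro exI[of _ "N \<union> N'"]) auto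
  have haar: "holds_except haar_null UNIV (hadamard_differentiable f)"
    if "haar_null N'" "sublevel f m \<subseteq> N'" for N'
    unfolding holds_except_def
    using haar_null_Un[OF aronszajn_null_imp_haar_null[OF N(1)] that(1)] N(2) that(2)
    by (intro exI[of _ "N \<union> N'"]) auto
  have reflexive: "holds_except haar_null UNIV (hadamard_differentiable f)"
    if refl: "reflexive_space TYPE('a)"
  proof (rule haar)
    show "haar_null (closure (sublevel f m))"
      using nd unfolding nowhere_dense_def
      by (intro haar_null_closed_convex[OF refl] closed_closure convex_closure convex_sublevel[OF quasiconvex])
  qed (rule closure_subset)
  show ?thesis
    using nd dense_open aronszajn haar reflexive by blast
qed

end
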